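(* Suppose the setting and assumptions (P), (W) and (F1) described in the context hold, with (P) holding for $k=1$. Then, for any $J\in\mathbb{N}$ and any $\underline{s}_j\in\mathcal S$, $j=1,\dots,J$, \[ \biggl(\sum_{t=1}^{T}w_{t,T}\,\bar{f}\left(\underline{s}_j,\underline{X}_{t,T}\right),\;j=1,\dots,J\biggr)\overset{d}{\longrightarrow}\mathcal{N}\left(\underline 0,\mathbf{V}\right) \] as $T\to\infty$, where $\mathbf{V}=\left(\mathbf{V}(\underline{s}_{j_1},\underline{s}_{j_2})\right)_{j_1,j_2=1,\dots,J}$ is the $(J\times J)$ covariance matrix with entries \[ \mathbf{V}\left(\underline{s}_{j_1},\underline{s}_{j_2}\right)=\sum_{h\in\mathbb{Z}}\lim_{T\to\infty} \sum_{t=1}^{T}w_{t,T}\,w_{t+h,T}\, \operatorname{Cov}\left(f\left(\underline{s}_{j_1},\widetilde{\underline{X}}_0\left(\tfrac{t}{T}\right)\right),f\left(\underline{s}_{j_2},\widetilde{\underline{X}}_h\left(\tfrac{t}{T}\right)\right)\right). \]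
   Context: Notation: $|M|_1=\max_{j}\sum_i|m^{(i,j)}|$ is the max column sum norm of a matrix $M=(m^{(i,j)})$, $|\underline v|_1$ the $\ell_1$-norm of a vector, and $\|\underline X\|_p=(E|\underline X|_p^p)^{1/p}$... (with $\|\underline X\|_p:=(E|\underline X|_p)^{1/p}$ as defined in the paper). Model: Let $(\underline\varepsilon_t)_{t\in\mathbb{Z}}$ be i.i.d. centred $\mathbb{R}^d$-valued random vectors and \[ \underline{X}_{t,T}=\underline\mu\left(\tfrac{t}{T}\right)+\sum_{j\in\mathbb{Z}}A_{t,T}(j)\,\underline\varepsilon_{t-j},\qquad t=1,\dots,T, \] with a time-varying mean $\underline\mu=(\mu_1,\dots,\mu_d)'$ and $(d\times d)$ coefficient matrices $A_{t,T}(j)$. Assumption (P) (locally stationary linear process): (i) the innovations are i.i.d., centred and $E|\underline\varepsilon_1|_1<\infty$; (ii) for some $\vartheta\in(0,1)$ and $B<\infty$, $\sup_{t,T}|A_{t,T}(j)|_1\le B\vartheta^{|j|}$, and for each $j$ there is an entry-wise continuously differentiable $A(\cdot,j)=(a^{(p,q)}(\cdot,j))_{p,q}:[0,1]\to\mathbb{R}^{d\times d}$ with $\sup_u|\partial^s a^{(p,q)}(u,j)/\partial u^s|\le B\vartheta^{|j|}$ for all $p,q$ and $s\le k$, $s,k\in\{0,1\}$, and $\sup_{t,T}T|A_{t,T}(j)-A(t/T,j)|_1\le B\vartheta^{|j|}$; (iii) each component of $\underline\mu$ is continuously differentiable. Companion process: $\widetilde{\underline{X}}_t(u)=\underline\mu(u)+\sum_{j\in\mathbb{Z}}A(u,j)\underline\varepsilon_{t-j}$,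 $t\in\mathbb{Z}$, $u\in[0,1]$. Truncated versions for $M\in\mathbb{N}$: $\underline{X}^{(M)}_{t,T}=\underline\mu(t/T)+\sum_{|j|<M}A_{t,T}(j)\underline\varepsilon_{t-j}$ and $\widetilde{\underline{X}}^{(M)}_t(u)=\underline\mu(u)+\sum_{|j|<M}A(u,j)\underline\varepsilon_{t-j}$. Assumption (W) (weights): the weights $(w_{t,T})_{t=1}^T$ are non-negative with $\sup_{1\le t\le T}w_{t,T}\le C_w d_T^{-1/2}$ for a finite constant $C_w$, where $d_T\to\infty$ denotes the number of non-zero weights among $(w_{t,T})_{t=1}^T$. (For $t$ outside $\{1,\dots,T\}$ the weights are taken to be zero / extended in the natural way in the covariance formula.) Assumption (F1) (function class I): $(\mathcal S,\rho)$ is a compact semimetric space with $\mathcal S\subseteq\overline{\mathbb{R}}^d$, and $f:\mathcal S\times\mathbb{R}^d\to\mathbb{R}$ satisfies the Lipschitz condition $\sup_{\underline s\in\mathcal S}|f(\underline s,\underline x)-f(\underline s,\underline x^\circ)|\le C_{Lip}|\underline x-\underline x^\circ|_1$ for all $\underline x,\underline x^\circ\in\mathbb{R}^d$ and some $C_{Lip}<\infty$; moreover, for some $\delta\in(0,1/2)$, \[ \sup_{t\le T,\,\underline s\in\mathcal S,\,M\in\mathbb{N}}E\big[|f(\underline s,\underline X_{t,T})|^{2+\delta}+|f(\underline s,\underline X^{(M)}_{t,T})|^{2+\delta}\big]<\infty, \] \[ \sup_{u\in[0,1],\,\underline s\in\mathcal S,\,M\in\mathbb{N}}E\big[|f(\underline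 s,\widetilde{\underline X}_0(u))|^{2+\delta}+|f(\underline s,\widetilde{\underline X}^{(M)}_0(u))|^{2+\delta}\big]<\infty. \] Centring: $\bar f(\underline s,\underline X_{t,T}):=f(\underline s,\underline X_{t,T})-Ef(\underline s,\underline X_{t,T})$.
   Formalization: It is additionally assumed that, for each lag h and each pair of points s_{j1}, s_{j2}, the limit over T in the definition of V exists; assumption (W) does not guarantee this, and without it V is undefined. *)

theory Defs
  imports "HOL-Probability.Probability"
begin

definition norm1v :: "real^'d \<Rightarrow> real" where
  "norm1v x = (\<Sum>i\<in>UNIV. \<bar>x $ i\<bar>)"

definition mnorm1 :: "real^'d^'d \<Rightarrow> real" where
  "mnorm1 A = Max (range (\<lambda>q. \<Sum>p\<in>UNIV. \<bar>A $ p $ q\<bar>))"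

definition C1_01 :: "(real \<Rightarrow> real) \<Rightarrow> bool" where
  "C1_01 g \<longleftrightarrow> (\<exists>g'. continuous_on {0..1} g' \<and>
      (\<forall>u\<in>{0..1}. (g has_real_derivative g' u) (at u within {0..1})))"

definition lsp_X :: "(real \<Rightarrow> real^'d) \<Rightarrow> (nat \<Rightarrow> int \<Rightarrow> int \<Rightarrow> real^'d^'d)
    \<Rightarrow> (int \<Rightarrow> 'w \<Rightarrow> real^'d) \<Rightarrow> nat \<Rightarrow> int \<Rightarrow> 'w \<Rightarrow> real^'d" where
  "lsp_X mu A eps T t \<omega> = mu (real_of_int t / real T) + (\<Sum>\<^sub>\<infinity>j\<in>UNIV. A T t j *v eps (t - j) \<omega>)"

definition lsp_XM :: "(real \<Rightarrow> real^'d) \<Rightarrow> (nat \<Rightarrow> int \<Rightarrow> int \<Rightarrow> real^'d^'d)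
    \<Rightarrow> (int \<Rightarrow> 'w \<Rightarrow> real^'d) \<Rightarrow> nat \<Rightarrow> nat \<Rightarrow> int \<Rightarrow> 'w \<Rightarrow> real^'d" where
  "lsp_XM mu A eps M T t \<omega> = mu (real_of_int t / real T) + (\<Sum>j | \<bar>j\<bar> < int M. A T t j *v eps (t - j) \<omega>)"

definition comp_X :: "(real \<Rightarrow> real^'d) \<Rightarrow> (real \<Rightarrow> int \<Rightarrow> real^'d^'d)
    \<Rightarrow> (int \<Rightarrow> 'w \<Rightarrow> real^'d) \<Rightarrow> real \<Rightarrow> int \<Rightarrow> 'w \<Rightarrow> real^'d" where
  "comp_X mu Au eps u t \<omega> = mu u + (\<Sum>\<^sub>\<infinity>j\<in>UNIV. Au u j *v eps (t - j) \<omega>)"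

definition comp_XM :: "(real \<Rightarrow> real^'d) \<Rightarrow> (real \<Rightarrow> int \<Rightarrow> real^'d^'d)
    \<Rightarrow> (int \<Rightarrow> 'w \<Rightarrow> real^'d) \<Rightarrow> nat \<Rightarrow> real \<Rightarrow> int \<Rightarrow> 'w \<Rightarrow> real^'d" where
  "comp_XM mu Au eps M u t \<omega> = mu u + (\<Sum>j | \<bar>j\<bar> < int M. Au u j *v eps (t - j) \<omega>)"

definition cov :: "'w measure \<Rightarrow> ('w \<Rightarrow> real) \<Rightarrow> ('w \<Rightarrow> real) \<Rightarrow> real" where
  "cov M X Y = (\<integral>\<omega>. (X \<omega> - (\<integral>\<omega>'. X \<omega>' \<partial>M)) * (Y \<omega> - (\<integral>\<omega>'. Y \<omega>' \<partial>M)) \<partial>M)"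

definition semimetric_on :: "'a set \<Rightarrow> ('a \<Rightarrow> 'a \<Rightarrow> real) \<Rightarrow> bool" where
  "semimetric_on S \<rho> \<longleftrightarrow> (\<forall>x\<in>S. \<forall>y\<in>S. \<rho> x y \<ge> 0 \<and> \<rho> x y = \<rho> y x) \<and> (\<forall>x\<in>S. \<rho> x x = 0) \<and>
      (\<forall>x\<in>S. \<forall>y\<in>S. \<forall>z\<in>S. \<rho> x z \<le> \<rho> x y + \<rho> y z)"

definition compact_semimetric :: "'a set \<Rightarrow> ('a \<Rightarrow> 'a \<Rightarrow> real) \<Rightarrow> bool" where
  "compact_semimetric S \<rho> \<longleftrightarrow> semimetric_on S \<rho> \<and>
     (\<forall>x :: nat \<Rightarrow> 'a. (\<forall>n. x n \<in> S) \<longrightarrow> (\<exists>r x0. strict_mono r \<and> x0 \<in> S \<and> (\<lambda>n. \<rho> (x (r n)) x0) \<longlonglongrightarrow> 0))"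

text \<open>N is the (possibly degenerate) centred multivariate normal law N(0,V) on R^J,
  defined through its characteristic function\<close>
definition is_normal_0 :: "(real^'j) measure \<Rightarrow> real^'j^'j \<Rightarrow> bool" where
  "is_normal_0 N V \<longleftrightarrow> prob_space N \<and> sets N = sets borel \<and>
     (\<forall>u. (\<integral>x. cis (u \<bullet> x) \<partial>N) = complex_of_real (exp (- (u \<bullet> (V *v u)) / 2)))"

definition conv_distr :: "'w measure \<Rightarrow> (nat \<Rightarrow> 'w \<Rightarrow> real^'j) \<Rightarrow> (real^'j) measure \<Rightarrow> bool" where
  "conv_distr M Y N \<longleftrightarrow> (\<forall>g :: real^'j \<Rightarrow> real. continuous_on UNIV g \<and> bounded (range g) \<longrightarrow>
      (\<lambda>T. \<integral>\<omega>. g (Y T \<omega>) \<partial>M) \<longlonglongrightarrow> (\<integral>x. g x \<partial>N))"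

end

theory Submission
  imports Defs "HOL-Real_Asymp.Real_Asymp"
begin

text \<open>By Levy's continuity theorem it suffices that \<open>E cis (u \<bullet> Y T)\<close> tends to \<open>exp (- (u \<bullet> V u) / 2)\<close>.
  Let \<open>d\<close> be the number of nonzero weights. Replace \<open>f (s j)\<close> of the process by its value at the process
  truncated to the innovations in a window of radius \<open>m\<close>, of order \<open>(ln d)^2\<close>, and clip that value at a
  level \<open>c\<close>, a power of \<open>d\<close> slightly below \<open>sqrt d\<close>. As the weights add up to \<open>O (sqrt d)\<close>, the replacement
  costs \<open>o (1)\<close> in \<open>L\<^sup>1\<close>. The new weighted summands are \<open>m\<close>-dependent and of size \<open>O (c / sqrt d)\<close>, and
  Tikhomirov's differential equation for the characteristic function yields a normal approximation with
  error \<open>O (m^2 * c / sqrt d)\<close>, which tends to \<open>0\<close>.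

  For the variance, the covariance of two variables with bounded moments of order \<open>2 + \<delta>\<close> is a
  Hoelder continuous function of the variables in \<open>L\<^sup>1\<close>. Comparing with shorter windows, which
  are disjoint, the covariances at lag \<open>h\<close> decay geometrically in \<open>h\<close> uniformly in \<open>T\<close>;
  comparing with the companion process, those at a fixed lag converge. Dominated convergence over the
  lags then identifies \<open>V\<close>, which is positive semidefinite as a limit of covariance matrices.\<close>

section \<open>Convergence in distribution from characteristic functions\<close>

text \<open>The innovations have only a first moment, so replacing the process by a truncated one is
  cheap in L1 but not controlled in L2. In L1 the weights add up to order \<open>sqrt d\<close>,
  hence each summand must be replaced up to \<open>o (1 / sqrt d)\<close>: a fixed window radius
  would leave an error bound of order \<open>sqrt d\<close>, and the window has to grow with
  \<open>T\<close>. This excludes a limit theorem for fixed \<open>m\<close> followed by an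
  approximation argument; what is needed is a normal approximation with explicit dependence on
  \<open>m\<close> and on the size of the summands. Tikhomirov's method gives one without cutting
  the index set into large and small blocks, so the non-zero weights may lie anywhere, and without
  dividing by the variance, so \<open>V\<close> may be singular. Clipping supplies the bounded
  summands for it, and the moments of order \<open>2 + \<delta>\<close> keep the clipping error
  below the growth \<open>sqrt d\<close> of the total weight.\<close>

inductive trig_poly :: "(real^'n \<Rightarrow> complex) \<Rightarrow> bool" where
  zero: "trig_poly (\<lambda>x. 0)"
| step: "trig_poly h \<Longrightarrow> trig_poly (\<lambda>x. a * cis (u \<bullet> x) + h x)"

lemma trig_poly_cis: "trig_poly (\<lambda>x. a * cis (u \<bullet> x))"
  using trig_poly.step[OF trig_poly.zero, of a u] by simp

lemma trig_poly_add:
  assumes "trig_poly h" "trig_poly k" shows "trig_poly (\<lambda>x. h x + k x)"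
  using assms(1)
proof induction
  case zero then show ?case using assms(2) by simp
next
  case (step h a u)
  from trig_poly.step[OF step.IH, of a u] show ?case by (simp add: add.assoc)
qed

lemma trig_poly_mult_cis:
  assumes "trig_poly h" shows "trig_poly (\<lambda>x. a * cis (u \<bullet> x) * h x)"
  using assms
proof induction
  case zero then show ?case by (simp add: trig_poly.zero)
next
  case (step h b v)
  from trig_poly.step[OF step.IH, of "a * b" "u + v"] show ?case
    by (simp add: algebra_simps inner_add_left flip: cis_mult)
qed

lemma trig_poly_mult:
  assumes "trig_poly h" "trig_poly k" shows "trig_poly (\<lambda>x. h x * k x)"
  using assms(1)
proof induction
  case zero then show ?case by (simp add: trig_poly.zero)
next
  case (step h a u)
  from trig_poly_add[OF trig_poly_mult_cis[OF assms(2), of a u] step.IH] show ?case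
    by (simp add: distrib_right)
qed

lemma trig_poly_const: "trig_poly (\<lambda>x. c)"
  using trig_poly_cis[of c 0] by (simp add: cis_zero)

lemma trig_poly_sum:
  "finite I \<Longrightarrow> (\<And>i. i \<in> I \<Longrightarrow> trig_poly (h i)) \<Longrightarrow> trig_poly (\<lambda>x. \<Sum>i\<in>I. h i x)"
  by (induction I rule: finite_induct) (auto intro: trig_poly.zero trig_poly_add)

lemma trig_poly_sin: "trig_poly (\<lambda>x. complex_of_real (sin (c * x $ i)))"
proof -
  have "complex_of_real (sin (c * x $ i))
      = (- \<i>/2) * cis (axis i c \<bullet> x) + (\<i>/2) * cis (axis i (- c) \<bullet> x)" for x
    by (simp add: complex_eq_iff inner_axis')
  then show ?thesis using trig_poly_add[OF trig_poly_cis trig_poly_cis] by (simp only:)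
qed

lemma trig_poly_real_polynomial_sin:
  assumes "real_polynomial_function p"
  shows "trig_poly (\<lambda>x :: real^'n. complex_of_real (p (\<chi> i. sin (c * x $ i))))"
  using assms
proof induction
  case (linear f)
  then interpret bounded_linear f .
  have "f (\<chi> i. sin (c * x $ i)) = (\<Sum>i\<in>UNIV. sin (c * x $ i) * f (axis i 1))" for x :: "real^'n"
  proof -
    have "(\<chi> i. sin (c * x $ i)) = (\<Sum>i\<in>UNIV. sin (c * x $ i) *\<^sub>R axis i (1::real))"
      by (simp add: vec_eq_iff axis_def if_distrib cong: if_cong)
    then show ?thesis by (simp add: sum scaleR)
  qed
  moreover have "trig_poly (\<lambda>x. \<Sum>i\<in>UNIV. complex_of_real (sin (c * x $ i)) * of_real (f (axis i 1)))"
    by (intro trig_poly_sum trig_poly_mult trig_poly_sin trig_poly_const) auto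
  ultimately show ?case by simp
next
  case (const c) then show ?case by (rule trig_poly_const)
next
  case (add f g)
  from trig_poly_add[OF add.IH] show ?case by simp
next
  case (mult f g)
  from trig_poly_mult[OF mult.IH] show ?case by simp
qed

text \<open>Folding the coordinates with the triangle wave \<open>arcsin \<circ> sin\<close> makes \<open>g\<close> periodic without
  changing it on a large cube; Stone--Weierstrass in the variables \<open>sin (c * x $ i)\<close> then
  approximates the folded function globally.\<close>
lemma trig_poly_approx:
  fixes g :: "real^'n \<Rightarrow> real"
  assumes g: "continuous_on UNIV g" and b: "\<And>x. \<bar>g x\<bar> \<le> b" and "0 < L" "0 < e"
  obtains p where "trig_poly (\<lambda>x. complex_of_real (p x))" "\<And>x. \<bar>p x\<bar> \<le> b + e"
    "\<And>x. (\<forall>i. \<bar>x $ i\<bar> \<le> L) \<Longrightarrow> \<bar>g x - p x\<bar> \<le> e"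
proof -
  \<comment> \<open>On the cube the arguments \<open>c * x $ i\<close> then lie in
    \<open>[-1, 1]\<close>, inside the range \<open>[- pi / 2, pi / 2]\<close> where
    \<open>arcsin\<close> inverts \<open>sin\<close>.\<close>
  define c where "c = 1 / L"
  define G where "G y = g (\<chi> i. arcsin (y $ i) / c)" for y :: "real^'n"
  let ?C = "cbox (\<chi> i. -1) (\<chi> i. 1) :: (real^'n) set"
  have c: "c > 0" using \<open>0 < L\<close> by (simp add: c_def)
  have mem: "y \<in> ?C \<longleftrightarrow> (\<forall>i. \<bar>y $ i\<bar> \<le> 1)" for y
    by (auto simp: mem_box_cart abs_le_iff minus_le_iff)
  have "continuous_on ?C G"
    unfolding G_def
    by (rule continuous_on_compose2[OF g])
      (use mem c in \<open>auto intro!: continuous_intros simp: abs_le_iff minus_le_iff\<close>)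
  then obtain q where q: "real_polynomial_function q" "\<And>y. y \<in> ?C \<Longrightarrow> \<bar>G y - q y\<bar> < e"
    using Stone_Weierstrass_real_polynomial_function[OF compact_cbox _ \<open>0 < e\<close>] by blast
  define s where "s x = (\<chi> i. sin (c * x $ i))" for x :: "real^'n"
  have s: "s x \<in> ?C" for x by (simp add: mem s_def)
  show ?thesis
  proof
    show "trig_poly (\<lambda>x. complex_of_real (q (s x)))"
      unfolding s_def by (rule trig_poly_real_polynomial_sin[OF q(1)])
    show "\<bar>q (s x)\<bar> \<le> b + e" for x
      using q(2)[OF s[of x]] b[of "\<chi> i. arcsin (s x $ i) / c"] unfolding G_def by linarith
    fix x :: "real^'n" assume x: "\<forall>i. \<bar>x $ i\<bar> \<le> L"
    have "arcsin (sin (c * x $ i)) = c * x $ i" for i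
    proof (rule arcsin_sin)
      have "\<bar>c * x $ i\<bar> \<le> 1" using x \<open>0 < L\<close> by (simp add: c_def abs_mult field_simps)
      then show "- (pi / 2) \<le> c * x $ i" "c * x $ i \<le> pi / 2"
        using pi_gt3 by (auto simp: abs_le_iff)
    qed
    then have "G (s x) = g x" using c by (simp add: G_def s_def vec_eq_iff flip: vec_lambda_eta) (simp add: vec_lambda_eta)
    then show "\<bar>g x - q (s x)\<bar> \<le> e" using q(2)[OF s[of x]] by simp
  qed
qed

lemma trig_poly_continuous: "trig_poly h \<Longrightarrow> continuous_on UNIV h"
  by (induction rule: trig_poly.induct) (auto intro!: continuous_intros)

lemma trig_poly_borel: "trig_poly h \<Longrightarrow> h \<in> borel_measurable borel"
  by (intro borel_measurable_continuous_onI trig_poly_continuous)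

lemma trig_poly_integrable:
  assumes "trig_poly h" "finite_measure M" "Y \<in> borel_measurable M"
  shows "integrable M (\<lambda>x. h (Y x))"
  using assms(1)
proof induction
  case zero then show ?case by simp
next
  case (step h a u)
  interpret finite_measure M by fact
  note [measurable] = assms(3)
  have "integrable M (\<lambda>x. cis (u \<bullet> Y x))"
  proof (rule integrable_const_bound[where B=1])
    show "(\<lambda>x. cis (u \<bullet> Y x)) \<in> borel_measurable M"
      by (rule borel_measurable_continuous_on[OF _ assms(3)]) (intro continuous_intros)
  qed simp
  then show ?case using step.IH by simp
qed

text \<open>A trigonometric polynomial is a finite combination of characters, so the hypothesis on
  characteristic functions passes to it one term at a time.\<close>

lemma trig_poly_lim:
  assumes "trig_poly h" "\<And>T. Y T \<in> borel_measurable M" "finite_measure M" "finite_measure N" "sets N = sets borel"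
    and cf: "\<And>u. (\<lambda>T. \<integral>x. cis (u \<bullet> Y T x) \<partial>M) \<longlonglongrightarrow> (\<integral>x. cis (u \<bullet> x) \<partial>N)"
  shows "(\<lambda>T. \<integral>x. h (Y T x) \<partial>M) \<longlonglongrightarrow> (\<integral>x. h x \<partial>N)"
  using assms(1)
proof induction
  case zero then show ?case by simp
next
  case (step h a u)
  have id: "(\<lambda>x. x) \<in> borel_measurable N" by (rule measurable_ident_sets[OF assms(5)])
  have c: "integrable M (\<lambda>x. a * cis (u \<bullet> Y T x))" "integrable N (\<lambda>x. a * cis (u \<bullet> x))" for T
    using trig_poly_integrable[OF trig_poly_cis[of a u]] assms id by blast+
  have h: "integrable M (\<lambda>x. h (Y T x))" "integrable N h" for T
    using trig_poly_integrable[OF step.hyps] assms id by blast+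
  show ?case
    by (simp add: c h del: integral_mult_right_zero) (intro tendsto_add step.IH, simp, intro tendsto_mult_left cf)
qed

text \<open>Tightness enters as a uniform bound on first moments, so that Markov's inequality
  supplies one large cube for all \<open>T\<close>. On the cube \<open>g\<close> is within
  \<open>e\<close> of a trigonometric polynomial; off the cube only boundedness is used.\<close>

theorem levy_continuity_vec:
  fixes Y :: "nat \<Rightarrow> 'w \<Rightarrow> real^'n" and N :: "(real^'n) measure"
  assumes M: "prob_space M" and N: "prob_space N" "sets N = sets borel"
    and Y: "\<And>T. Y T \<in> borel_measurable M"
    and cf: "\<And>u. (\<lambda>T. \<integral>x. cis (u \<bullet> Y T x) \<partial>M) \<longlonglongrightarrow> (\<integral>x. cis (u \<bullet> x) \<partial>N)"
    and tight: "\<And>T i. integrable M (\<lambda>x. Y T x $ i)" "\<And>T i. (\<integral>x. \<bar>Y T x $ i\<bar> \<partial>M) \<le> K"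
  shows "conv_distr M Y N"
  unfolding conv_distr_def
proof safe
  fix g :: "real^'n \<Rightarrow> real" assume g: "continuous_on UNIV g" "bounded (range g)"
  interpret M: prob_space M by fact
  interpret N: prob_space N by fact
  obtain b where b: "b > 0" "\<And>x. \<bar>g x\<bar> \<le> b"
    using g(2) unfolding bounded_pos by auto
  have id: "(\<lambda>x. x) \<in> borel_measurable N" by (rule measurable_ident_sets[OF N(2)])
  have gm: "g \<in> borel_measurable borel" by (rule borel_measurable_continuous_onI[OF g(1)])
  show "(\<lambda>T. \<integral>x. g (Y T x) \<partial>M) \<longlonglongrightarrow> (\<integral>x. g x \<partial>N)"
  proof (rule LIMSEQ_I)
    fix r :: real assume "0 < r"
    \<comment> \<open>Five errors \<open>e\<close> add up: two each from replacing \<open>g\<close>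
      by \<open>p\<close> under the law of \<open>Y T\<close> and under \<open>N\<close>, one from
      the convergence for \<open>p\<close>. The cap \<open>e \<le> 1\<close> makes
      \<open>\<bar>g x - p x\<bar> \<le> b + (b + e)\<close> at most the penalty
      \<open>2 * b + 1\<close> of \<open>?out\<close>.\<close>
    define e where "e = min 1 (r / 5)"
    have e: "0 < e" "e \<le> 1" "5 * e \<le> r" using \<open>0 < r\<close> by (auto simp: e_def)
    let ?out = "\<lambda>L (x :: real^'n). if \<forall>i. \<bar>x $ i\<bar> \<le> L then 0 else 2 * b + 1 :: real"
    have out_m: "(\<lambda>x :: real^'n. ?out L x) \<in> borel_measurable borel" for L by measurable
    have out_int: "integrable M' (\<lambda>x. ?out L (Z x))"
      if "prob_space M'" "Z \<in> borel_measurable M'" for M' :: "'x measure" and Z :: "'x \<Rightarrow> real^'n" and L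
    proof -
      interpret M': prob_space M' by fact
      show ?thesis
        by (rule M'.integrable_const_bound[where B="2*b+1"])
          (use b(1) measurable_compose[OF that(2) out_m] in auto)
    qed
    have "(\<lambda>n. \<integral>x. ?out (real n) x \<partial>N) \<longlonglongrightarrow> (\<integral>x. 0 \<partial>N)"
    proof (rule integral_dominated_convergence[where w="\<lambda>_. 2*b+1"])
      show "AE x in N. (\<lambda>n. ?out (real n) x) \<longlonglongrightarrow> 0"
      proof (rule AE_I2, rule tendsto_eventually)
        fix x :: "real^'n"
        obtain k where k: "norm x \<le> real k" using real_arch_simple by blast
        show "\<forall>\<^sub>F n in sequentially. ?out (real n) x = 0"
          using eventually_ge_at_top[of k]
        proof eventually_elim
          case (elim n)
          have "\<bar>x $ i\<bar> \<le> real n" for i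
            using k component_le_norm_cart[of x i] elim by linarith
          then show ?case by simp
        qed
      qed
    qed (use b(1) measurable_compose[OF id out_m] in auto)
    then have "\<forall>\<^sub>F n in sequentially. (\<integral>x. ?out (real n) x \<partial>N) < e"
      using order_tendstoD(2) e(1) by fastforce
    moreover have "\<forall>\<^sub>F n in sequentially. real n \<ge> (2*b+1) * (CARD('n) * K) / e + 1" by real_asymp
    ultimately obtain n where n: "(\<integral>x. ?out (real n) x \<partial>N) < e"
      "real n \<ge> (2*b+1) * (CARD('n) * K) / e + 1"
      using eventually_happens'[OF sequentially_bot eventually_conj] by blast
    define L where "L = real n"
    have K: "K \<ge> 0" by (rule order_trans[OF _ tight(2)[of 0 undefined]]) simp
    have L: "L > 0" "(2*b+1) * (CARD('n) * K) / L \<le> e"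
    proof -
      have "(2*b+1) * (CARD('n) * K) / e \<ge> 0" using b K e by simp
      then show "L > 0" using n(2) unfolding L_def by linarith
      moreover have "(2*b+1) * (CARD('n) * K) \<le> L * e"
        using n(2) e unfolding L_def by (simp add: field_simps)
      ultimately show "(2*b+1) * (CARD('n) * K) / L \<le> e" by (simp add: field_simps)
    qed
    have outY: "(\<integral>x. ?out L (Y T x) \<partial>M) \<le> e" for T
    proof -
      have "(\<integral>x. ?out L (Y T x) \<partial>M) \<le> (\<integral>x. (2*b+1) / L * (\<Sum>i\<in>UNIV. \<bar>Y T x $ i\<bar>) \<partial>M)"
      proof (intro integral_mono out_int M Y)
        fix x
        show "?out L (Y T x) \<le> (2*b+1) / L * (\<Sum>i\<in>UNIV. \<bar>Y T x $ i\<bar>)"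
        proof (cases "\<forall>i. \<bar>Y T x $ i\<bar> \<le> L")
          case True then show ?thesis using b L by (simp add: sum_nonneg)
        next
          case False
          then obtain i where "\<bar>Y T x $ i\<bar> > L" by (auto simp: not_le)
          moreover have "\<bar>Y T x $ i\<bar> \<le> (\<Sum>i\<in>UNIV. \<bar>Y T x $ i\<bar>)" by (rule member_le_sum) auto
          ultimately have "1 \<le> (\<Sum>i\<in>UNIV. \<bar>Y T x $ i\<bar>) / L" using L by (simp add: field_simps)
          then have "(2*b+1) * 1 \<le> (2*b+1) * ((\<Sum>i\<in>UNIV. \<bar>Y T x $ i\<bar>) / L)"
            by (rule mult_left_mono) (use b in simp)
          then show ?thesis using False unfolding if_not_P[OF False] by simp
        qed
      qed (use tight in auto)
      also have "\<dots> = (2*b+1) / L * (\<Sum>i\<in>UNIV. \<integral>x. \<bar>Y T x $ i\<bar> \<partial>M)"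
        using tight by simp
      also have "\<dots> \<le> (2*b+1) / L * (CARD('n) * K)"
        using b L sum_bounded_above[of UNIV "\<lambda>i. \<integral>x. \<bar>Y T x $ i\<bar> \<partial>M" K] tight(2)
        by (intro mult_left_mono) auto
      finally show ?thesis using L(2) by simp
    qed
    obtain p where p: "trig_poly (\<lambda>x. complex_of_real (p x))" "\<And>x. \<bar>p x\<bar> \<le> b + e"
      "\<And>x. (\<forall>i. \<bar>x $ i\<bar> \<le> L) \<Longrightarrow> \<bar>g x - p x\<bar> \<le> e"
      using trig_poly_approx[OF g(1) b(2) L(1) e(1)] by metis
    have pm: "p \<in> borel_measurable borel"
      using measurable_compose[OF trig_poly_borel[OF p(1)], of Re borel] by simp
    have diff: "\<bar>(\<integral>x. g (Z x) \<partial>M') - (\<integral>x. p (Z x) \<partial>M')\<bar> \<le> 2 * e"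
      if "prob_space M'" "Z \<in> borel_measurable M'" "(\<integral>x. ?out L (Z x) \<partial>M') \<le> e"
      for M' :: "'x measure" and Z :: "'x \<Rightarrow> real^'n"
    proof -
      interpret M': prob_space M' by fact
      have i: "integrable M' (\<lambda>x. g (Z x))" "integrable M' (\<lambda>x. p (Z x))"
        using b(2) p(2) measurable_compose[OF that(2) gm] measurable_compose[OF that(2) pm]
        by (auto intro: M'.integrable_const_bound[where B="b"] M'.integrable_const_bound[where B="b + e"])
      have "\<bar>(\<integral>x. g (Z x) \<partial>M') - (\<integral>x. p (Z x) \<partial>M')\<bar> \<le> (\<integral>x. \<bar>g (Z x) - p (Z x)\<bar> \<partial>M')"
        using i by (simp flip: Bochner_Integration.integral_diff)
      also have "\<dots> \<le> (\<integral>x. e + ?out L (Z x) \<partial>M')"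
      proof (intro integral_mono)
        fix x show "\<bar>g (Z x) - p (Z x)\<bar> \<le> e + ?out L (Z x)"
          using p(3)[of "Z x"] b(2)[of "Z x"] p(2)[of "Z x"] e by auto
      qed (use i out_int[OF that(1,2), of L] in auto)
      also have "\<dots> \<le> 2 * e" using that out_int[OF that(1,2)] by (simp add: M'.prob_space)
      finally show ?thesis .
    qed
    have "(\<lambda>T. \<integral>x. complex_of_real (p (Y T x)) \<partial>M) \<longlonglongrightarrow> (\<integral>x. complex_of_real (p x) \<partial>N)"
      by (rule trig_poly_lim[OF p(1) Y M.finite_measure_axioms N.finite_measure_axioms N(2) cf])
    then have "(\<lambda>T. complex_of_real (\<integral>x. p (Y T x) \<partial>M)) \<longlonglongrightarrow> complex_of_real (\<integral>x. p x \<partial>N)"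
      by simp
    then have "(\<lambda>T. \<integral>x. p (Y T x) \<partial>M) \<longlonglongrightarrow> (\<integral>x. p x \<partial>N)"
      by (simp only: tendsto_of_real_iff)
    then obtain n0 where n0: "\<And>T. T \<ge> n0 \<Longrightarrow> \<bar>(\<integral>x. p (Y T x) \<partial>M) - (\<integral>x. p x \<partial>N)\<bar> < e"
      using LIMSEQ_D[OF _ e(1)] by (metis real_norm_def)
    show "\<exists>n0. \<forall>T\<ge>n0. norm ((\<integral>x. g (Y T x) \<partial>M) - (\<integral>x. g x \<partial>N)) < r"
    proof (intro exI allI impI)
      fix T assume "n0 \<le> T"
      from n0[OF this] diff[OF M Y outY, of T] diff[OF N(1) id] n(1) e
      show "norm ((\<integral>x. g (Y T x) \<partial>M) - (\<integral>x. g x \<partial>N)) < r"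
        unfolding L_def real_norm_def by linarith
    qed
  qed
qed

section \<open>Existence of the multivariate normal law\<close>

text \<open>Lagrange's reduction: completing the square in one coordinate after the other.\<close>
lemma psd_sum_of_squares:
  fixes V :: "'n \<Rightarrow> 'n \<Rightarrow> real"
  assumes "finite I" "\<And>i k. V i k = V k i"
    and "\<And>u. (\<Sum>i\<in>I. \<Sum>k\<in>I. V i k * u i * u k) \<ge> 0"
  shows "\<exists>bs :: ('n \<Rightarrow> real) list. \<forall>u.
    (\<Sum>i\<in>I. \<Sum>k\<in>I. V i k * u i * u k) = (\<Sum>b\<leftarrow>bs. (\<Sum>i\<in>I. b i * u i)\<^sup>2)"
  using assms
proof (induction I arbitrary: V rule: finite_induct)
  case empty
  show ?case by (rule exI[of _ "[]"]) simp
next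
  case (insert i I)
  note sym = insert.prems(1) and psd = insert.prems(2)
  have expand: "(\<Sum>k\<in>insert i I. \<Sum>l\<in>insert i I. W k l * u k * u l) =
      W i i * (u i)\<^sup>2 + 2 * u i * (\<Sum>k\<in>I. W i k * u k) + (\<Sum>k\<in>I. \<Sum>l\<in>I. W k l * u k * u l)"
    if "\<And>i k. W i k = W k i" for W :: "'n \<Rightarrow> 'n \<Rightarrow> real" and u
  proof -
    have "(\<Sum>k\<in>insert i I. \<Sum>l\<in>insert i I. W k l * u k * u l) =
      W i i * u i * u i + (\<Sum>l\<in>I. W i l * u i * u l) + ((\<Sum>k\<in>I. W k i * u k * u i) + (\<Sum>k\<in>I. \<Sum>l\<in>I. W k l * u k * u l))"
      using insert.hyps by (simp add: sum.distrib)
    moreover have "(\<Sum>k\<in>I. W k i * u k * u i) = u i * (\<Sum>k\<in>I. W i k * u k)"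
      "(\<Sum>l\<in>I. W i l * u i * u l) = u i * (\<Sum>k\<in>I. W i k * u k)"
      using that by (auto simp: sum_distrib_left algebra_simps intro!: sum.cong)
    ultimately show ?thesis by (simp add: power2_eq_square algebra_simps)
  qed
  have cong: "(\<Sum>k\<in>I. W k * (u(i := c)) k) = (\<Sum>k\<in>I. W k * u k)" for W u c
    using insert.hyps by (intro sum.cong) auto
  have cong2: "(\<Sum>k\<in>I. \<Sum>l\<in>I. V k l * (u(i := c)) k * (u(i := c)) l) = (\<Sum>k\<in>I. \<Sum>l\<in>I. V k l * u k * u l)" for u and c :: real
    using insert.hyps by (intro sum.cong) auto
  show ?case
  proof (cases "V i i = 0")
    case True
    \<comment> \<open>With \<open>V i i = 0\<close> the form is affine in \<open>u i\<close>, and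
      nonnegativity forces its slope to vanish. The value of \<open>c\<close> used for the
      contradiction makes the form equal to \<open>-1\<close>.\<close>
    have lin0: "(\<Sum>k\<in>I. V i k * u k) = 0" for u
    proof (rule ccontr)
      assume n: "(\<Sum>k\<in>I. V i k * u k) \<noteq> 0"
      define Q where "Q = (\<Sum>k\<in>I. \<Sum>l\<in>I. V k l * u k * u l)"
      define l where "l = (\<Sum>k\<in>I. V i k * u k)"
      have "2 * c * l + Q \<ge> 0" for c
        using psd[of "u(i := c)"] unfolding expand[OF sym] unfolding cong2 unfolding cong using True by (simp add: Q_def l_def)
      from this[of "- (Q + 1) / (2 * l)"] show False using n unfolding l_def[symmetric] by (simp add: field_simps)
    qed
    have psd': "(\<Sum>k\<in>I. \<Sum>l\<in>I. V k l * u k * u l) \<ge> 0" for u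
      using psd[of u] unfolding expand[OF sym] lin0 using True by simp
    then obtain bs where bs: "\<And>u. (\<Sum>k\<in>I. \<Sum>l\<in>I. V k l * u k * u l) = (\<Sum>b\<leftarrow>bs. (\<Sum>i\<in>I. b i * u i)\<^sup>2)"
      using insert.IH[of V, OF sym psd'] by blast
    show ?thesis
    \<comment> \<open>The vectors from the induction hypothesis are arbitrary at \<open>i\<close>
      and must not contribute there.\<close>
    proof (intro exI[of _ "map (\<lambda>b. b(i := 0)) bs"] allI)
      fix u :: "'n \<Rightarrow> real"
      have "(\<Sum>j\<in>insert i I. (b(i := 0)) j * u j) = (\<Sum>j\<in>I. b j * u j)" for b
        using insert.hyps by (auto intro!: sum.cong)
      then show "(\<Sum>k\<in>insert i I. \<Sum>l\<in>insert i I. V k l * u k * u l) =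
          (\<Sum>b\<leftarrow>map (\<lambda>b. b(i := 0)) bs. (\<Sum>j\<in>insert i I. b j * u j)\<^sup>2)"
        unfolding expand[OF sym] lin0 using True bs by (simp add: comp_def)
    qed
  next
    case False
    have pos: "V i i > 0"
    proof -
      have "V i i * 1 \<ge> 0"
        using psd[of "(\<lambda>_. 0)(i := 1)"] unfolding expand[OF sym] unfolding cong2 unfolding cong by simp
      then show ?thesis using False by simp
    qed
    \<comment> \<open>The Schur complement of \<open>V i i\<close>: its form is that of
      \<open>V\<close> minimised over the coordinate \<open>u i\<close>, with minimiser
      \<open>- l / V i i\<close>, and therefore stays nonnegative.\<close>
    define W where "W k l = V k l - V i k * V i l / V i i" for k l
    have W: "W k l = W l k" for k l using sym by (simp add: W_def)
    have Wsum: "(\<Sum>k\<in>I. \<Sum>l\<in>I. W k l * u k * u l) =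
      (\<Sum>k\<in>I. \<Sum>l\<in>I. V k l * u k * u l) - (\<Sum>k\<in>I. V i k * u k)\<^sup>2 / V i i" for u
    proof -
      have "(\<Sum>k\<in>I. V i k * u k)\<^sup>2 / V i i = (\<Sum>k\<in>I. \<Sum>l\<in>I. V i k * V i l / V i i * u k * u l)"
        by (simp add: power2_eq_square sum_product sum_divide_distrib algebra_simps)
      then show ?thesis by (simp add: W_def left_diff_distrib sum_subtractf)
    qed
    have psd': "(\<Sum>k\<in>I. \<Sum>l\<in>I. W k l * u k * u l) \<ge> 0" for u
    proof -
      define l where "l = (\<Sum>k\<in>I. V i k * u k)"
      have "V i i * (- l / V i i)\<^sup>2 + 2 * (- l / V i i) * l + (\<Sum>k\<in>I. \<Sum>l\<in>I. V k l * u k * u l) \<ge> 0"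
        using psd[of "u(i := - l / V i i)"] unfolding expand[OF sym] unfolding cong2 unfolding cong by (simp add: l_def)
      moreover have "V i i * (- l / V i i)\<^sup>2 + 2 * (- l / V i i) * l = - l\<^sup>2 / V i i"
        using pos by (simp add: field_simps power2_eq_square)
      ultimately show ?thesis unfolding Wsum by (simp add: l_def)
    qed
    then obtain bs where bs: "\<And>u. (\<Sum>k\<in>I. \<Sum>l\<in>I. W k l * u k * u l) = (\<Sum>b\<leftarrow>bs. (\<Sum>i\<in>I. b i * u i)\<^sup>2)"
      using insert.IH[of W, OF W psd'] by blast
    show ?thesis
    proof (intro exI[of _ "(\<lambda>k. V i k / sqrt (V i i)) # map (\<lambda>b. b(i := 0)) bs"] allI)
      fix u :: "'n \<Rightarrow> real"
      define l where "l = (\<Sum>k\<in>I. V i k * u k)"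
      have "(\<Sum>j\<in>insert i I. (b(i := 0)) j * u j) = (\<Sum>j\<in>I. b j * u j)" for b
        using insert.hyps by (auto intro!: sum.cong)
      then have "(\<Sum>b\<leftarrow>map (\<lambda>b. b(i := 0)) bs. (\<Sum>j\<in>insert i I. b j * u j)\<^sup>2)
          = (\<Sum>k\<in>I. \<Sum>l\<in>I. V k l * u k * u l) - l\<^sup>2 / V i i"
        using bs Wsum by (simp add: comp_def l_def)
      moreover have "(\<Sum>j\<in>insert i I. V i j / sqrt (V i i) * u j) = (V i i * u i + l) / sqrt (V i i)"
        using insert.hyps by (simp add: l_def sum_divide_distrib add_divide_distrib)
      then have "(\<Sum>j\<in>insert i I. V i j / sqrt (V i i) * u j)\<^sup>2 = V i i * (u i)\<^sup>2 + 2 * u i * l + l\<^sup>2 / V i i"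
        using pos by (simp only: power_divide real_sqrt_pow2[OF less_imp_le]) (simp add: field_simps power2_eq_square)
      ultimately show "(\<Sum>k\<in>insert i I. \<Sum>l\<in>insert i I. V k l * u k * u l) =
          (\<Sum>b\<leftarrow>(\<lambda>k. V i k / sqrt (V i i)) # map (\<lambda>b. b(i := 0)) bs. (\<Sum>j\<in>insert i I. b j * u j)\<^sup>2)"
        unfolding expand[OF sym] by (simp add: l_def)
    qed
  qed
qed

lemma integral_cis_std_normal: "(\<integral>z. cis (t * z) \<partial>std_normal_distribution) = exp (- (t\<^sup>2) / 2)"
  using char_std_normal_distribution unfolding char_def
  by (simp add: cis_conv_exp fun_eq_iff)

text \<open>This is the law of the sum of \<open>Z b *\<^sub>R b\<close> over \<open>bs\<close> with
  independent standard normal \<open>Z b\<close>, starting from the point mass at \<open>0\<close>.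
  Adding one term multiplies the characteristic function by
  \<open>exp (- (b \<bullet> u)\<^sup>2 / 2)\<close>. No density appears, so singular forms are
  covered as well.\<close>

lemma gaussian_of_squares_exists:
  fixes bs :: "(real^'n) list"
  shows "\<exists>N. prob_space N \<and> sets N = sets borel \<and>
     (\<forall>u. (\<integral>x. cis (u \<bullet> x) \<partial>N) = complex_of_real (exp (- (\<Sum>b\<leftarrow>bs. (b \<bullet> u)\<^sup>2) / 2)))"
proof (induction bs)
  case Nil
  show ?case
  proof (intro exI[of _ "return borel 0"] conjI allI)
    show "prob_space (return borel (0 :: real^'n))" by (rule prob_space_return) simp
    fix u :: "real^'n"
    show "(\<integral>x. cis (u \<bullet> x) \<partial>return borel 0) = complex_of_real (exp (- (\<Sum>b\<leftarrow>[]. (b \<bullet> u)\<^sup>2) / 2))"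
      by (subst integral_return) (auto intro!: borel_measurable_continuous_onI continuous_intros)
  qed simp
next
  case (Cons b bs)
  then obtain N where N: "prob_space N" "sets N = sets borel"
    and cf: "\<And>u. (\<integral>x. cis (u \<bullet> x) \<partial>N) = complex_of_real (exp (- (\<Sum>b\<leftarrow>bs. (b \<bullet> u)\<^sup>2) / 2))" by blast
  let ?Z = std_normal_distribution
  interpret N: prob_space N by fact
  interpret Z: real_distribution ?Z by (rule real_dist_normal_dist)
  interpret P: pair_prob_space N ?Z ..
  have cm: "(\<lambda>x. cis (u \<bullet> x)) \<in> borel_measurable borel" for u :: "real^'n"
    by (intro borel_measurable_continuous_onI continuous_intros)
  have cm1: "(\<lambda>x :: real. cis x) \<in> borel_measurable borel"
    by (intro borel_measurable_continuous_onI continuous_intros)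
  have [measurable]: "(\<lambda>p. fst p + snd p *\<^sub>R b) \<in> borel_measurable (N \<Otimes>\<^sub>M ?Z)"
  proof -
    have [measurable_cong]: "sets N = sets borel" by fact
    show ?thesis by measurable
  qed
  let ?N' = "distr (N \<Otimes>\<^sub>M ?Z) borel (\<lambda>p. fst p + snd p *\<^sub>R b)"
  show ?case
  proof (intro exI[of _ ?N'] conjI allI)
    show "prob_space ?N'" by (rule P.prob_space_distr) simp
    fix u :: "real^'n"
    have "(\<integral>x. cis (u \<bullet> x) \<partial>?N') = (\<integral>p. cis (u \<bullet> fst p) * cis ((b \<bullet> u) * snd p) \<partial>(N \<Otimes>\<^sub>M ?Z))"
      by (subst integral_distr) (auto simp: cm inner_add_right cis_mult inner_commute[of b] mult.commute)
    also have "\<dots> = (\<integral>x. \<integral>z. cis (u \<bullet> x) * cis ((b \<bullet> u) * z) \<partial>?Z \<partial>N)"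
    proof (subst P.integral_fst'[symmetric])
      have [measurable_cong]: "sets N = sets borel" by fact
      note [measurable] = cm1
      show "integrable (N \<Otimes>\<^sub>M ?Z) (\<lambda>p. cis (u \<bullet> fst p) * cis ((b \<bullet> u) * snd p))"
        by (rule P.integrable_const_bound[where B=1]) (auto simp: norm_mult)
    qed simp
    also have "\<dots> = complex_of_real (exp (- (\<Sum>b\<leftarrow>bs. (b \<bullet> u)\<^sup>2) / 2)) * complex_of_real (exp (- ((b \<bullet> u)\<^sup>2) / 2))"
      by (simp add: integral_cis_std_normal cf)
    also have "\<dots> = complex_of_real (exp (- (\<Sum>b\<leftarrow>b # bs. (b \<bullet> u)\<^sup>2) / 2))"
      by (simp flip: of_real_mult exp_add add: add_divide_distrib)
    finally show "(\<integral>x. cis (u \<bullet> x) \<partial>?N') = \<dots>" .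
  qed simp
qed

theorem is_normal_0_exists:
  fixes V :: "real^'n^'n"
  assumes psd: "\<And>u. u \<bullet> (V *v u) \<ge> 0"
  shows "\<exists>N. is_normal_0 N V"
proof -
  \<comment> \<open>The quadratic form sees only the symmetric part of \<open>V\<close>; passing to
    it provides the symmetry that completing the square requires.\<close>
  define W where "W i k = (V $ i $ k + V $ k $ i) / 2" for i k
  have W: "(\<Sum>i\<in>UNIV. \<Sum>k\<in>UNIV. W i k * (u $ i) * (u $ k)) = u \<bullet> (V *v u)" for u
  proof -
    have 1: "u \<bullet> (V *v u) = (\<Sum>i\<in>UNIV. \<Sum>k\<in>UNIV. V $ i $ k * (u $ i) * (u $ k))"
      by (simp add: inner_vec_def matrix_vector_mult_def sum_distrib_left algebra_simps)
    also have "\<dots> = (\<Sum>i\<in>UNIV. \<Sum>k\<in>UNIV. V $ k $ i * (u $ i) * (u $ k))"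
      by (subst sum.swap) (simp add: algebra_simps)
    finally have 2: "u \<bullet> (V *v u) = \<dots>" .
    show ?thesis
      using 1 2 by (simp add: W_def add_divide_distrib distrib_right sum.distrib flip: sum_divide_distrib)
  qed
  have psd': "(\<Sum>i\<in>UNIV. \<Sum>k\<in>UNIV. W i k * u i * u k) \<ge> 0" for u
    using W[of "\<chi> i. u i"] psd[of "\<chi> i. u i"] by simp
  have sym: "W i k = W k i" for i k by (simp add: W_def)
  obtain bs where bs: "\<And>u. (\<Sum>i\<in>UNIV. \<Sum>k\<in>UNIV. W i k * u i * u k) = (\<Sum>b\<leftarrow>bs. (\<Sum>i\<in>UNIV. b i * u i)\<^sup>2)"
    using psd_sum_of_squares[of UNIV W, OF finite_class.finite_UNIV sym psd'] by blast
  have "(\<Sum>b\<leftarrow>map (\<lambda>b. \<chi> i. b i) bs. (b \<bullet> u)\<^sup>2) = u \<bullet> (V *v u)" for u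
    unfolding W[symmetric] bs by (simp add: comp_def inner_vec_def)
  with gaussian_of_squares_exists[of "map (\<lambda>b. \<chi> i. b i) bs"] show ?thesis
    unfolding is_normal_0_def by simp
qed

section \<open>Sums of bounded \<open>m\<close>-dependent variables\<close>

locale indep_noise = prob_space M for M :: "'w measure" +
  fixes eps :: "int \<Rightarrow> 'w \<Rightarrow> 'b::topological_space"
  assumes eps_rv: "\<And>t. eps t \<in> borel_measurable M"
    and eps_indep_vars: "indep_vars (\<lambda>_. borel) eps UNIV"
begin

definition preim :: "int \<Rightarrow> 'w set set" where
  "preim k = {eps k -` A \<inter> space M | A. A \<in> sets borel}"

text \<open>The sigma-algebra is packaged as a measure space so that "depends only on the
  innovations in \<open>I\<close>" becomes plain \<open>borel_measurable\<close>, with all its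
  closure rules. Only the sets of this space matter; probabilities are always taken in
  \<open>M\<close>.\<close>

definition block :: "int set \<Rightarrow> 'w measure" where
  "block I = sigma (space M) (\<Union>k\<in>I. preim k)"

lemma preim_Pow: "(\<Union>k\<in>I. preim k) \<subseteq> Pow (space M)"
  by (auto simp: preim_def)

lemma space_block [simp]: "space (block I) = space M"
  using preim_Pow by (simp add: block_def)

lemma sets_block: "sets (block I) = sigma_sets (space M) (\<Union>k\<in>I. preim k)"
  using preim_Pow by (simp add: block_def)

lemma block_mono: "X \<in> borel_measurable (block I) \<Longrightarrow> I \<subseteq> J \<Longrightarrow> X \<in> borel_measurable (block J)"
  unfolding block_def by (rule subsetD[OF measurable_mono1[OF preim_Pow]]) auto

lemma block_measurable: "X \<in> borel_measurable (block I) \<Longrightarrow> X \<in> borel_measurable M"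
proof -
  have "(\<Union>k\<in>I. preim k) \<subseteq> sets M" by (auto simp: preim_def intro!: measurable_sets[OF eps_rv])
  then have "sets (block I) \<subseteq> sets M" unfolding sets_block by (rule sets.sigma_sets_subset)
  then show "X \<in> borel_measurable (block I) \<Longrightarrow> X \<in> borel_measurable M"
    by (auto simp: measurable_def)
qed

lemma eps_block: "k \<in> I \<Longrightarrow> eps k \<in> borel_measurable (block I)"
  by (rule measurableI) (auto simp: sets_block preim_def intro!: sigma_sets.Basic)

text \<open>The generators \<open>preim k\<close> are independent and closed under intersection, so
  grouping them over disjoint index sets yields independent sigma-algebras.\<close>

lemma indep_var_block:
  assumes X: "X \<in> borel_measurable (block I)" and Y: "Y \<in> borel_measurable (block J)" and "I \<inter> J = {}"
  shows "indep_var borel X borel Y"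
proof -
  have sets_case: "(\<lambda>j. sigma_sets (space M) (\<Union>i\<in>case_bool I J j. preim i)) = case_bool (sets (block I)) (sets (block J))"
    by (auto simp: fun_eq_iff sets_block split: bool.split)
  have "indep_sets (\<lambda>j. sigma_sets (space M) (\<Union>i\<in>case_bool I J j. preim i)) UNIV"
  proof (rule indep_sets_collect_sigma)
    have "indep_sets preim UNIV"
      using eps_indep_vars unfolding indep_vars_def2 preim_def by simp
    then show "indep_sets preim (\<Union>j\<in>UNIV. case_bool I J j)"
      by (auto simp: indep_sets_def)
    show "Int_stable (preim i)" for i
      unfolding Int_stable_def preim_def
    proof safe
      fix A B :: "'b set" assume "A \<in> sets borel" "B \<in> sets borel"
      then show "\<exists>C. eps i -` A \<inter> space M \<inter> (eps i -` B \<inter> space M) = eps i -` C \<inter> space M \<and> C \<in> sets borel"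
        by (intro exI[of _ "A \<inter> B"]) auto
    qed
    show "disjoint_family_on (case_bool I J) UNIV"
      using assms(3) by (auto simp: disjoint_family_on_def split: bool.split)
  qed
  then have ind: "indep_set (sets (block I)) (sets (block J))"
    unfolding indep_set_def sets_case .
  show ?thesis
    unfolding indep_var_eq
  proof (intro conjI)
    show "random_variable borel X" "random_variable borel Y"
      using X Y by (auto intro: block_measurable)
    have "sigma_sets (space M) {X -` A \<inter> space M |A. A \<in> sets borel} \<subseteq> sets (block I)"
      using sets.sigma_sets_subset[of "{X -` A \<inter> space M |A. A \<in> sets borel}" "block I"] measurable_sets[OF X]
      by auto
    moreover have "sigma_sets (space M) {Y -` A \<inter> space M |A. A \<in> sets borel} \<subseteq> sets (block J)"
      using sets.sigma_sets_subset[of "{Y -` A \<inter> space M |A. A \<in> sets borel}" "block J"] measurable_sets[OF Y]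
      by auto
    ultimately show "indep_set (sigma_sets (space M) {X -` A \<inter> space M |A. A \<in> sets borel})
        (sigma_sets (space M) {Y -` A \<inter> space M |A. A \<in> sets borel})"
      using ind unfolding indep_set_def
      by (elim indep_sets_mono_sets) (auto split: bool.split)
  qed
qed

lemma expectation_block_mult:
  fixes X Y :: "'w \<Rightarrow> 'c::{real_normed_field, banach, second_countable_topology}"
  assumes "X \<in> borel_measurable (block I)" "Y \<in> borel_measurable (block J)" "I \<inter> J = {}"
    and "integrable M X" "integrable M Y"
  shows "(\<integral>x. X x * Y x \<partial>M) = (\<integral>x. X x \<partial>M) * (\<integral>x. Y x \<partial>M)"
  by (rule indep_var_lebesgue_integral[OF indep_var_block[OF assms(1-3)] assms(4,5)])

lemma integrable_bdd:
  fixes X :: "'w \<Rightarrow> 'c::{banach, second_countable_topology}"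
  assumes "X \<in> borel_measurable M" "\<And>x. norm (X x) \<le> c"
  shows "integrable M X"
  by (rule integrable_const_bound[where B=c]) (use assms in auto)

lemma norm_expectation_le:
  fixes X :: "'w \<Rightarrow> 'c::{banach, second_countable_topology}"
  assumes "integrable M Y" "\<And>x. norm (X x) \<le> Y x"
  shows "norm (\<integral>x. X x \<partial>M) \<le> (\<integral>x. Y x \<partial>M)"
proof (cases "integrable M X")
  case True
  then have "norm (\<integral>x. X x \<partial>M) \<le> (\<integral>x. norm (X x) \<partial>M)" by simp
  also have "\<dots> \<le> (\<integral>x. Y x \<partial>M)" using True assms by (intro integral_mono) auto
  finally show ?thesis .
next
  \<comment> \<open>A function that is not integrable has integral \<open>0\<close> by convention,
    so the nonnegativity of the majorant suffices.\<close>
  case False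
  have "0 \<le> (\<integral>x. Y x \<partial>M)" by (rule Bochner_Integration.integral_nonneg) (rule order_trans[OF norm_ge_zero assms(2)])
  then show ?thesis using False by (simp add: not_integrable_integral_eq)
qed

end

section \<open>Characteristic functions of bounded random variables\<close>

lemma norm_cis_minus_1: "cmod (cis x - 1) \<le> \<bar>x\<bar>"
  using iexp_approx1[of x 0] by (simp add: cis_conv_exp)

lemma norm_cis_diff: "cmod (cis x - cis y) \<le> \<bar>x - y\<bar>"
proof -
  have "cis x - cis y = cis y * (cis (x - y) - 1)"
    by (simp add: right_diff_distrib cis_mult)
  then show ?thesis using norm_cis_minus_1[of "x - y"] by (simp add: norm_mult)
qed

lemma norm_cis_approx2: "cmod (cis x - 1 - \<i> * x) \<le> x\<^sup>2 / 2"
  using iexp_approx1[of x 1] by (simp add: cis_conv_exp power2_eq_square algebra_simps)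

context prob_space
begin

text \<open>Differentiation under the integral. As \<open>S\<close> is bounded, the second-order
  Taylor remainder of \<open>cis\<close> is at most \<open>(y - l)\<^sup>2 * K\<^sup>2\<close> at
  every point, so the difference quotient converges at a linear rate.\<close>

lemma cf_bounded_derivative:
  assumes S: "S \<in> borel_measurable M" "\<And>x. \<bar>S x\<bar> \<le> K"
  shows "((\<lambda>l. \<integral>x. cis (l * S x) \<partial>M) has_vector_derivative (\<integral>x. \<i> * S x * cis (l * S x) \<partial>M)) (at l)"
  unfolding has_vector_derivative_def
proof (rule has_derivativeI_sandwich[where e=1])
  have cm: "(\<lambda>x. cis (l * S x)) \<in> borel_measurable M" for l
    by (rule borel_measurable_continuous_on[OF _ S(1)]) (intro continuous_intros)
  have i1: "integrable M (\<lambda>x. cis (l * S x))" for l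
    by (rule integrable_const_bound[where B=1]) (use cm in auto)
  have K: "K \<ge> 0" using S(2) by (meson abs_ge_zero order_trans)
  have i2: "integrable M (\<lambda>x. \<i> * S x * cis (l * S x))"
    by (rule integrable_const_bound[where B=K]) (use cm S in \<open>auto simp: norm_mult\<close>)
  fix y :: real assume "y \<noteq> l"
  let ?D = "\<lambda>x. cis (y * S x) - cis (l * S x) - (y - l) *\<^sub>R (\<i> * S x * cis (l * S x))"
  have D: "cmod (?D x) \<le> (y - l)\<^sup>2 * K\<^sup>2" for x
  proof -
    have "?D x = cis (l * S x) * (cis ((y - l) * S x) - 1 - \<i> * ((y - l) * S x))"
      by (simp add: algebra_simps cis_mult scaleR_conv_of_real)
    then have "cmod (?D x) \<le> ((y - l) * S x)\<^sup>2 / 2"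
      using norm_cis_approx2[of "(y - l) * S x"] by (simp add: norm_mult)
    also have "\<dots> \<le> (y - l)\<^sup>2 * (S x)\<^sup>2" by (simp add: power_mult_distrib)
    also have "\<dots> \<le> (y - l)\<^sup>2 * K\<^sup>2"
      using S(2)[of x] K by (intro mult_left_mono) (auto simp: abs_le_square_iff[symmetric])
    finally show ?thesis .
  qed
  have "(\<integral>x. cis (y * S x) \<partial>M) - (\<integral>x. cis (l * S x) \<partial>M) - (y - l) *\<^sub>R (\<integral>x. \<i> * S x * cis (l * S x) \<partial>M) = (\<integral>x. ?D x \<partial>M)"
    using i1 i2 by (simp del: integral_mult_right_zero integral_mult_left_zero)
  moreover have "cmod (\<integral>x. ?D x \<partial>M) \<le> (y - l)\<^sup>2 * K\<^sup>2"
    by (rule order_trans[OF integral_norm_bound]) (use D i1 i2 in \<open>intro integral_le_const; auto\<close>)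
  ultimately have "cmod ((\<integral>x. cis (y * S x) \<partial>M) - (\<integral>x. cis (l * S x) \<partial>M) - (y - l) *\<^sub>R (\<integral>x. \<i> * S x * cis (l * S x) \<partial>M)) \<le> (y - l)\<^sup>2 * K\<^sup>2"
    by (simp only:)
  moreover have "(y - l)\<^sup>2 * K\<^sup>2 = (\<bar>y - l\<bar> * K\<^sup>2) * \<bar>y - l\<bar>"
    by (simp add: power2_eq_square)
  ultimately show "cmod ((\<integral>x. cis (y * S x) \<partial>M) - (\<integral>x. cis (l * S x) \<partial>M) - (y - l) *\<^sub>R (\<integral>x. \<i> * S x * cis (l * S x) \<partial>M)) / norm (y - l)
      \<le> \<bar>y - l\<bar> * K\<^sup>2"
    using \<open>y \<noteq> l\<close> by (subst pos_divide_le_eq) auto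
next
  have "((\<lambda>y. \<bar>y - l\<bar> * K\<^sup>2) \<longlongrightarrow> \<bar>l - l\<bar> * K\<^sup>2) (at l)" by (intro tendsto_intros)
  then show "((\<lambda>y. \<bar>y - l\<bar> * K\<^sup>2) \<longlongrightarrow> 0) (at l)" by simp
qed (auto intro!: bounded_linear_scaleR_left)

text \<open>The assumption \<open>ode\<close> says that the characteristic function \<open>\<phi>\<close> of \<open>S\<close> almost satisfies
  \<open>\<phi>' l = - s2 * l * \<phi> l\<close>, the differential equation of the normal law.\<close>
lemma cf_near_gaussian:
  assumes S: "S \<in> borel_measurable M" "\<And>x. \<bar>S x\<bar> \<le> K" and "s2 \<ge> 0"
    and ode: "\<And>l. 0 \<le> l \<Longrightarrow> l \<le> 1 \<Longrightarrow>
      cmod ((\<integral>x. \<i> * S x * cis (l * S x) \<partial>M) + complex_of_real (l * s2) * (\<integral>x. cis (l * S x) \<partial>M)) \<le> C"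
  shows "cmod ((\<integral>x. cis (S x) \<partial>M) - complex_of_real (exp (- s2 / 2))) \<le> C"
proof -
  define phi where "phi l = (\<integral>x. cis (l * S x) \<partial>M)" for l
  define dphi where "dphi l = (\<integral>x. \<i> * S x * cis (l * S x) \<partial>M)" for l
  \<comment> \<open>The integrating factor of the differential equation: the derivative of
    \<open>g\<close> is this exponential times the defect bounded by \<open>C\<close>. On
    \<open>[0, 1]\<close> the exponential is at most \<open>exp (s2 / 2)\<close>, and multiplying
    back by \<open>exp (- s2 / 2)\<close> cancels it, so that no variance enters the final
    bound.\<close>
  define g where "g l = exp (l\<^sup>2 * s2 / 2 :: real) *\<^sub>R phi l" for l :: real
  have dphi: "(phi has_vector_derivative dphi l) (at l)" for l
    unfolding phi_def dphi_def by (rule cf_bounded_derivative[OF S])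
  have g: "(g has_vector_derivative exp (l\<^sup>2 * s2 / 2 :: real) *\<^sub>R (dphi l + complex_of_real (l * s2) * phi l)) (at l)" for l :: real
    unfolding g_def
    by (rule derivative_eq_intros dphi refl | simp)+ (simp add: algebra_simps scaleR_conv_of_real)
  have "norm (g 1 - g 0) \<le> exp (s2 / 2) * C * 1 - exp (s2 / 2) * C * 0"
  proof (rule differentiable_bound_general[where f' = "\<lambda>l :: real. exp (l\<^sup>2 * s2 / 2 :: real) *\<^sub>R (dphi l + complex_of_real (l * s2) * phi l)" and \<phi>' = "\<lambda>_. exp (s2 / 2) * C"])
    show "continuous_on {0..1} g"
      using g by (meson continuous_at_imp_continuous_on has_vector_derivative_continuous)
    fix x :: real assume x: "0 < x" "x < 1"
    have "x\<^sup>2 * s2 \<le> 1 * s2" using x \<open>s2 \<ge> 0\<close> by (intro mult_right_mono) (auto simp: power_le_one)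
    then have "exp (x\<^sup>2 * s2 / 2) \<le> exp (s2 / 2)" by simp
    then show "norm (exp (x\<^sup>2 * s2 / 2) *\<^sub>R (dphi x + complex_of_real (x * s2) * phi x)) \<le> exp (s2 / 2) * C"
      using ode[of x] x by (auto simp: dphi_def phi_def intro!: mult_mono)
  qed (use g in \<open>auto intro!: derivative_eq_intros continuous_intros simp del: of_real_mult\<close>)
  then have *: "cmod (exp (s2 / 2 :: real) *\<^sub>R phi 1 - 1) \<le> exp (s2 / 2) * C"
    by (simp add: g_def phi_def prob_space)
  have "cmod (phi 1 - complex_of_real (exp (- s2 / 2))) = exp (- s2 / 2) * cmod (exp (s2 / 2 :: real) *\<^sub>R phi 1 - 1)"
  proof -
    have "phi 1 - complex_of_real (exp (- s2 / 2)) = exp (- s2 / 2 :: real) *\<^sub>R (exp (s2 / 2 :: real) *\<^sub>R phi 1 - 1)"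
      by (simp add: scaleR_diff_right exp_minus scaleR_conv_of_real right_diff_distrib)
    then show ?thesis by simp
  qed
  also have "\<dots> \<le> exp (- s2 / 2) * (exp (s2 / 2) * C)" using * by simp
  also have "\<dots> = C" by (simp flip: exp_add mult.assoc)
  finally show ?thesis by (simp add: phi_def)
qed

end

text \<open>Tikhomirov's method. With \<open>N\<close> and \<open>N'\<close> the sums over the windows of radius \<open>2 * m\<close> and
  \<open>4 * m\<close> around \<open>t\<close>, the variable \<open>xi t\<close> is independent of \<open>S - N\<close>, and \<open>xi t * N\<close> of \<open>S - N'\<close>.\<close>
lemma (in indep_noise) m_dependent_cf_bound:
  fixes xi :: "int \<Rightarrow> 'w \<Rightarrow> real"
  assumes "finite I" "m \<ge> 1"
    and meas: "\<And>t. t \<in> I \<Longrightarrow> xi t \<in> borel_measurable (block {t - int m<..<t + int m})"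
    and bound: "\<And>t x. t \<in> I \<Longrightarrow> \<bar>xi t x\<bar> \<le> a"
    and mean: "\<And>t. t \<in> I \<Longrightarrow> (\<integral>x. xi t x \<partial>M) = 0"
    and "a \<ge> 0"
  defines "S \<equiv> \<lambda>x. \<Sum>t\<in>I. xi t x"
  shows "cmod ((\<integral>x. cis (S x) \<partial>M) - complex_of_real (exp (- (\<integral>x. (S x)\<^sup>2 \<partial>M) / 2)))
    \<le> 72 * (real m)\<^sup>2 * a * (\<Sum>t\<in>I. \<integral>x. (xi t x)\<^sup>2 \<partial>M)"
proof -
  define B where "B k t = {s\<in>I. \<bar>s - t\<bar> < int k}" for k :: nat and t
  define W where "W k t x = (\<Sum>s\<in>B k t. xi s x)" for k t x
  define s2 where "s2 = (\<integral>x. (S x)\<^sup>2 \<partial>M)"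
  define Q where "Q = (\<Sum>t\<in>I. \<integral>x. (xi t x)\<^sup>2 \<partial>M)"
  have finB: "finite (B k t)" for k t using \<open>finite I\<close> by (simp add: B_def)
  have cardB: "card (B k t) \<le> 2 * k" for k t
  proof -
    have "card (B k t) \<le> card {t - int k <..< t + int k}"
      by (rule card_mono) (auto simp: B_def)
    then show ?thesis by simp
  qed
  have W_bound: "\<bar>W k t x\<bar> \<le> 2 * real k * a" for k t x
  proof -
    have "\<bar>W k t x\<bar> \<le> (\<Sum>s\<in>B k t. \<bar>xi s x\<bar>)" unfolding W_def by (rule sum_abs)
    also have "\<dots> \<le> real (card (B k t)) * a" using bound by (intro sum_bounded_above) (auto simp: B_def)
    also have "\<dots> \<le> real (2 * k) * a" using cardB \<open>a \<ge> 0\<close> by (intro mult_right_mono) (simp_all only: of_nat_le_iff)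
    finally show ?thesis by simp
  qed
  have W_meas: "W k t \<in> borel_measurable (block {s. \<bar>s - t\<bar> < int (k + m)})" for k t
    unfolding W_def
  proof (intro borel_measurable_sum)
    fix s assume "s \<in> B k t"
    then show "xi s \<in> borel_measurable (block {s. \<bar>s - t\<bar> < int (k + m)})"
      by (intro block_mono[OF meas]) (auto simp: B_def)
  qed
  have SW: "S x - W k t x = (\<Sum>s\<in>I - B k t. xi s x)" for k t x
    unfolding S_def W_def using \<open>finite I\<close> by (subst sum_diff) (auto simp: B_def)
  \<comment> \<open>A summand at distance at least \<open>k + m\<close> from \<open>t\<close>
    reaches back by less than \<open>m\<close>, so it avoids the innovations within \<open>k\<close>
    of \<open>t\<close>. Used with \<open>k = m\<close> for \<open>S - N\<close> and with
    \<open>k = 3 * m\<close> for \<open>S - N'\<close>, as \<open>xi t * N\<close> spreads over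
    radius \<open>3 * m\<close>.\<close>
  have SW_meas: "(\<lambda>x. S x - W (k + m) t x) \<in> borel_measurable (block {s. \<bar>s - t\<bar> \<ge> int k})" for k t
    unfolding SW
  proof (intro borel_measurable_sum)
    fix s assume "s \<in> I - B (k + m) t"
    then show "xi s \<in> borel_measurable (block {s. \<bar>s - t\<bar> \<ge> int k})"
      by (intro block_mono[OF meas]) (auto simp: B_def)
  qed
  have xi_m: "xi t \<in> borel_measurable M" if "t \<in> I" for t using block_measurable[OF meas[OF that]] .
  have W_m: "W k t \<in> borel_measurable M" for k t using block_measurable[OF W_meas] .
  have S_m: "S \<in> borel_measurable M" unfolding S_def using xi_m by measurable
  have S_bound: "\<bar>S x\<bar> \<le> card I * a" for x
    unfolding S_def by (rule order_trans[OF sum_abs sum_bounded_above]) (use bound in auto)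
  have xi_i: "integrable M (xi t)" if "t \<in> I" for t
    by (rule integrable_bdd[OF xi_m[OF that], of a]) (use bound that in simp)
  have W_i: "integrable M (W k t)" for k t
    by (rule integrable_bdd[OF W_m]) (use W_bound in simp)
  have S_i: "integrable M S"
    by (rule integrable_bdd[OF S_m]) (use S_bound in simp)
  have cis_meas: "(\<lambda>x. cis (l * Z x)) \<in> borel_measurable M'" if "Z \<in> borel_measurable M'" for l Z and M' :: "'w measure"
    by (rule borel_measurable_continuous_on[OF _ that]) (intro continuous_intros)
  \<comment> \<open>Only the near part of \<open>S\<close> correlates with \<open>xi t\<close>: the
    far part is independent of it, and \<open>xi t\<close> has mean zero.\<close>
  have s2W: "s2 = (\<Sum>t\<in>I. \<integral>x. xi t x * W (2 * m) t x \<partial>M)"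
  proof -
    have prod_i: "integrable M (\<lambda>x. xi t x * Z x)"
      if "t \<in> I" "Z \<in> borel_measurable M" "\<And>x. \<bar>Z x\<bar> \<le> b" for t Z b
      using bound[OF that(1)] xi_m[OF that(1)] that(2,3) \<open>a \<ge> 0\<close>
      by (auto simp: abs_mult intro!: integrable_bdd[where c="a * b"] mult_mono)
    note int = prod_i[OF _ S_m S_bound] prod_i[OF _ W_m W_bound]
    have "(\<integral>x. xi t x * S x \<partial>M) = (\<integral>x. xi t x * W (2 * m) t x \<partial>M)" if t: "t \<in> I" for t
    proof -
      have "(\<integral>x. xi t x * (S x - W (m + m) t x) \<partial>M) = (\<integral>x. xi t x \<partial>M) * (\<integral>x. S x - W (m + m) t x \<partial>M)"
      proof (rule expectation_block_mult[OF meas[OF t] SW_meas])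
      qed (use xi_i[OF t] S_i W_i in auto)
      then show ?thesis using int[OF t] mean[OF t] by (simp add: right_diff_distrib mult_2)
    qed
    moreover have "s2 = (\<integral>x. (\<Sum>t\<in>I. xi t x * S x) \<partial>M)"
      unfolding s2_def power2_eq_square by (subst S_def) (simp add: sum_distrib_right)
    ultimately show ?thesis using int by simp
  qed
  define e where "e t = (\<integral>x. \<bar>xi t x * W (2 * m) t x\<bar> \<partial>M)" for t
  let ?v = "\<lambda>t. \<integral>x. (xi t x)\<^sup>2 \<partial>M"
  \<comment> \<open>Products are split by
    \<open>\<bar>x * y\<bar> \<le> (x\<^sup>2 + y\<^sup>2) / 2\<close>. The relation
    \<open>\<bar>s - t\<bar> < 2 * m\<close> is symmetric, so both halves have the same total, and
    each variance is counted at most \<open>4 * m\<close> times.\<close>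
  have e_sum: "(\<Sum>t\<in>I. e t) \<le> 4 * real m * Q"
  proof -
    have q: "integrable M (\<lambda>x. (xi t x)\<^sup>2)" if "t \<in> I" for t
      using bound[OF that] xi_m[OF that] \<open>a \<ge> 0\<close>
      by (auto intro!: integrable_bdd[where c="a\<^sup>2"] simp: abs_le_square_iff[symmetric])
    have "e t \<le> (\<Sum>s\<in>B (2 * m) t. (?v t + ?v s) / 2)" if t: "t \<in> I" for t
    proof -
      have BI: "s \<in> B (2 * m) t \<Longrightarrow> s \<in> I" for s by (simp add: B_def)
      have "e t \<le> (\<integral>x. (\<Sum>s\<in>B (2 * m) t. ((xi t x)\<^sup>2 + (xi s x)\<^sup>2) / 2) \<partial>M)"
        unfolding e_def
      proof (rule integral_mono)
        show "integrable M (\<lambda>x. \<bar>xi t x * W (2 * m) t x\<bar>)"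
          using bound[OF t] W_bound[of "2 * m" t] xi_m[OF t] W_m \<open>a \<ge> 0\<close>
          by (auto simp: abs_mult intro!: integrable_bdd[where c="a * (2 * real (2 * m) * a)"] mult_mono)
        show "integrable M (\<lambda>x. \<Sum>s\<in>B (2 * m) t. ((xi t x)\<^sup>2 + (xi s x)\<^sup>2) / 2)"
          using q t BI by (intro Bochner_Integration.integrable_sum) auto
        fix x
        have "\<bar>xi t x * W (2 * m) t x\<bar> \<le> (\<Sum>s\<in>B (2 * m) t. \<bar>xi t x * xi s x\<bar>)"
          unfolding W_def sum_distrib_left by (rule sum_abs)
        also have "\<dots> \<le> (\<Sum>s\<in>B (2 * m) t. ((xi t x)\<^sup>2 + (xi s x)\<^sup>2) / 2)"
        proof (rule sum_mono)
          fix s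
          show "\<bar>xi t x * xi s x\<bar> \<le> ((xi t x)\<^sup>2 + (xi s x)\<^sup>2) / 2"
            using sum_squares_bound[of "\<bar>xi t x\<bar>" "\<bar>xi s x\<bar>"] by (simp add: abs_mult)
        qed
        finally show "\<bar>xi t x * W (2 * m) t x\<bar> \<le> \<dots>" .
      qed
      also have "\<dots> = (\<Sum>s\<in>B (2 * m) t. (?v t + ?v s) / 2)"
        using q t BI by (subst Bochner_Integration.integral_sum) (auto intro!: sum.cong)
      finally show ?thesis .
    qed
    then have "(\<Sum>t\<in>I. e t) \<le> (\<Sum>t\<in>I. \<Sum>s\<in>B (2 * m) t. (?v t + ?v s) / 2)"
      by (rule sum_mono)
    also have "\<dots> = (\<Sum>t\<in>I. \<Sum>s\<in>B (2 * m) t. ?v t / 2) + (\<Sum>t\<in>I. \<Sum>s\<in>B (2 * m) t. ?v s / 2)"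
      by (simp add: add_divide_distrib sum.distrib)
    also have "(\<Sum>t\<in>I. \<Sum>s\<in>B (2 * m) t. ?v s / 2) = (\<Sum>t\<in>I. \<Sum>s\<in>B (2 * m) t. ?v t / 2)"
    proof -
      have ind: "(\<Sum>s\<in>B (2 * m) t. F s) = (\<Sum>s\<in>I. if \<bar>s - t\<bar> < int (2 * m) then F s else 0)" for F :: "int \<Rightarrow> real" and t
        unfolding B_def using \<open>finite I\<close> by (simp add: sum.inter_filter)
      show ?thesis unfolding ind by (subst sum.swap) (simp add: abs_minus_commute)
    qed
    also have "(\<Sum>t\<in>I. \<Sum>s\<in>B (2 * m) t. ?v t / 2) + (\<Sum>t\<in>I. \<Sum>s\<in>B (2 * m) t. ?v t / 2)
      = (\<Sum>t\<in>I. real (card (B (2 * m) t)) * ?v t)"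
      by (simp flip: sum.distrib)
    also have "\<dots> \<le> (\<Sum>t\<in>I. real (2 * (2 * m)) * ?v t)"
      using cardB by (intro sum_mono mult_right_mono) (simp_all only: of_nat_le_iff, simp)
    finally show ?thesis by (simp add: Q_def sum_distrib_left)
  qed
  define phi where "phi l = (\<integral>x. cis (l * S x) \<partial>M)" for l
  \<comment> \<open>Write \<open>cis (l * S) = D * cis (l * N)\<close> and expand the second factor
    to first order. The constant term has mean zero, by independence; in the linear term
    \<open>D\<close> is replaced by \<open>D'\<close>, which is independent of
    \<open>xi t * N\<close>, and then \<open>E D'\<close> by \<open>phi l\<close>. The constant is
    \<open>18 = 2 + 8 + 8\<close>: half of \<open>\<bar>N\<bar> \<le> 4 * m * a\<close> from the
    remainder, \<open>\<bar>N' - N\<bar> \<le> 8 * m * a\<close> for \<open>D - D'\<close>, and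
    \<open>\<bar>N'\<bar> \<le> 8 * m * a\<close> for \<open>E D' - phi l\<close>. With the factor
    \<open>4 * m\<close> of \<open>e_sum\<close> it becomes \<open>72\<close>.\<close>
  have deriv_term: "cmod ((\<integral>x. xi t x * cis (l * S x) \<partial>M) - \<i> * l * (\<integral>x. xi t x * W (2 * m) t x \<partial>M) * phi l)
      \<le> 18 * real m * a * e t" if t: "t \<in> I" and l: "0 \<le> l" "l \<le> 1" for t and l :: real
  proof -
    let ?x = "\<lambda>x. complex_of_real (xi t x)"
    let ?N = "W (2 * m) t" and ?N' = "W (4 * m) t"
    let ?xN = "\<lambda>x. complex_of_real (xi t x * ?N x)"
    define D where "D = (\<lambda>x. cis (l * (S x - ?N x)))"
    define D' where "D' = (\<lambda>x. cis (l * (S x - ?N' x)))"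
    have D_meas: "D \<in> borel_measurable (block {s. \<bar>s - t\<bar> \<ge> int m})"
      unfolding D_def using cis_meas[OF SW_meas[of m t]] by (simp add: mult_2)
    have "4 * m = 3 * m + m" by simp
    then have D'_meas: "D' \<in> borel_measurable (block {s. \<bar>s - t\<bar> \<ge> int (3 * m)})"
      unfolding D'_def using cis_meas[OF SW_meas[of "3 * m" t]] by metis
    have xN_meas: "?xN \<in> borel_measurable (block {s. \<bar>s - t\<bar> < int (3 * m)})"
    proof -
      have "?N \<in> borel_measurable (block {s. \<bar>s - t\<bar> < int (3 * m)})" using W_meas[of "2 * m" t] by simp
      moreover have "xi t \<in> borel_measurable (block {s. \<bar>s - t\<bar> < int (3 * m)})"
        by (rule block_mono[OF meas[OF t]]) auto
      ultimately show ?thesis by measurable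
    qed
    note [measurable] = xi_m[OF t] W_m S_m block_measurable[OF D_meas] block_measurable[OF D'_meas] cis_meas
    have xb: "cmod (?x x) \<le> a" for x using bound[OF t] by simp
    have D1: "cmod (D x) = 1" "cmod (D' x) = 1" for x by (simp_all add: D_def D'_def)
    have xNb: "cmod (?xN x) \<le> a * (4 * real m * a)" for x
      using bound[OF t, of x] W_bound[of "2 * m" t x] \<open>a \<ge> 0\<close> by (auto simp: norm_mult abs_mult intro!: mult_mono)
    have int: "integrable M (\<lambda>x. ?x x * cis (l * S x))" "integrable M (\<lambda>x. ?x x * D x)"
      "integrable M (\<lambda>x. ?xN x * D' x)" "integrable M ?x" "integrable M ?xN" "integrable M D" "integrable M D'"
      "integrable M (\<lambda>x. cis (l * S x))" "integrable M (\<lambda>x. \<bar>xi t x * ?N x\<bar>)"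
      by (rule integrable_bdd[where c=a] integrable_bdd[where c=1] integrable_bdd[where c="a * (4 * real m * a)"];
        (measurable; fail | use xb xNb D1 in \<open>auto simp: norm_mult abs_mult simp del: of_real_mult; fail\<close>))+
    have xD: "(\<integral>x. ?x x * D x \<partial>M) = 0"
    proof -
      have "(\<integral>x. ?x x * D x \<partial>M) = (\<integral>x. ?x x \<partial>M) * (\<integral>x. D x \<partial>M)"
        by (rule expectation_block_mult[OF _ D_meas _ int(4,6), of "{t - int m<..<t + int m}"]) (use meas[OF t] in auto)
      then show ?thesis using mean[OF t] by simp
    qed
    have xND': "(\<integral>x. ?xN x * D' x \<partial>M) = (\<integral>x. ?xN x \<partial>M) * (\<integral>x. D' x \<partial>M)"
      by (rule expectation_block_mult[OF xN_meas D'_meas _ int(5,7)]) auto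
    define R where "R = (\<lambda>x. ?x x * cis (l * S x) - ?x x * D x - \<i> * l * (?xN x * D' x))"
    have R: "cmod (R x) \<le> 10 * real m * a * \<bar>xi t x * ?N x\<bar>" for x
    proof -
      have "R x = ?x x * D x * (cis (l * ?N x) - 1 - \<i> * (l * ?N x)) + \<i> * l * ?xN x * (D x - D' x)"
        by (simp add: R_def D_def algebra_simps cis_mult)
      also have "cmod \<dots> \<le> \<bar>xi t x\<bar> * ((l * ?N x)\<^sup>2 / 2) + l * \<bar>xi t x * ?N x\<bar> * \<bar>l * (S x - ?N x) - l * (S x - ?N' x)\<bar>"
      proof (rule order_trans[OF norm_triangle_ineq add_mono])
        show "cmod (?x x * D x * (cis (l * ?N x) - 1 - \<i> * (l * ?N x))) \<le> \<bar>xi t x\<bar> * ((l * ?N x)\<^sup>2 / 2)"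
          unfolding norm_mult[of "?x x * D x"] norm_mult[of "?x x"] D1 norm_of_real mult_1_right
          by (intro mult_left_mono norm_cis_approx2) simp
        have "cmod (\<i> * l * ?xN x * (D x - D' x)) = l * \<bar>xi t x * ?N x\<bar> * cmod (D x - D' x)"
          using l(1) by (simp only: norm_mult norm_of_real norm_ii mult_1 abs_of_nonneg)
        also have "\<dots> \<le> l * \<bar>xi t x * ?N x\<bar> * \<bar>l * (S x - ?N x) - l * (S x - ?N' x)\<bar>"
          unfolding D_def D'_def using l(1) by (intro mult_left_mono norm_cis_diff) simp
        finally show "cmod (\<i> * l * ?xN x * (D x - D' x)) \<le> \<dots>" .
      qed
      also have "\<dots> = \<bar>xi t x * ?N x\<bar> * (l\<^sup>2 * \<bar>?N x\<bar> / 2 + l\<^sup>2 * \<bar>?N' x - ?N x\<bar>)"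
      proof -
        have "l * (S x - ?N x) - l * (S x - ?N' x) = l * (?N' x - ?N x)" by (simp add: algebra_simps)
        then have "\<bar>l * (S x - ?N x) - l * (S x - ?N' x)\<bar> = l * \<bar>?N' x - ?N x\<bar>" using l by (simp add: abs_mult)
        moreover have "(l * ?N x)\<^sup>2 = l\<^sup>2 * (\<bar>?N x\<bar> * \<bar>?N x\<bar>)" by (simp add: power2_eq_square)
        ultimately show ?thesis by (simp only: abs_mult power2_eq_square) (simp add: algebra_simps)
      qed
      also have "\<dots> \<le> \<bar>xi t x * ?N x\<bar> * (1 * (4 * real m * a) / 2 + 1 * (8 * real m * a))"
      proof (intro mult_left_mono add_mono divide_right_mono mult_mono)
        show "\<bar>?N' x - ?N x\<bar> \<le> 8 * real m * a"
        proof -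
          have "?N' x - ?N x = (\<Sum>s\<in>B (4 * m) t - B (2 * m) t. xi s x)"
            unfolding W_def by (subst sum_diff[OF finB]) (auto simp: B_def)
          also have "\<bar>\<dots>\<bar> \<le> (\<Sum>s\<in>B (4 * m) t - B (2 * m) t. \<bar>xi s x\<bar>)" by (rule sum_abs)
          also have "\<dots> \<le> (\<Sum>s\<in>B (4 * m) t. \<bar>xi s x\<bar>)" using finB by (intro sum_mono2) auto
          also have "\<dots> \<le> real (card (B (4 * m) t)) * a" using bound by (intro sum_bounded_above) (auto simp: B_def)
          also have "\<dots> \<le> real (2 * (4 * m)) * a" using cardB \<open>a \<ge> 0\<close> by (intro mult_right_mono) (simp_all only: of_nat_le_iff)
          finally show ?thesis by simp
        qed
        show "l\<^sup>2 \<le> 1" "l\<^sup>2 \<le> 1" using l by (simp_all add: power_le_one)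
      qed (use W_bound[of "2 * m" t x] in auto)
      also have "\<dots> = 10 * real m * a * \<bar>xi t x * ?N x\<bar>" by (simp add: algebra_simps)
      finally show ?thesis .
    qed
    have "(\<integral>x. R x \<partial>M) = (\<integral>x. ?x x * cis (l * S x) \<partial>M) - \<i> * l * ((\<integral>x. ?xN x \<partial>M) * (\<integral>x. D' x \<partial>M))"
      unfolding R_def using int(1-3) xD xND' by (simp del: of_real_mult)
    then have eq: "(\<integral>x. ?x x * cis (l * S x) \<partial>M) - \<i> * l * (\<integral>x. xi t x * ?N x \<partial>M) * phi l
        = (\<integral>x. R x \<partial>M) + \<i> * l * (\<integral>x. ?xN x \<partial>M) * ((\<integral>x. D' x \<partial>M) - phi l)"
      by (simp add: algebra_simps del: of_real_mult)
    have "cmod (\<integral>x. R x \<partial>M) \<le> (\<integral>x. 10 * real m * a * \<bar>xi t x * ?N x\<bar> \<partial>M)"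
      by (rule norm_expectation_le[OF _ R]) (use int(9) in simp)
    then have R_le: "cmod (\<integral>x. R x \<partial>M) \<le> 10 * real m * a * e t" by (simp add: e_def)
    have "cmod (\<integral>x. D' x - cis (l * S x) \<partial>M) \<le> (\<integral>x. 8 * real m * a \<partial>M)"
    proof (rule norm_expectation_le)
      fix x
      have "cmod (D' x - cis (l * S x)) \<le> l * \<bar>?N' x\<bar>"
        using norm_cis_diff[of "l * (S x - ?N' x)" "l * S x"] l by (simp add: D'_def abs_mult right_diff_distrib)
      also have "\<dots> \<le> 1 * (8 * real m * a)" using W_bound[of "4 * m" t x] l by (intro mult_mono) auto
      finally show "cmod (D' x - cis (l * S x)) \<le> 8 * real m * a" by simp
    qed simp
    then have D'_le: "cmod ((\<integral>x. D' x \<partial>M) - phi l) \<le> 8 * real m * a"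
      using int(7,8) by (simp add: phi_def prob_space)
    have xN_le: "cmod (\<integral>x. ?xN x \<partial>M) \<le> e t"
      unfolding e_def by (rule norm_expectation_le[OF int(9)]) (simp del: of_real_mult)
    have e0: "e t \<ge> 0" by (simp add: e_def)
    have "cmod ((\<integral>x. R x \<partial>M) + \<i> * l * (\<integral>x. ?xN x \<partial>M) * ((\<integral>x. D' x \<partial>M) - phi l))
      \<le> 10 * real m * a * e t + 1 * e t * (8 * real m * a)"
    proof (intro order_trans[OF norm_triangle_ineq] add_mono R_le)
      have "l * cmod (\<integral>x. ?xN x \<partial>M) * cmod ((\<integral>x. D' x \<partial>M) - phi l) \<le> 1 * e t * (8 * real m * a)"
        by (intro mult_mono D'_le xN_le l mult_nonneg_nonneg norm_ge_zero e0) (simp_all add: e0)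
      then show "cmod (\<i> * l * (\<integral>x. ?xN x \<partial>M) * ((\<integral>x. D' x \<partial>M) - phi l)) \<le> 1 * e t * (8 * real m * a)"
        using l(1) by (simp only: norm_mult norm_ii norm_of_real abs_of_nonneg mult_1)
    qed
    then show ?thesis unfolding eq by (simp add: algebra_simps)
  qed
  show ?thesis
    unfolding s2_def[symmetric] Q_def[symmetric]
  proof (rule cf_near_gaussian[OF S_m S_bound])
    show "s2 \<ge> 0" by (simp add: s2_def)
    fix l :: real assume l: "0 \<le> l" "l \<le> 1"
    have "integrable M (\<lambda>x. xi t x * cis (l * S x))" if "t \<in> I" for t
      using bound[OF that] xi_m[OF that] cis_meas[OF S_m] by (intro integrable_bdd[where c=a]) (auto simp: norm_mult)
    then have "(\<integral>x. \<i> * S x * cis (l * S x) \<partial>M) = \<i> * (\<Sum>t\<in>I. \<integral>x. xi t x * cis (l * S x) \<partial>M)"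
      by (subst (1) S_def) (simp add: sum_distrib_right mult.assoc)
    moreover have "complex_of_real (l * s2) * phi l = \<i> * (\<Sum>t\<in>I. - \<i> * l * (\<integral>x. xi t x * W (2 * m) t x \<partial>M) * phi l)"
      unfolding s2W by (simp add: sum_distrib_left sum_distrib_right mult.assoc)
    ultimately have "(\<integral>x. \<i> * S x * cis (l * S x) \<partial>M) + complex_of_real (l * s2) * phi l =
      \<i> * (\<Sum>t\<in>I. (\<integral>x. xi t x * cis (l * S x) \<partial>M) - \<i> * l * (\<integral>x. xi t x * W (2 * m) t x \<partial>M) * phi l)"
      by (simp add: sum_subtractf sum_negf distrib_left right_diff_distrib)
    also have "cmod \<dots> \<le> (\<Sum>t\<in>I. 18 * real m * a * e t)"
      using deriv_term[OF _ l] by (auto simp: norm_mult intro!: order_trans[OF norm_sum] sum_mono)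
    also have "\<dots> \<le> 18 * real m * a * (4 * real m * Q)"
      unfolding sum_distrib_left[symmetric] using e_sum \<open>a \<ge> 0\<close> by (intro mult_left_mono) auto
    also have "\<dots> = 72 * (real m)\<^sup>2 * a * Q" by (simp add: power2_eq_square)
    finally show "cmod ((\<integral>x. \<i> * S x * cis (l * S x) \<partial>M) + complex_of_real (l * s2) * (\<integral>x. cis (l * S x) \<partial>M)) \<le> 72 * (real m)\<^sup>2 * a * Q"
      by (simp add: phi_def)
  qed
qed

section \<open>Vector-valued two-sided series\<close>

lemma norm1v_nonneg [simp]: "norm1v x \<ge> 0"
  by (simp add: norm1v_def sum_nonneg)

lemma norm1v_0 [simp]: "norm1v 0 = 0"
  by (simp add: norm1v_def)

lemma norm1v_triangle: "norm1v (x + y) \<le> norm1v x + norm1v y"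
  unfolding norm1v_def by (simp add: sum_mono flip: sum.distrib)

lemma norm1v_sum: "norm1v (\<Sum>i\<in>I. f i) \<le> (\<Sum>i\<in>I. norm1v (f i))"
  by (induction I rule: infinite_finite_induct) (auto intro: order_trans[OF norm1v_triangle])

lemma norm_le_norm1v: "norm x \<le> norm1v x"
  unfolding norm1v_def by (rule norm_le_l1_cart)

lemma continuous_norm1v [continuous_intros]: "continuous_on A f \<Longrightarrow> continuous_on A (\<lambda>x. norm1v (f x))"
  unfolding norm1v_def by (intro continuous_intros)

lemma tendsto_norm1v [tendsto_intros]: "(f \<longlongrightarrow> l) F \<Longrightarrow> ((\<lambda>x. norm1v (f x)) \<longlongrightarrow> norm1v l) F"
  unfolding norm1v_def by (intro tendsto_intros)

lemma norm1v_measurable [measurable]: "f \<in> borel_measurable M \<Longrightarrow> (\<lambda>x. norm1v (f x)) \<in> borel_measurable M"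
  by (rule borel_measurable_continuous_on[OF _ ]) (auto intro!: continuous_intros)

lemma mnorm1_column_le: "(\<Sum>p\<in>UNIV. \<bar>A $ p $ q\<bar>) \<le> mnorm1 A"
  unfolding mnorm1_def by (rule Max_ge) auto

lemma mnorm1_nonneg [simp]: "mnorm1 A \<ge> 0"
  using mnorm1_column_le[of A undefined] by (meson abs_ge_zero order_trans sum_nonneg)

lemma mnorm1_le: "(\<And>q. (\<Sum>p\<in>UNIV. \<bar>A $ p $ q\<bar>) \<le> c) \<Longrightarrow> mnorm1 A \<le> c"
  unfolding mnorm1_def by (subst Max_le_iff) auto

lemma mnorm1_le_entries:
  fixes A :: "real^'d^'d"
  assumes "\<And>p q. \<bar>A $ p $ q\<bar> \<le> (c :: real)"
  shows "mnorm1 A \<le> real CARD('d) * c"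
proof (rule mnorm1_le)
  fix q
  show "(\<Sum>p\<in>UNIV. \<bar>A $ p $ q\<bar>) \<le> real CARD('d) * c"
    using sum_bounded_above[of UNIV "\<lambda>p. \<bar>A $ p $ q\<bar>" c] assms by simp
qed

lemma mnorm1_0 [simp]: "mnorm1 0 = 0"
  by (rule antisym) (auto intro: mnorm1_le)

lemma mnorm1_triangle: "mnorm1 (A + B) \<le> mnorm1 A + mnorm1 B"
proof (rule mnorm1_le)
  fix q
  have "(\<Sum>p\<in>UNIV. \<bar>(A + B) $ p $ q\<bar>) \<le> (\<Sum>p\<in>UNIV. \<bar>A $ p $ q\<bar>) + (\<Sum>p\<in>UNIV. \<bar>B $ p $ q\<bar>)"
    by (simp add: sum_mono flip: sum.distrib)
  then show "(\<Sum>p\<in>UNIV. \<bar>(A + B) $ p $ q\<bar>) \<le> mnorm1 A + mnorm1 B"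
    by (rule order_trans) (intro add_mono mnorm1_column_le)
qed

lemma norm1v_mult_le: "norm1v (A *v x) \<le> mnorm1 A * norm1v x"
proof -
  have "norm1v (A *v x) \<le> (\<Sum>p\<in>UNIV. \<Sum>q\<in>UNIV. \<bar>A $ p $ q\<bar> * \<bar>x $ q\<bar>)"
    unfolding norm1v_def matrix_vector_mult_def by (auto intro!: sum_mono order_trans[OF sum_abs] simp: abs_mult)
  also have "\<dots> = (\<Sum>q\<in>UNIV. (\<Sum>p\<in>UNIV. \<bar>A $ p $ q\<bar>) * \<bar>x $ q\<bar>)"
    by (subst sum.swap) (simp add: sum_distrib_right)
  also have "\<dots> \<le> (\<Sum>q\<in>UNIV. mnorm1 A * \<bar>x $ q\<bar>)"
    by (intro sum_mono mult_right_mono mnorm1_column_le) auto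
  finally show ?thesis by (simp add: norm1v_def sum_distrib_left)
qed

section \<open>Summation over symmetric windows of integers\<close>

lemma window_eq: "{j :: int. \<bar>j\<bar> < int n} = {- int n <..< int n}"
  by auto

lemma finite_window [simp]: "finite {j :: int. \<bar>j\<bar> < int n}"
  by (simp add: window_eq)

text \<open>Turns an unconditional sum over the integers into the limit of a sequence, the form in
  which measurability and Fatou's lemma apply.\<close>

lemma filterlim_window: "filterlim (\<lambda>n. {j :: int. \<bar>j\<bar> < int n}) (finite_subsets_at_top UNIV) sequentially"
  unfolding filterlim_finite_subsets_at_top
proof (intro allI impI)
  fix F :: "int set" assume F: "finite F \<and> F \<subseteq> UNIV"
  define k where "k = nat (Max (insert 0 (abs ` F))) + 1"
  have "\<bar>j\<bar> < int k" if "j \<in> F" for j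
  proof -
    have "\<bar>j\<bar> \<le> Max (insert 0 (abs ` F))" using F that by (intro Max_ge) auto
    then show ?thesis unfolding k_def by linarith
  qed
  then show "\<forall>\<^sub>F n in sequentially. finite {j :: int. \<bar>j\<bar> < int n} \<and> F \<subseteq> {j. \<bar>j\<bar> < int n} \<and> {j. \<bar>j\<bar> < int n} \<subseteq> UNIV"
  proof (intro eventually_sequentiallyI[of k] conjI subsetI)
    fix n j assume "k \<le> n" "j \<in> F"
    with \<open>\<And>j. j \<in> F \<Longrightarrow> \<bar>j\<bar> < int k\<close>[of j] show "j \<in> {j. \<bar>j\<bar> < int n}" by simp
  qed auto
qed

text \<open>The window is covered by two copies of \<open>{..<n}\<close>, one per sign; counting the
  index \<open>0\<close> twice accounts for the round constant.\<close>

lemma geometric_window: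
  assumes "0 < q" "q < (1::real)"
  shows "(\<Sum>j | \<bar>j\<bar> < int n. q ^ nat \<bar>j\<bar>) \<le> 2 / (1 - q)"
proof -
  have g: "(\<Sum>k<n. q ^ k) \<le> 1 / (1 - q)"
    using assms by (subst sum_gp_strict) (auto intro!: divide_right_mono)
  have "(\<Sum>j | \<bar>j\<bar> < int n. q ^ nat \<bar>j\<bar>) \<le> (\<Sum>j\<in>int ` {..<n} \<union> (\<lambda>k. - int k) ` {..<n}. q ^ nat \<bar>j\<bar>)"
  proof (rule sum_mono2)
    show "{j :: int. \<bar>j\<bar> < int n} \<subseteq> int ` {..<n} \<union> (\<lambda>k. - int k) ` {..<n}"
    proof
      fix j :: int assume "j \<in> {j. \<bar>j\<bar> < int n}"
      then have "nat \<bar>j\<bar> < n" "j = int (nat \<bar>j\<bar>) \<or> j = - int (nat \<bar>j\<bar>)" by auto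
      then show "j \<in> int ` {..<n} \<union> (\<lambda>k. - int k) ` {..<n}" by blast
    qed
  qed (use assms in auto)
  also have "\<dots> \<le> (\<Sum>j\<in>int ` {..<n}. q ^ nat \<bar>j\<bar>) + (\<Sum>j\<in>(\<lambda>k. - int k) ` {..<n}. q ^ nat \<bar>j\<bar>)"
    using assms by (subst sum_Un_nat[symmetric] sum.union_inter[symmetric]) (auto intro!: sum_nonneg)
  also have "\<dots> = 2 * (\<Sum>k<n. q ^ k)"
    by (subst (1 2) sum.reindex) (auto simp: inj_on_def)
  finally show ?thesis using g by simp
qed

lemma infsum_window_lim:
  fixes v :: "int \<Rightarrow> 'b::{comm_monoid_add, t2_space}"
  assumes "v summable_on UNIV"
  shows "(\<lambda>n. \<Sum>j | \<bar>j\<bar> < int n. v j) \<longlonglongrightarrow> infsum v UNIV"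
proof -
  have "(sum v \<longlongrightarrow> infsum v UNIV) (finite_subsets_at_top UNIV)"
    using has_sum_infsum[OF assms] unfolding has_sum_def .
  from filterlim_compose[OF this filterlim_window] show ?thesis .
qed

lemma nonneg_window_summable:
  fixes f :: "int \<Rightarrow> real"
  assumes f: "\<And>j. f j \<ge> 0" and C: "\<And>n. (\<Sum>j | \<bar>j\<bar> < int n. f j) \<le> C"
  shows "f summable_on UNIV"
proof (rule nonneg_bdd_above_summable_on)
  show "bdd_above (sum f ` {F. F \<subseteq> UNIV \<and> finite F})"
  proof (rule bdd_aboveI2)
    fix F :: "int set" assume "F \<in> {F. F \<subseteq> UNIV \<and> finite F}"
    then have "\<forall>\<^sub>F n in sequentially. F \<subseteq> {j. \<bar>j\<bar> < int n}"
      using filterlim_window unfolding filterlim_finite_subsets_at_top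
      by (elim allE[of _ F]) (auto elim: eventually_mono)
    then obtain n where "F \<subseteq> {j. \<bar>j\<bar> < int n}" using eventually_happens'[OF sequentially_bot] by blast
    then have "sum f F \<le> (\<Sum>j | \<bar>j\<bar> < int n. f j)" using f by (intro sum_mono2) auto
    then show "sum f F \<le> C" using C[of n] by simp
  qed
qed (rule f)

text \<open>In finite dimension unconditional and absolute convergence agree. The right-hand side
  uses countable quantifiers over finite sums only, so the set of convergence is visibly
  measurable.\<close>

lemma summable_vec_iff:
  fixes v :: "int \<Rightarrow> real^'d"
  shows "v summable_on UNIV \<longleftrightarrow> (\<exists>k::nat. \<forall>n. (\<Sum>j | \<bar>j\<bar> < int n. norm1v (v j)) \<le> real k)"
proof
  assume v: "v summable_on UNIV"
  have "(\<lambda>j. \<bar>v j $ i\<bar>) summable_on UNIV" for i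
    using summable_on_bounded_linear[OF bounded_linear_vec_nth v, of i]
    unfolding summable_on_iff_abs_summable_on_real[of "\<lambda>j. v j $ i"] by simp
  then have s: "(\<lambda>j. norm1v (v j)) summable_on UNIV"
  proof -
    have "(\<lambda>j. \<Sum>i\<in>I. \<bar>v j $ i\<bar>) summable_on UNIV" if "finite I" for I
      using that by induction (auto intro: summable_on_add \<open>\<And>i. (\<lambda>j. \<bar>v j $ i\<bar>) summable_on UNIV\<close>)
    then show ?thesis unfolding norm1v_def by simp
  qed
  obtain k :: nat where k: "infsum (\<lambda>j. norm1v (v j)) UNIV \<le> real k" using real_arch_simple by blast
  have "(\<Sum>j | \<bar>j\<bar> < int n. norm1v (v j)) \<le> real k" for n
    using finite_sum_le_infsum[OF s, of "{j. \<bar>j\<bar> < int n}"] k by simp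
  then show "\<exists>k::nat. \<forall>n. (\<Sum>j | \<bar>j\<bar> < int n. norm1v (v j)) \<le> real k" by blast
next
  assume "\<exists>k::nat. \<forall>n. (\<Sum>j | \<bar>j\<bar> < int n. norm1v (v j)) \<le> real k"
  then obtain k :: nat where k: "\<And>n. (\<Sum>j | \<bar>j\<bar> < int n. norm1v (v j)) \<le> real k" by blast
  have "(\<lambda>j. norm (v j)) summable_on UNIV"
  proof (rule nonneg_window_summable)
    show "(\<Sum>j | \<bar>j\<bar> < int n. norm (v j)) \<le> real k" for n
      by (rule order_trans[OF sum_mono[OF norm_le_norm1v] k])
  qed simp
  then show "v summable_on UNIV" by (rule abs_summable_summable)
qed

text \<open>Where the series diverges, \<open>infsum\<close> is \<open>0\<close>; hence measurability also needs that the set of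
  convergence is measurable.\<close>
lemma borel_measurable_infsum_vec:
  fixes v :: "int \<Rightarrow> 'w \<Rightarrow> real^'d"
  assumes [measurable]: "\<And>j. v j \<in> borel_measurable M"
  shows "(\<lambda>x. \<Sum>\<^sub>\<infinity>j\<in>UNIV. v j x) \<in> borel_measurable M"
proof -
  let ?P = "\<lambda>x. \<exists>k::nat. \<forall>n. (\<Sum>j | \<bar>j\<bar> < int n. norm1v (v j x)) \<le> real k"
  let ?w = "\<lambda>n x. if ?P x then (\<Sum>j | \<bar>j\<bar> < int n. v j x) else 0"
  have "?w n \<in> borel_measurable M" for n by measurable
  moreover have "(\<lambda>n. ?w n x) \<longlonglongrightarrow> (\<Sum>\<^sub>\<infinity>j\<in>UNIV. v j x)" for x
  proof (cases "?P x")
    case True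
    then show ?thesis using infsum_window_lim[of "\<lambda>j. v j x"] unfolding summable_vec_iff by simp
  next
    case False
    then have "(\<Sum>\<^sub>\<infinity>j\<in>UNIV. v j x) = 0" by (intro infsum_not_exists) (simp add: summable_vec_iff)
    then show ?thesis unfolding if_not_P[OF False] by simp
  qed
  ultimately show ?thesis by (rule borel_measurable_LIMSEQ_metric)
qed

text \<open>By monotone convergence the supremum of the partial sums of \<open>norm1v\<close> has
  expectation at most \<open>C\<close>, so it is finite almost everywhere.\<close>

lemma AE_summable_vec:
  fixes v :: "int \<Rightarrow> 'w \<Rightarrow> real^'d"
  assumes [measurable]: "\<And>j. v j \<in> borel_measurable M"
    and i: "\<And>j. integrable M (\<lambda>x. norm1v (v j x))"
    and C: "\<And>n. (\<Sum>j | \<bar>j\<bar> < int n. \<integral>x. norm1v (v j x) \<partial>M) \<le> C"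
  shows "AE x in M. (\<lambda>j. v j x) summable_on UNIV"
proof -
  let ?S = "\<lambda>n x. ennreal (\<Sum>j | \<bar>j\<bar> < int n. norm1v (v j x))"
  have "(\<integral>\<^sup>+x. (SUP n. ?S n x) \<partial>M) = (SUP n. \<integral>\<^sup>+x. ?S n x \<partial>M)"
    by (rule nn_integral_monotone_convergence_SUP)
      (auto simp: incseq_def le_fun_def intro!: ennreal_leI sum_mono2)
  also have "\<dots> \<le> ennreal C"
  proof (rule SUP_least)
    fix n
    have "(\<integral>\<^sup>+x. ?S n x \<partial>M) = ennreal (\<integral>x. (\<Sum>j | \<bar>j\<bar> < int n. norm1v (v j x)) \<partial>M)"
      by (rule nn_integral_eq_integral) (auto intro!: i sum_nonneg)
    also have "\<dots> \<le> ennreal C" using C[of n] i by (simp add: ennreal_leI)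
    finally show "(\<integral>\<^sup>+x. ?S n x \<partial>M) \<le> ennreal C" .
  qed
  finally have "(\<integral>\<^sup>+x. (SUP n. ?S n x) \<partial>M) \<noteq> \<infinity>" by (auto simp: top_unique)
  then have "AE x in M. (SUP n. ?S n x) \<noteq> \<infinity>" by (intro nn_integral_PInf_AE) auto
  then show ?thesis
  proof eventually_elim
    case (elim x)
    then have "(SUP n. ?S n x) < \<infinity>" by (simp only: less_top infinity_ennreal_def)
    then obtain k :: nat where k: "(SUP n. ?S n x) < of_nat k"
      using ennreal_Ex_less_of_nat[of "SUP n. ?S n x"] unfolding infinity_ennreal_def by blast
    have "(\<Sum>j | \<bar>j\<bar> < int n. norm1v (v j x)) \<le> real k" for n
    proof -
      have "?S n x \<le> ennreal (real k)"
        using order_trans[OF SUP_upper[of n UNIV "\<lambda>n. ?S n x"] less_imp_le[OF k]] by (simp add: ennreal_of_nat_eq_real_of_nat)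
      then show ?thesis by (subst (asm) ennreal_le_iff) auto
    qed
    then show ?case unfolding summable_vec_iff by blast
  qed
qed

text \<open>Fatou's lemma along the windows.\<close>
lemma infsum_vec_diff_L1:
  fixes v v' :: "int \<Rightarrow> 'w \<Rightarrow> real^'d"
  assumes m [measurable]: "\<And>j. v j \<in> borel_measurable M" "\<And>j. v' j \<in> borel_measurable M"
    and s: "AE x in M. (\<lambda>j. v j x) summable_on UNIV" "AE x in M. (\<lambda>j. v' j x) summable_on UNIV"
    and i: "\<And>j. integrable M (\<lambda>x. norm1v (v j x - v' j x))"
    and C: "\<And>n. (\<Sum>j | \<bar>j\<bar> < int n. \<integral>x. norm1v (v j x - v' j x) \<partial>M) \<le> C"
  defines "D \<equiv> \<lambda>x. norm1v ((\<Sum>\<^sub>\<infinity>j\<in>UNIV. v j x) - (\<Sum>\<^sub>\<infinity>j\<in>UNIV. v' j x))"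
  shows "integrable M D" "(\<integral>x. D x \<partial>M) \<le> C"
proof -
  have [measurable]: "D \<in> borel_measurable M"
    unfolding D_def using borel_measurable_infsum_vec m by measurable
  let ?D = "\<lambda>n x. norm1v (\<Sum>j | \<bar>j\<bar> < int n. v j x - v' j x)"
  have "C \<ge> 0" using C[of 0] by simp
  have le: "(\<integral>\<^sup>+x. ennreal (D x) \<partial>M) \<le> ennreal C"
  proof -
    have "(\<integral>\<^sup>+x. ennreal (D x) \<partial>M) = (\<integral>\<^sup>+x. liminf (\<lambda>n. ennreal (?D n x)) \<partial>M)"
    proof (rule nn_integral_cong_AE)
      show "AE x in M. ennreal (D x) = liminf (\<lambda>n. ennreal (?D n x))"
        using s
      proof eventually_elim
        case (elim x)
        have "(\<lambda>n. (\<Sum>j | \<bar>j\<bar> < int n. v j x) - (\<Sum>j | \<bar>j\<bar> < int n. v' j x)) \<longlonglongrightarrow> (\<Sum>\<^sub>\<infinity>j\<in>UNIV. v j x) - (\<Sum>\<^sub>\<infinity>j\<in>UNIV. v' j x)"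
          by (intro tendsto_diff infsum_window_lim elim)
        then have "(\<lambda>n. ?D n x) \<longlonglongrightarrow> D x"
          unfolding D_def sum_subtractf
          by (rule tendsto_norm1v)
        then have "(\<lambda>n. ennreal (?D n x)) \<longlonglongrightarrow> ennreal (D x)" by (rule tendsto_ennrealI)
        then show ?case by (intro lim_imp_Liminf[symmetric]) auto
      qed
    qed
    also have "\<dots> \<le> liminf (\<lambda>n. \<integral>\<^sup>+x. ennreal (?D n x) \<partial>M)" by (rule nn_integral_liminf) simp
    also have "\<dots> \<le> liminf (\<lambda>n :: nat. ennreal C)"
    proof (intro Liminf_mono always_eventually allI)
      fix n
      have "(\<integral>\<^sup>+x. ennreal (?D n x) \<partial>M) \<le> (\<integral>\<^sup>+x. ennreal (\<Sum>j | \<bar>j\<bar> < int n. norm1v (v j x - v' j x)) \<partial>M)"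
        by (intro nn_integral_mono ennreal_leI norm1v_sum)
      also have "\<dots> = ennreal (\<integral>x. (\<Sum>j | \<bar>j\<bar> < int n. norm1v (v j x - v' j x)) \<partial>M)"
        by (rule nn_integral_eq_integral) (auto intro!: i sum_nonneg)
      also have "\<dots> \<le> ennreal C" using C[of n] i by (simp add: ennreal_leI)
      finally show "(\<integral>\<^sup>+x. ennreal (?D n x) \<partial>M) \<le> ennreal C" .
    qed
    finally show ?thesis by (simp add: Liminf_const)
  qed
  show "integrable M D"
  proof (rule integrableI_bounded)
    have "norm (D x) = D x" for x by (simp add: D_def)
    then show "(\<integral>\<^sup>+x. ennreal (norm (D x)) \<partial>M) < \<infinity>"
      using le by (simp add: le_less_trans)
  qed simp
  then have "ennreal (\<integral>x. D x \<partial>M) \<le> ennreal C"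
    using le by (subst (asm) nn_integral_eq_integral) (auto simp: D_def)
  then show "(\<integral>x. D x \<partial>M) \<le> C" using \<open>C \<ge> 0\<close> by simp
qed

section \<open>Linear processes\<close>

lemma measurable_matrix_mult [measurable (raw)]:
  fixes X :: "'w \<Rightarrow> real^'d"
  shows "X \<in> borel_measurable M \<Longrightarrow> (\<lambda>x. A *v X x) \<in> borel_measurable M"
  using borel_measurable_continuous_on[OF matrix_vector_mult_linear_continuous_on, of X M A] .

lemma infsum_finite_support:
  fixes v :: "int \<Rightarrow> 'b::{comm_monoid_add, t2_space}"
  shows "(\<Sum>\<^sub>\<infinity>j\<in>UNIV. if \<bar>j\<bar> < int m then v j else 0) = (\<Sum>j | \<bar>j\<bar> < int m. v j)"
proof (rule infsumI, rule has_sum_finite_neutralI)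
  show "finite {j :: int. \<bar>j\<bar> < int m}" by simp
  show "(\<Sum>j | \<bar>j\<bar> < int m. v j) = (\<Sum>j | \<bar>j\<bar> < int m. if \<bar>j\<bar> < int m then v j else 0)"
    by (rule sum.cong) auto
qed auto

locale linear_noise = indep_noise M eps for M :: "'w measure" and eps :: "int \<Rightarrow> 'w \<Rightarrow> real^'d" +
  assumes eps_distr: "\<And>t. distr M borel (eps t) = distr M borel (eps 0)"
    and eps_L1: "integrable M (\<lambda>x. norm1v (eps 0 x))"
begin

definition lin :: "(int \<Rightarrow> real^'d^'d) \<Rightarrow> int \<Rightarrow> 'w \<Rightarrow> real^'d" where
  "lin a t x = (\<Sum>\<^sub>\<infinity>j\<in>UNIV. a j *v eps (t - j) x)"

text \<open>Cutting off the coefficients instead of the sum keeps a truncated process of the form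
  \<open>lin\<close>. One L1 comparison then covers a process and its truncation, two truncations,
  and a process and its companion.\<close>

definition trunc :: "nat \<Rightarrow> (int \<Rightarrow> real^'d^'d) \<Rightarrow> int \<Rightarrow> real^'d^'d" where
  "trunc m a j = (if \<bar>j\<bar> < int m then a j else 0)"

definition eps_mean :: real where
  "eps_mean = (\<integral>x. norm1v (eps 0 x) \<partial>M)"

lemma eps_mean_nonneg: "eps_mean \<ge> 0"
  unfolding eps_mean_def by (rule Bochner_Integration.integral_nonneg) simp

lemma eps_L1_shift: "integrable M (\<lambda>x. norm1v (eps t x))" "(\<integral>x. norm1v (eps t x) \<partial>M) = eps_mean"
proof -
  have n: "norm1v \<in> borel_measurable (borel :: (real^'d) measure)" by measurable
  have "integrable (distr M borel (eps 0)) norm1v"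
    using eps_L1 integrable_distr_eq[OF eps_rv n] by simp
  then show "integrable M (\<lambda>x. norm1v (eps t x))"
    unfolding eps_distr[of t, symmetric] using integrable_distr_eq[OF eps_rv n] by simp
  have "(\<integral>x. norm1v x \<partial>distr M borel (eps t)) = (\<integral>x. norm1v x \<partial>distr M borel (eps 0))"
    by (simp only: eps_distr[of t])
  then show "(\<integral>x. norm1v (eps t x) \<partial>M) = eps_mean"
    by (simp add: integral_distr[OF eps_rv n] eps_mean_def)
qed

lemma norm1v_mult_L1:
  "integrable M (\<lambda>x. norm1v (A *v eps t x))" "(\<integral>x. norm1v (A *v eps t x) \<partial>M) \<le> mnorm1 A * eps_mean"
proof -
  have [measurable]: "eps t \<in> borel_measurable M" by (rule eps_rv)
  have i: "integrable M (\<lambda>x. mnorm1 A * norm1v (eps t x))" using eps_L1_shift by simp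
  show i': "integrable M (\<lambda>x. norm1v (A *v eps t x))"
    by (rule Bochner_Integration.integrable_bound[OF i]) (auto simp: norm1v_mult_le)
  have "(\<integral>x. norm1v (A *v eps t x) \<partial>M) \<le> (\<integral>x. mnorm1 A * norm1v (eps t x) \<partial>M)"
    by (intro integral_mono i i' norm1v_mult_le)
  then show "(\<integral>x. norm1v (A *v eps t x) \<partial>M) \<le> mnorm1 A * eps_mean" by (simp add: eps_L1_shift)
qed

lemma sum_norm1v_mult_le:
  assumes q: "0 < q" "q < 1" and a: "\<And>j. mnorm1 (a j) \<le> B * q ^ nat \<bar>j\<bar>"
  shows "(\<Sum>j | \<bar>j\<bar> < int n. \<integral>x. norm1v (a j *v eps (t - j) x) \<partial>M) \<le> B * (2 / (1 - q) * eps_mean)"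
proof -
  have B: "B \<ge> 0" using order_trans[OF mnorm1_nonneg a[of 0]] by simp
  have "(\<Sum>j | \<bar>j\<bar> < int n. \<integral>x. norm1v (a j *v eps (t - j) x) \<partial>M) \<le> (\<Sum>j | \<bar>j\<bar> < int n. (B * q ^ nat \<bar>j\<bar>) * eps_mean)"
    by (intro sum_mono order_trans[OF norm1v_mult_L1(2)] mult_right_mono a eps_mean_nonneg)
  also have "\<dots> = B * ((\<Sum>j | \<bar>j\<bar> < int n. q ^ nat \<bar>j\<bar>) * eps_mean)"
    by (simp add: sum_distrib_left sum_distrib_right mult.assoc)
  also have "\<dots> \<le> B * (2 / (1 - q) * eps_mean)"
    by (intro mult_left_mono mult_right_mono geometric_window q eps_mean_nonneg B)
  finally show ?thesis .
qed

lemma lin_measurable [measurable]: "lin a t \<in> borel_measurable M"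
  unfolding lin_def[abs_def] using eps_rv by (intro borel_measurable_infsum_vec) measurable

lemma lin_diff_L1:
  assumes q: "0 < q" "q < 1" and a: "\<And>j. mnorm1 (a j) \<le> B * q ^ nat \<bar>j\<bar>" "\<And>j. mnorm1 (a' j) \<le> B' * q ^ nat \<bar>j\<bar>"
    and D: "\<And>j. mnorm1 (a j - a' j) \<le> D * q ^ nat \<bar>j\<bar>"
  shows "integrable M (\<lambda>x. norm1v (lin a t x - lin a' t x))"
    "(\<integral>x. norm1v (lin a t x - lin a' t x) \<partial>M) \<le> D * (2 / (1 - q) * eps_mean)"
proof -
  have m: "(\<lambda>x. A *v eps s x) \<in> borel_measurable M" for A s using eps_rv by measurable
  \<comment> \<open>Both series have to converge almost surely: where one diverges, its
    \<open>infsum\<close> is the default \<open>0\<close>, and the difference of the sums need not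
    be the sum of the differences.\<close>
  have s: "AE x in M. (\<lambda>j. c j *v eps (t - j) x) summable_on UNIV"
    if "\<And>j. mnorm1 (c j) \<le> C * q ^ nat \<bar>j\<bar>" for c C
    by (rule AE_summable_vec[OF m norm1v_mult_L1(1) sum_norm1v_mult_le[OF q that]])
  have i: "integrable M (\<lambda>x. norm1v (a j *v eps (t - j) x - a' j *v eps (t - j) x))" for j
    unfolding matrix_vector_mult_diff_rdistrib[symmetric] by (rule norm1v_mult_L1(1))
  have le: "(\<Sum>j | \<bar>j\<bar> < int n. \<integral>x. norm1v (a j *v eps (t - j) x - a' j *v eps (t - j) x) \<partial>M) \<le> D * (2 / (1 - q) * eps_mean)" for n
    unfolding matrix_vector_mult_diff_rdistrib[symmetric] by (rule sum_norm1v_mult_le[OF q D])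
  show "integrable M (\<lambda>x. norm1v (lin a t x - lin a' t x))"
    "(\<integral>x. norm1v (lin a t x - lin a' t x) \<partial>M) \<le> D * (2 / (1 - q) * eps_mean)"
    unfolding lin_def by (rule infsum_vec_diff_L1[OF m m s[OF a(1)] s[OF a(2)] i le])+
qed

lemma lin_trunc: "lin (trunc m a) t x = (\<Sum>j | \<bar>j\<bar> < int m. a j *v eps (t - j) x)"
  unfolding lin_def trunc_def infsum_finite_support[symmetric] by (rule infsum_cong) simp

lemma lin_trunc_block: "lin (trunc m a) t \<in> borel_measurable (block {t - int m<..<t + int m})"
  unfolding lin_trunc[abs_def]
  by (intro borel_measurable_sum measurable_matrix_mult eps_block) auto

text \<open>By independence and identical distribution both sides are the product of copies of the
  law of \<open>eps 0\<close>.\<close>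

lemma distr_shift:
  "distr M (\<Pi>\<^sub>M i\<in>UNIV. borel) (\<lambda>x k. eps (k + t) x) = distr M (\<Pi>\<^sub>M i\<in>UNIV. borel) (\<lambda>x k. eps k x)"
proof -
  have "indep_vars (\<lambda>_. borel) (\<lambda>k. eps (k + s)) UNIV" for s
  proof -
    have i: "indep_sets preim UNIV" using eps_indep_vars unfolding indep_vars_def2 preim_def by simp
    have "indep_sets (\<lambda>k. preim (k + s)) UNIV"
    proof (rule indep_setsI)
      show "preim (k + s) \<subseteq> events" for k using i by (auto simp: indep_sets_def)
      fix A J assume J: "J \<noteq> {}" "finite J" "\<forall>j\<in>J. A j \<in> preim (j + s)"
      have "prob (\<Inter>k\<in>(\<lambda>k. k + s) ` J. A (k - s)) = (\<Prod>k\<in>(\<lambda>k. k + s) ` J. prob (A (k - s)))"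
        by (rule indep_setsD[OF i]) (use J in auto)
      then show "prob (\<Inter>j\<in>J. A j) = (\<Prod>j\<in>J. prob (A j))"
        by (simp add: prod.reindex inj_on_def image_image)
    qed
    then show ?thesis using eps_rv unfolding indep_vars_def2 preim_def by simp
  qed
  then have "distr M (\<Pi>\<^sub>M i\<in>UNIV. borel) (\<lambda>x k. eps (k + s) x) = (\<Pi>\<^sub>M i\<in>UNIV. distr M borel (eps 0))" for s
    using indep_vars_iff_distr_eq_PiM'[of UNIV "\<lambda>k. eps (k + s)" "\<lambda>_. borel"] eps_rv
    by (simp add: eps_distr[of "_ + s"] restrict_UNIV)
  from this[of t] this[of 0] show ?thesis by simp
qed

text \<open>Both pairs are the same measurable function of the innovation path, once shifted and
  once not. Pairs are needed because the result feeds covariances at lag \<open>h\<close>.\<close>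

lemma lin_stationary:
  "distr M (borel \<Otimes>\<^sub>M borel) (\<lambda>x. (lin a t x, lin b (t + h) x)) =
   distr M (borel \<Otimes>\<^sub>M borel) (\<lambda>x. (lin a 0 x, lin b h x))"
proof -
  define F where "F x = ((\<Sum>\<^sub>\<infinity>j\<in>UNIV. a j *v x (- j)), (\<Sum>\<^sub>\<infinity>j\<in>UNIV. b j *v x (h - j)))" for x :: "int \<Rightarrow> real^'d"
  let ?P = "(\<Pi>\<^sub>M i\<in>UNIV. borel) :: (int \<Rightarrow> real^'d) measure"
  have F: "F \<in> measurable ?P (borel \<Otimes>\<^sub>M borel)"
    unfolding F_def by (intro measurable_Pair borel_measurable_infsum_vec measurable_matrix_mult) measurable
  have shift_m: "(\<lambda>x k. eps (k + s) x) \<in> measurable M ?P" for s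
    by (rule measurable_PiM_single') (use eps_rv in auto)
  have F_eq: "F (\<lambda>k. eps (k + s) x) = (lin a s x, lin b (s + h) x)" for s x
    by (simp add: F_def lin_def algebra_simps)
  have "distr M (borel \<Otimes>\<^sub>M borel) (\<lambda>x. (lin a s x, lin b (s + h) x)) = distr (distr M ?P (\<lambda>x k. eps (k + s) x)) (borel \<Otimes>\<^sub>M borel) F" for s
    by (subst distr_distr[OF F shift_m]) (simp add: comp_def F_eq)
  note eq = this
  show ?thesis using eq[of t] eq[of 0] unfolding distr_shift[of t] distr_shift[of 0] by simp
qed

end

section \<open>Dominated convergence, clipping and covariances\<close>

text \<open>The halved exponent arises from windows whose radius is half the lag. With
  \<open>q = sqrt s\<close>, rounding down in \<open>div\<close> costs at most one factor
  \<open>q\<close>.\<close>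

lemma summable_half_geometric_int:
  assumes "0 < s" "s < (1::real)"
  shows "(\<lambda>h :: int. s ^ (nat \<bar>h\<bar> div 2)) summable_on UNIV"
proof (rule nonneg_window_summable)
  define q where "q = sqrt s"
  have q: "0 < q" "q < 1" "s = q\<^sup>2" using assms by (auto simp: q_def)
  fix n
  have "(\<Sum>h | \<bar>h\<bar> < int n. s ^ (nat \<bar>h\<bar> div 2)) \<le> (\<Sum>h | \<bar>h\<bar> < int n. q ^ nat \<bar>h\<bar> * (1 / q))"
  proof (rule sum_mono)
    fix h :: int
    have "s ^ (nat \<bar>h\<bar> div 2) * q = q ^ (2 * (nat \<bar>h\<bar> div 2) + 1)"
      by (simp add: q power_mult)
    also have "\<dots> \<le> q ^ nat \<bar>h\<bar>" using q by (intro power_decreasing) auto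
    finally show "s ^ (nat \<bar>h\<bar> div 2) \<le> q ^ nat \<bar>h\<bar> * (1 / q)" using q(1) by (simp add: field_simps)
  qed
  also have "\<dots> \<le> 2 / (1 - q) * (1 / q)"
    unfolding sum_distrib_right[symmetric] using q by (intro mult_right_mono geometric_window) auto
  finally show "(\<Sum>h | \<bar>h\<bar> < int n. s ^ (nat \<bar>h\<bar> div 2)) \<le> 2 / (1 - q) * (1 / q)" .
qed (use assms in simp)

text \<open>Dominated convergence for the counting measure; the work lies in passing between
  \<open>infsum\<close> and the integral.\<close>

lemma tannery_int:
  fixes a :: "nat \<Rightarrow> int \<Rightarrow> real"
  assumes bound: "\<And>T h. \<bar>a T h\<bar> \<le> b h" and b: "b summable_on UNIV"
    and lim: "\<And>h. (\<lambda>T. a T h) \<longlonglongrightarrow> l h"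
  shows "l summable_on UNIV" "(\<lambda>T. infsum (a T) UNIV) \<longlonglongrightarrow> infsum l UNIV"
proof -
  have l_bound: "\<bar>l h\<bar> \<le> b h" for h
    by (rule LIMSEQ_le_const2[OF tendsto_rabs[OF lim]]) (use bound in auto)
  have s: "c summable_on UNIV" if "\<And>h. \<bar>c h\<bar> \<le> b h" for c
  proof (rule abs_summable_summable, rule Infinite_Sum.abs_summable_on_comparison_test)
    show "(\<lambda>h. norm (b h)) summable_on UNIV"
      using b by (simp only: summable_on_iff_abs_summable_on_real[symmetric])
    show "norm (c h) \<le> norm (b h)" for h using that[of h] by simp
  qed
  show "l summable_on UNIV" by (rule s[OF l_bound])
  have conv: "integrable (count_space UNIV) c" "infsum c UNIV = (\<integral>h. c h \<partial>count_space UNIV)"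
    if "c summable_on UNIV" for c :: "int \<Rightarrow> real"
  proof -
    have c: "Infinite_Set_Sum.abs_summable_on c UNIV"
      using that summable_on_iff_abs_summable_on_real abs_summable_equivalent by blast
    then show "integrable (count_space UNIV) c" by (simp add: Infinite_Set_Sum.abs_summable_on_def)
    show "infsum c UNIV = (\<integral>h. c h \<partial>count_space UNIV)"
      using infsetsum_infsum[OF c] by (simp add: infsetsum_def)
  qed
  have "(\<lambda>T. \<integral>h. a T h \<partial>count_space UNIV) \<longlonglongrightarrow> (\<integral>h. l h \<partial>count_space UNIV)"
    by (rule integral_dominated_convergence[where w=b])
      (use conv(1)[OF b] lim bound in \<open>auto\<close>)
  then show "(\<lambda>T. infsum (a T) UNIV) \<longlonglongrightarrow> infsum l UNIV"
    using conv(2)[OF s[OF bound]] conv(2)[OF s[OF l_bound]] by simp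
qed

definition clip :: "real \<Rightarrow> real \<Rightarrow> real" where
  "clip c x = max (- c) (min c x)"

lemma clip_lipschitz: "\<bar>clip c x - clip c y\<bar> \<le> \<bar>x - y\<bar>"
  unfolding clip_def by (auto simp: max_def min_def)

lemma clip_le_abs: "c \<ge> 0 \<Longrightarrow> \<bar>clip c x\<bar> \<le> \<bar>x\<bar>"
  unfolding clip_def by (auto simp: max_def min_def)

lemma clip_bound: "c \<ge> 0 \<Longrightarrow> \<bar>clip c x\<bar> \<le> c"
  unfolding clip_def by (auto simp: max_def min_def)

lemma clip_measurable [measurable]: "X \<in> borel_measurable M \<Longrightarrow> (\<lambda>x. clip c (X x)) \<in> borel_measurable M"
  unfolding clip_def by (intro borel_measurable_max borel_measurable_min borel_measurable_const)

text \<open>Nothing is lost up to the level \<open>c\<close>; beyond it,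
  \<open>\<bar>x\<bar> powr (1 - p)\<close> is at most \<open>c powr (1 - p)\<close> because the
  exponent is not positive.\<close>

lemma clip_error:
  assumes "c > 0" "p \<ge> 1"
  shows "\<bar>x - clip c x\<bar> \<le> \<bar>x\<bar> powr p * c powr (1 - p)"
proof (cases "\<bar>x\<bar> \<le> c")
  case True
  then have "clip c x = x" by (auto simp: clip_def)
  then show ?thesis by simp
next
  case False
  then have x: "\<bar>x\<bar> > c" by simp
  have "\<bar>x - clip c x\<bar> \<le> \<bar>x\<bar>" using assms by (auto simp: clip_def max_def min_def)
  also have "\<bar>x\<bar> = \<bar>x\<bar> powr p * \<bar>x\<bar> powr (1 - p)" using x assms by (simp flip: powr_add)
  also have "\<dots> \<le> \<bar>x\<bar> powr p * c powr (1 - p)"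
    using x assms by (intro mult_left_mono powr_mono2') auto
  finally show ?thesis .
qed

lemma abs_powr_le:
  fixes x :: real
  assumes "0 \<le> r" "r \<le> p"
  shows "\<bar>x\<bar> powr r \<le> 1 + \<bar>x\<bar> powr p"
proof (cases "\<bar>x\<bar> \<le> 1")
  case True
  then have "\<bar>x\<bar> powr r \<le> 1" using assms by (cases "x = 0") (auto simp: powr_le1)
  then show ?thesis using powr_ge_zero[of "\<bar>x\<bar>" p] by linarith
next
  case False
  then have "\<bar>x\<bar> powr r \<le> \<bar>x\<bar> powr p" using assms by (intro powr_mono) auto
  then show ?thesis by simp
qed

text \<open>The pointwise form of an interpolation: for \<open>\<bar>y\<bar> \<le> R\<close> the
  product is linear in \<open>\<bar>x\<bar>\<close>, and otherwise the larger of the two exceeds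
  \<open>R\<close>, so its square is at most its power \<open>2 + \<delta>\<close> times
  \<open>R powr (- \<delta>)\<close>.\<close>

lemma abs_mult_truncation:
  fixes x y :: real
  assumes "R > 0" "\<delta> > 0"
  shows "\<bar>x\<bar> * \<bar>y\<bar> \<le> R * \<bar>x\<bar> + (\<bar>x\<bar> powr (2 + \<delta>) + \<bar>y\<bar> powr (2 + \<delta>)) * R powr (- \<delta>)"
proof (cases "\<bar>y\<bar> \<le> R")
  case True
  have "\<bar>x\<bar> * \<bar>y\<bar> \<le> R * \<bar>x\<bar>" using mult_left_mono[OF True, of "\<bar>x\<bar>"] by (simp add: mult.commute)
  then show ?thesis by (simp add: add_increasing2)
next
  case False
  define z where "z = max \<bar>x\<bar> \<bar>y\<bar>"
  have z: "z \<ge> R" "z > 0" using False assms by (auto simp: z_def)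
  have "\<bar>x\<bar> * \<bar>y\<bar> \<le> z * z" by (intro mult_mono) (auto simp: z_def)
  also have "\<dots> = z powr (2 + \<delta>) * z powr (- \<delta>)" using z by (simp add: power2_eq_square flip: powr_add)
  also have "\<dots> \<le> (\<bar>x\<bar> powr (2 + \<delta>) + \<bar>y\<bar> powr (2 + \<delta>)) * R powr (- \<delta>)"
  proof (intro mult_mono)
    show "z powr (2 + \<delta>) \<le> \<bar>x\<bar> powr (2 + \<delta>) + \<bar>y\<bar> powr (2 + \<delta>)" by (auto simp: z_def max_def)
    show "z powr (- \<delta>) \<le> R powr (- \<delta>)" using z assms by (intro powr_mono2') auto
  qed auto
  finally have le: "\<bar>x\<bar> * \<bar>y\<bar> \<le> \<dots>" .
  have "0 \<le> R * \<bar>x\<bar>" using assms by simp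
  with le show ?thesis by linarith
qed

lemma abs_diff_powr_le:
  fixes x y :: real
  assumes "p \<ge> 0"
  shows "\<bar>x - y\<bar> powr p \<le> 2 powr p * (\<bar>x\<bar> powr p + \<bar>y\<bar> powr p)"
proof -
  define z where "z = max \<bar>x\<bar> \<bar>y\<bar>"
  have "\<bar>x - y\<bar> powr p \<le> (2 * z) powr p" using assms by (intro powr_mono2) (auto simp: z_def)
  also have "\<dots> = 2 powr p * z powr p" by (rule powr_mult)
  also have "z powr p \<le> \<bar>x\<bar> powr p + \<bar>y\<bar> powr p" by (auto simp: z_def max_def)
  finally show ?thesis by simp
qed

section \<open>Moment bounds and continuity of the covariance\<close>

context prob_space
begin

text \<open>Measurability and integrability are part of the notion because a bound on the integral
  alone would hold by default for functions that are not integrable. \<open>K\<close> bounds the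
  moment itself and not its root.\<close>

definition Lp_le :: "real \<Rightarrow> real \<Rightarrow> ('a \<Rightarrow> real) \<Rightarrow> bool" where
  "Lp_le p K X \<longleftrightarrow> X \<in> borel_measurable M \<and> integrable M (\<lambda>x. \<bar>X x\<bar> powr p) \<and> (\<integral>x. \<bar>X x\<bar> powr p \<partial>M) \<le> K"

lemma Lp_leI_nn:
  assumes [measurable]: "X \<in> borel_measurable M" and "(\<integral>\<^sup>+x. ennreal (\<bar>X x\<bar> powr p) \<partial>M) \<le> ennreal K" "K \<ge> 0"
  shows "Lp_le p K X"
proof -
  have i: "integrable M (\<lambda>x. \<bar>X x\<bar> powr p)"
    by (rule integrableI_bounded) (use assms(2) in \<open>auto intro: le_less_trans\<close>)
  have "ennreal (\<integral>x. \<bar>X x\<bar> powr p \<partial>M) \<le> ennreal K"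
    using assms(2) by (subst (asm) nn_integral_eq_integral[OF i]) auto
  then show ?thesis using i assms by (simp add: Lp_le_def)
qed

lemma Lp_le_mono:
  assumes "Lp_le p K X" "Z \<in> borel_measurable M" "\<And>x. \<bar>Z x\<bar> \<le> \<bar>X x\<bar>" "p \<ge> 0"
  shows "Lp_le p K Z"
proof -
  have le: "\<bar>Z x\<bar> powr p \<le> \<bar>X x\<bar> powr p" for x using assms(3,4) by (intro powr_mono2) auto
  have i: "integrable M (\<lambda>x. \<bar>Z x\<bar> powr p)"
    by (rule Bochner_Integration.integrable_bound[of M "\<lambda>x. \<bar>X x\<bar> powr p"])
      (use assms le in \<open>auto simp: Lp_le_def\<close>)
  have "(\<integral>x. \<bar>Z x\<bar> powr p \<partial>M) \<le> (\<integral>x. \<bar>X x\<bar> powr p \<partial>M)"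
    by (intro integral_mono i le) (use assms in \<open>simp add: Lp_le_def\<close>)
  then show ?thesis using i assms by (simp add: Lp_le_def)
qed

lemma Lp_le_nonneg: "Lp_le p K X \<Longrightarrow> K \<ge> 0"
  unfolding Lp_le_def by (meson Bochner_Integration.integral_nonneg order_trans powr_ge_zero)

lemma Lp_le_powr:
  assumes X: "Lp_le p K X" and "0 \<le> r" "r \<le> p"
  shows "integrable M (\<lambda>x. \<bar>X x\<bar> powr r)" "(\<integral>x. \<bar>X x\<bar> powr r \<partial>M) \<le> 1 + K"
proof -
  have i: "integrable M (\<lambda>x. 1 + \<bar>X x\<bar> powr p)" and [measurable]: "X \<in> borel_measurable M"
    using X by (auto simp: Lp_le_def)
  show i': "integrable M (\<lambda>x. \<bar>X x\<bar> powr r)"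
    by (rule Bochner_Integration.integrable_bound[OF i]) (auto intro: order_trans[OF abs_powr_le[OF assms(2,3)]])
  have "(\<integral>x. \<bar>X x\<bar> powr r \<partial>M) \<le> (\<integral>x. 1 + \<bar>X x\<bar> powr p \<partial>M)"
    by (intro integral_mono i i' abs_powr_le assms)
  also have "\<dots> \<le> 1 + K" using X by (simp add: Lp_le_def prob_space)
  finally show "(\<integral>x. \<bar>X x\<bar> powr r \<partial>M) \<le> 1 + K" .
qed

lemma Lp_le_L1:
  assumes "Lp_le p K X" "p \<ge> 1"
  shows "integrable M X" "(\<integral>x. \<bar>X x\<bar> \<partial>M) \<le> 1 + K"
  using Lp_le_powr[OF assms(1), of 1] assms
  by (auto simp: Lp_le_def integrable_abs_iff powr_one' cong: integral_cong)

lemma Lp_le_L2: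
  assumes "Lp_le p K X" "p \<ge> 2"
  shows "integrable M (\<lambda>x. (X x)\<^sup>2)" "(\<integral>x. (X x)\<^sup>2 \<partial>M) \<le> 1 + K"
proof -
  have "\<bar>x\<bar> powr 2 = x\<^sup>2" for x :: real by (cases "x = 0") (auto simp: powr_numeral)
  then show "integrable M (\<lambda>x. (X x)\<^sup>2)" "(\<integral>x. (X x)\<^sup>2 \<partial>M) \<le> 1 + K"
    using Lp_le_powr[OF assms(1), of 2] assms by simp_all
qed

lemma integrable_mult_L2:
  fixes X Y :: "'a \<Rightarrow> real"
  assumes "X \<in> borel_measurable M" "Y \<in> borel_measurable M"
    "integrable M (\<lambda>x. (X x)\<^sup>2)" "integrable M (\<lambda>x. (Y x)\<^sup>2)"
  shows "integrable M (\<lambda>x. X x * Y x)"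
proof (rule Bochner_Integration.integrable_bound[of M "\<lambda>x. (X x)\<^sup>2 + (Y x)\<^sup>2"])
  show "AE x in M. norm (X x * Y x) \<le> norm ((X x)\<^sup>2 + (Y x)\<^sup>2)"
  proof (rule AE_I2)
    fix x
    have "2 * \<bar>X x\<bar> * \<bar>Y x\<bar> \<le> \<bar>X x\<bar>\<^sup>2 + \<bar>Y x\<bar>\<^sup>2" by (rule sum_squares_bound)
    moreover have "0 \<le> \<bar>X x\<bar> * \<bar>Y x\<bar>" by simp
    ultimately show "norm (X x * Y x) \<le> norm ((X x)\<^sup>2 + (Y x)\<^sup>2)"
      using zero_le_power2[of "X x"] zero_le_power2[of "Y x"] unfolding power2_abs real_norm_def abs_mult by linarith
  qed
qed (use assms in auto)

lemma cov_eq: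
  assumes "integrable M X" "integrable M Y" "integrable M (\<lambda>x. X x * Y x)"
  shows "cov M X Y = (\<integral>x. X x * Y x \<partial>M) - (\<integral>x. X x \<partial>M) * (\<integral>x. Y x \<partial>M)"
proof -
  define a b where "a = (\<integral>x. X x \<partial>M)" and "b = (\<integral>x. Y x \<partial>M)"
  have "cov M X Y = (\<integral>x. X x * Y x - a * Y x - X x * b + a * b \<partial>M)"
    unfolding cov_def a_def[symmetric] b_def[symmetric] by (simp add: algebra_simps)
  also have "\<dots> = (\<integral>x. X x * Y x \<partial>M) - a * b - a * b + a * b"
    using assms by (simp add: prob_space a_def b_def)
  finally show ?thesis by (simp add: a_def b_def)
qed

lemma expectation_mult_le:
  assumes D: "Lp_le (2 + \<delta>) K1 D" and Y: "Lp_le (2 + \<delta>) K2 Y" and "\<delta> > 0" "\<delta> \<le> 1"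
    and r: "(\<integral>x. \<bar>D x\<bar> \<partial>M) \<le> C * r" "0 < r" "r \<le> 1" and C: "C \<ge> 0"
  shows "(\<integral>x. \<bar>D x\<bar> * \<bar>Y x\<bar> \<partial>M) \<le> (C + K1 + K2) * r powr (\<delta> / 2)"
proof -
  \<comment> \<open>This level balances the two terms of the truncation:
    \<open>R * r = r powr (1 / 2)\<close> and
    \<open>R powr (- \<delta>) = r powr (\<delta> / 2)\<close>. For \<open>r \<le> 1\<close> and
    \<open>\<delta> \<le> 1\<close> the second power is the larger one.\<close>
  define R where "R = r powr (- 1 / 2)"
  have R: "R > 0" using r by (simp add: R_def)
  have i: "integrable M D" "integrable M (\<lambda>x. \<bar>D x\<bar> powr (2 + \<delta>))" "integrable M (\<lambda>x. \<bar>Y x\<bar> powr (2 + \<delta>))"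
    using D Y Lp_le_L1(1)[OF D] assms(3) by (auto simp: Lp_le_def)
  have "(\<integral>x. \<bar>D x\<bar> * \<bar>Y x\<bar> \<partial>M) \<le> (\<integral>x. R * \<bar>D x\<bar> + (\<bar>D x\<bar> powr (2 + \<delta>) + \<bar>Y x\<bar> powr (2 + \<delta>)) * R powr (- \<delta>) \<partial>M)"
  proof (intro integral_mono abs_mult_truncation R \<open>\<delta> > 0\<close>)
    have "integrable M (\<lambda>x. D x * Y x)"
      using D Y Lp_le_L2(1)[OF D] Lp_le_L2(1)[OF Y] assms(3) by (intro integrable_mult_L2) (auto simp: Lp_le_def)
    then show "integrable M (\<lambda>x. \<bar>D x\<bar> * \<bar>Y x\<bar>)" by (simp flip: abs_mult)
  qed (use i in auto)
  also have "\<dots> = R * (\<integral>x. \<bar>D x\<bar> \<partial>M) + ((\<integral>x. \<bar>D x\<bar> powr (2 + \<delta>) \<partial>M) + (\<integral>x. \<bar>Y x\<bar> powr (2 + \<delta>) \<partial>M)) * R powr (- \<delta>)"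
    using i by simp
  also have "\<dots> \<le> R * (C * r) + (K1 + K2) * R powr (- \<delta>)"
    using D Y R r by (intro add_mono mult_left_mono mult_right_mono) (auto simp: Lp_le_def)
  also have "R powr (- \<delta>) = r powr (\<delta> / 2)" by (simp add: R_def powr_powr)
  also have "R * (C * r) = C * r powr (1 / 2)"
  proof -
    have "r powr (- 1 / 2) * r powr 1 = r powr (1 / 2)" unfolding powr_add[symmetric] by simp
    then show ?thesis using r by (simp add: R_def)
  qed
  also have "C * r powr (1 / 2) \<le> C * r powr (\<delta> / 2)"
    using r C assms(4) by (intro mult_left_mono powr_mono') auto
  finally show ?thesis by (simp add: algebra_simps)
qed

text \<open>The mixed moment telescopes as \<open>(X - X') * Y + (Y - Y') * X'\<close>, and each
  product is small because its first factor is small in L1 while both have higher moments;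
  \<open>2 powr (2 + \<delta>) * (2 * K)\<close> is the moment of a difference. The last term of the
  constant comes from the products of the means.\<close>

lemma cov_close:
  assumes X: "Lp_le (2 + \<delta>) K X" "Lp_le (2 + \<delta>) K X'" and Y: "Lp_le (2 + \<delta>) K Y" "Lp_le (2 + \<delta>) K Y'"
    and \<delta>: "\<delta> > 0" "\<delta> \<le> 1" and r: "0 < r" "r \<le> 1" and C: "C \<ge> 0"
    and dX: "(\<integral>x. \<bar>X x - X' x\<bar> \<partial>M) \<le> C * r" and dY: "(\<integral>x. \<bar>Y x - Y' x\<bar> \<partial>M) \<le> C * r"
  shows "\<bar>cov M X Y - cov M X' Y'\<bar> \<le> (2 * (C + (2 powr (2 + \<delta>) * (2 * K) + K)) + 2 * C * (1 + K)) * r powr (\<delta> / 2)"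
proof -
  have p: "1 \<le> 2 + \<delta>" "2 \<le> 2 + \<delta>" "0 \<le> 2 + \<delta>" using \<delta> by auto
  have K: "K \<ge> 0" by (rule Lp_le_nonneg[OF X(1)])
  note L1 = X[THEN Lp_le_L1(1)[OF _ p(1)]] Y[THEN Lp_le_L1(1)[OF _ p(1)]]
  have m: "Z \<in> borel_measurable M" if "Lp_le (2 + \<delta>) K Z" for Z using that by (simp add: Lp_le_def)
  have mult: "integrable M (\<lambda>x. U x * Z x)" if "Lp_le (2 + \<delta>) K U" "Lp_le (2 + \<delta>) K Z" for U Z
    using that by (intro integrable_mult_L2 m Lp_le_L2(1)[OF _ p(2)])
  have diff: "Lp_le (2 + \<delta>) (2 powr (2 + \<delta>) * (2 * K)) (\<lambda>x. U x - Z x)"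
    if "Lp_le (2 + \<delta>) K U" "Lp_le (2 + \<delta>) K Z" for U Z
  proof -
    have i: "integrable M (\<lambda>x. 2 powr (2 + \<delta>) * (\<bar>U x\<bar> powr (2 + \<delta>) + \<bar>Z x\<bar> powr (2 + \<delta>)))"
      using that by (auto simp: Lp_le_def)
    have i': "integrable M (\<lambda>x. \<bar>U x - Z x\<bar> powr (2 + \<delta>))"
      by (rule Bochner_Integration.integrable_bound[OF i])
        (use that in \<open>auto simp: Lp_le_def intro: order_trans[OF abs_diff_powr_le[OF p(3)]]\<close>)
    have "(\<integral>x. \<bar>U x - Z x\<bar> powr (2 + \<delta>) \<partial>M) \<le> (\<integral>x. 2 powr (2 + \<delta>) * (\<bar>U x\<bar> powr (2 + \<delta>) + \<bar>Z x\<bar> powr (2 + \<delta>)) \<partial>M)"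
      by (intro integral_mono i i' abs_diff_powr_le p)
    also have "\<dots> = 2 powr (2 + \<delta>) * ((\<integral>x. \<bar>U x\<bar> powr (2 + \<delta>) \<partial>M) + (\<integral>x. \<bar>Z x\<bar> powr (2 + \<delta>) \<partial>M))"
      using that by (simp add: Lp_le_def)
    also have "\<dots> \<le> 2 powr (2 + \<delta>) * (2 * K)" using that by (intro mult_left_mono) (auto simp: Lp_le_def)
    finally show ?thesis using i' m[OF that(1)] m[OF that(2)] by (simp add: Lp_le_def)
  qed
  define s where "s = r powr (\<delta> / 2)"
  \<comment> \<open>The means differ by order \<open>r\<close>; this absorbs that error into the
    slower rate of the mixed moments.\<close>
  have s: "s \<ge> 0" "r \<le> s"
    using powr_mono'[of "\<delta> / 2" 1 r] r \<delta> by (auto simp: s_def)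
  let ?E = "C + 2 powr (2 + \<delta>) * (2 * K) + K"
  have "\<bar>(\<integral>x. X x * Y x \<partial>M) - (\<integral>x. X' x * Y' x \<partial>M)\<bar> \<le> ?E * s + ?E * s"
  proof -
    have "(\<integral>x. X x * Y x \<partial>M) - (\<integral>x. X' x * Y' x \<partial>M) = (\<integral>x. (X x - X' x) * Y x \<partial>M) + (\<integral>x. (Y x - Y' x) * X' x \<partial>M)"
      unfolding left_diff_distrib
      using mult[OF X(1) Y(1)] mult[OF X(2) Y(1)] mult[OF Y(1) X(2)] mult[OF Y(2) X(2)]
      by (simp add: mult.commute[of "X' _"])
    moreover have "\<bar>\<integral>x. (X x - X' x) * Y x \<partial>M\<bar> \<le> (\<integral>x. \<bar>X x - X' x\<bar> * \<bar>Y x\<bar> \<partial>M)"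
      using integral_abs_bound[of M "\<lambda>x. (X x - X' x) * Y x"] by (simp add: abs_mult)
    moreover have "\<bar>\<integral>x. (Y x - Y' x) * X' x \<partial>M\<bar> \<le> (\<integral>x. \<bar>Y x - Y' x\<bar> * \<bar>X' x\<bar> \<partial>M)"
      using integral_abs_bound[of M "\<lambda>x. (Y x - Y' x) * X' x"] by (simp add: abs_mult)
    moreover have "(\<integral>x. \<bar>X x - X' x\<bar> * \<bar>Y x\<bar> \<partial>M) \<le> ?E * s"
      unfolding s_def by (rule expectation_mult_le[OF diff[OF X] Y(1) \<delta> dX r C])
    moreover have "(\<integral>x. \<bar>Y x - Y' x\<bar> * \<bar>X' x\<bar> \<partial>M) \<le> ?E * s"
      unfolding s_def by (rule expectation_mult_le[OF diff[OF Y] X(2) \<delta> dY r C])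
    ultimately show ?thesis by linarith
  qed
  moreover have "\<bar>(\<integral>x. X x \<partial>M) * (\<integral>x. Y x \<partial>M) - (\<integral>x. X' x \<partial>M) * (\<integral>x. Y' x \<partial>M)\<bar> \<le> C * s * (1 + K) + C * s * (1 + K)"
  proof -
    have E: "\<bar>\<integral>x. Z x \<partial>M\<bar> \<le> 1 + K" if "Lp_le (2 + \<delta>) K Z" for Z
      by (rule order_trans[OF integral_abs_bound Lp_le_L1(2)[OF that p(1)]])
    have d: "\<bar>(\<integral>x. U x \<partial>M) - (\<integral>x. Z x \<partial>M)\<bar> \<le> C * s"
      if "integrable M U" "integrable M Z" "(\<integral>x. \<bar>U x - Z x\<bar> \<partial>M) \<le> C * r" for U Z
    proof -
      have "\<bar>(\<integral>x. U x \<partial>M) - (\<integral>x. Z x \<partial>M)\<bar> \<le> (\<integral>x. \<bar>U x - Z x\<bar> \<partial>M)"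
        using integral_abs_bound[of M "\<lambda>x. U x - Z x"] that(1,2) by simp
      also have "\<dots> \<le> C * s" using that(3) s C by (meson mult_left_mono order_trans)
      finally show ?thesis .
    qed
    have "(\<integral>x. X x \<partial>M) * (\<integral>x. Y x \<partial>M) - (\<integral>x. X' x \<partial>M) * (\<integral>x. Y' x \<partial>M)
      = ((\<integral>x. X x \<partial>M) - (\<integral>x. X' x \<partial>M)) * (\<integral>x. Y x \<partial>M) + ((\<integral>x. Y x \<partial>M) - (\<integral>x. Y' x \<partial>M)) * (\<integral>x. X' x \<partial>M)"
      by (simp add: algebra_simps)
    also have "\<bar>\<dots>\<bar> \<le> C * s * (1 + K) + C * s * (1 + K)"
      using d[OF L1(1,2) dX] d[OF L1(3,4) dY] E[OF Y(1)] E[OF X(2)] C s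
      by (intro order_trans[OF abs_triangle_ineq] add_mono) (auto simp: abs_mult intro!: mult_mono)
    finally show ?thesis .
  qed
  ultimately have "\<bar>cov M X Y - cov M X' Y'\<bar> \<le> (?E * s + ?E * s) + (C * s * (1 + K) + C * s * (1 + K))"
    unfolding cov_eq[OF L1(1,3) mult[OF X(1) Y(1)]] cov_eq[OF L1(2,4) mult[OF X(2) Y(2)]] by linarith
  then show ?thesis by (simp add: s_def algebra_simps)
qed

lemma clip_L1_error:
  assumes X: "Lp_le p K X" and "c > 0" "p \<ge> 1"
  shows "(\<integral>x. \<bar>X x - clip c (X x)\<bar> \<partial>M) \<le> K * c powr (1 - p)"
proof -
  have i: "integrable M X" "integrable M (\<lambda>x. \<bar>X x\<bar> powr p)" and [measurable]: "X \<in> borel_measurable M"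
    using X Lp_le_L1(1)[OF X assms(3)] by (auto simp: Lp_le_def)
  have "integrable M (\<lambda>x. clip c (X x))"
    by (rule Bochner_Integration.integrable_bound[OF i(1)]) (use clip_le_abs assms in auto)
  then have "(\<integral>x. \<bar>X x - clip c (X x)\<bar> \<partial>M) \<le> (\<integral>x. \<bar>X x\<bar> powr p * c powr (1 - p) \<partial>M)"
    using i by (intro integral_mono clip_error assms) auto
  also have "\<dots> \<le> K * c powr (1 - p)" using X by (simp add: Lp_le_def mult_right_mono)
  finally show ?thesis .
qed

end

text \<open>\<open>(ln d)\<^sup>2\<close> outgrows every multiple of \<open>ln d\<close>, so
  \<open>q ^ m\<close> beats each power of \<open>d\<close> whatever \<open>q\<close> is, and yet
  any power of \<open>m\<close> is negligible against a positive power of \<open>d\<close>.\<close>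

lemma truncation_rates:
  fixes \<delta> q :: real
  assumes \<delta>: "\<delta> > 0" and q: "0 < q" "q < 1" and d: "filterlim d at_top F"
  defines "c \<equiv> \<lambda>T. real (d T :: nat) powr ((2 + \<delta>) / (4 * (1 + \<delta>)))"
    and "m \<equiv> \<lambda>T. nat \<lceil>(ln (real (d T)))\<^sup>2\<rceil> + 1"
  shows "((\<lambda>T. sqrt (real (d T)) * q ^ m T) \<longlongrightarrow> 0) F"
    and "((\<lambda>T. q ^ m T) \<longlongrightarrow> 0) F"
    and "((\<lambda>T. sqrt (real (d T)) * c T powr (- (1 + \<delta>))) \<longlongrightarrow> 0) F"
    and "((\<lambda>T. c T powr (- (1 + \<delta>))) \<longlongrightarrow> 0) F"
    and "((\<lambda>T. (real (m T))\<^sup>2 * (c T / sqrt (real (d T)))) \<longlongrightarrow> 0) F"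
proof -
  have d': "filterlim (\<lambda>T. real (d T)) at_top F"
    by (rule filterlim_compose[OF filterlim_real_sequentially d])
  have pos: "\<forall>\<^sub>F T in F. real (d T) > 0" using d' unfolding filterlim_at_top_dense by blast
  define g where "g = (2 + \<delta>) / (4 * (1 + \<delta>))"
  have c_eq: "c T = real (d T) powr g" for T by (simp only: c_def g_def)
  \<comment> \<open>The first identity gives
    \<open>sqrt d * c powr (- (1 + \<delta>)) = d powr (- \<delta> / 4)\<close>, the second
    \<open>c / sqrt d = d powr (- k)\<close> with
    \<open>k = \<delta> / (4 * (1 + \<delta>))\<close>.\<close>
  have g1: "g * (1 + \<delta>) = 1 / 2 + \<delta> / 4" using \<delta> by (simp add: g_def field_simps)
  have g2: "g = 1 / 2 - \<delta> / (4 * (1 + \<delta>))" using \<delta> by (simp add: g_def field_simps)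
  have qm: "q ^ m T \<le> exp ((ln (real (d T)))\<^sup>2 * ln q)" for T
  proof -
    have "q ^ m T = exp (real (m T) * ln q)" using q by (simp add: exp_of_nat_mult)
    also have "\<dots> \<le> exp ((ln (real (d T)))\<^sup>2 * ln q)"
    proof (subst exp_le_cancel_iff, rule mult_right_mono_neg)
      show "(ln (real (d T)))\<^sup>2 \<le> real (m T)" unfolding m_def by linarith
      show "ln q \<le> 0" using q by simp
    qed
    finally show ?thesis .
  qed
  have lq: "ln q < 0" using q by simp
  have lim: "((\<lambda>x. sqrt x * exp ((ln x)\<^sup>2 * ln q)) \<longlongrightarrow> 0) at_top" "((\<lambda>x. exp ((ln x)\<^sup>2 * ln q)) \<longlongrightarrow> 0) at_top"
    using lq by real_asymp+
  show "((\<lambda>T. sqrt (real (d T)) * q ^ m T) \<longlongrightarrow> 0) F"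
    by (rule tendsto_sandwich[OF _ _ tendsto_const filterlim_compose[OF lim(1) d']])
      (use q qm in \<open>auto intro!: always_eventually mult_left_mono\<close>)
  show "((\<lambda>T. q ^ m T) \<longlongrightarrow> 0) F"
    by (rule tendsto_sandwich[OF _ _ tendsto_const filterlim_compose[OF lim(2) d']])
      (use q qm in \<open>auto intro!: always_eventually\<close>)
  have l3: "((\<lambda>x. x powr (- \<delta> / 4)) \<longlongrightarrow> 0) at_top" "((\<lambda>x. x powr (- (1 / 2 + \<delta> / 4))) \<longlongrightarrow> 0) at_top"
    using \<delta> by real_asymp+
  show "((\<lambda>T. sqrt (real (d T)) * c T powr (- (1 + \<delta>))) \<longlongrightarrow> 0) F"
  proof (rule Lim_transform_eventually[OF filterlim_compose[OF l3(1) d']])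
    show "\<forall>\<^sub>F T in F. real (d T) powr (- \<delta> / 4) = sqrt (real (d T)) * c T powr (- (1 + \<delta>))"
      using pos
    proof eventually_elim
      case (elim T)
      have "g * (- 1 - \<delta>) = - (g * (1 + \<delta>))" by (simp add: algebra_simps)
      then have "sqrt (real (d T)) * c T powr (- (1 + \<delta>)) = real (d T) powr (1 / 2) * real (d T) powr (- (g * (1 + \<delta>)))"
        using elim by (simp add: c_eq powr_powr powr_half_sqrt)
      also have "\<dots> = real (d T) powr (- \<delta> / 4)" unfolding powr_add[symmetric] g1 by simp
      finally show ?case by simp
    qed
  qed
  show "((\<lambda>T. c T powr (- (1 + \<delta>))) \<longlongrightarrow> 0) F"
  proof (rule Lim_transform_eventually[OF filterlim_compose[OF l3(2) d']])
    show "\<forall>\<^sub>F T in F. real (d T) powr (- (1 / 2 + \<delta> / 4)) = c T powr (- (1 + \<delta>))"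
      by (intro always_eventually allI) (simp add: c_eq powr_powr g1[symmetric] algebra_simps)
  qed
  define k where "k = \<delta> / (4 * (1 + \<delta>))"
  have k: "k > 0" using \<delta> by (simp add: k_def)
  have l5: "((\<lambda>x. ((ln x)\<^sup>2 + 2)\<^sup>2 * x powr (- k)) \<longlongrightarrow> 0) at_top" using k by real_asymp
  show "((\<lambda>T. (real (m T))\<^sup>2 * (c T / sqrt (real (d T)))) \<longlongrightarrow> 0) F"
  proof (rule tendsto_sandwich[OF _ _ tendsto_const filterlim_compose[OF l5 d']])
    show "\<forall>\<^sub>F T in F. 0 \<le> (real (m T))\<^sup>2 * (c T / sqrt (real (d T)))"
      by (intro always_eventually) (simp add: c_def)
    show "\<forall>\<^sub>F T in F. (real (m T))\<^sup>2 * (c T / sqrt (real (d T))) \<le> ((ln (real (d T)))\<^sup>2 + 2)\<^sup>2 * real (d T) powr (- k)"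
      using pos
    proof eventually_elim
      case (elim T)
      have "c T / sqrt (real (d T)) = real (d T) powr g / real (d T) powr (1 / 2)"
        using elim by (simp add: c_eq powr_half_sqrt)
      also have "\<dots> = real (d T) powr (- k)" unfolding powr_diff[symmetric] g2 k_def by simp
      finally have eq: "c T / sqrt (real (d T)) = real (d T) powr (- k)" .
      have "real (m T) \<le> (ln (real (d T)))\<^sup>2 + 2"
      proof -
        have "real (nat \<lceil>(ln (real (d T)))\<^sup>2\<rceil>) = real_of_int \<lceil>(ln (real (d T)))\<^sup>2\<rceil>" by simp
        also have "\<dots> \<le> (ln (real (d T)))\<^sup>2 + 1" by (rule of_int_ceiling_le_add_one)
        finally have "real (nat \<lceil>(ln (real (d T)))\<^sup>2\<rceil>) \<le> (ln (real (d T)))\<^sup>2 + 1" .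
        then show ?thesis unfolding m_def of_nat_add of_nat_1 by linarith
      qed
      then show ?case unfolding eq by (intro mult_right_mono power_mono) auto
    qed
  qed
qed

section \<open>The locally stationary process and its truncations\<close>

lemma borel_measurable_lipschitz1:
  fixes g :: "real^'d \<Rightarrow> real"
  assumes g_lip: "\<And>x y. \<bar>g x - g y\<bar> \<le> L * norm1v (x - y)"
  shows "g \<in> borel_measurable borel"
proof (rule borel_measurable_continuous_onI, unfold continuous_on_def, intro ballI)
  fix x :: "real^'d"
  have "((\<lambda>y. L * norm1v (y - x)) \<longlongrightarrow> L * norm1v (x - x)) (at x)"
    by (intro tendsto_intros)
  then have "((\<lambda>y. L * norm1v (y - x)) \<longlongrightarrow> 0) (at x)" by simp
  then have "((\<lambda>y. g y - g x) \<longlongrightarrow> 0) (at x)"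
    by (rule Lim_null_comparison[rotated]) (simp add: g_lip)
  then show "(g \<longlongrightarrow> g x) (at x within UNIV)" by (rule LIM_zero_cancel)
qed

context linear_noise
begin

lemma lipschitz_lin_L1:
  fixes g :: "real^'d \<Rightarrow> real"
  assumes q: "0 < q" "q < 1" and a: "\<And>j. mnorm1 (a j) \<le> B * q ^ nat \<bar>j\<bar>" "\<And>j. mnorm1 (a' j) \<le> B' * q ^ nat \<bar>j\<bar>"
    and D: "\<And>j. mnorm1 (a j - a' j) \<le> D * q ^ nat \<bar>j\<bar>"
    and g: "\<And>x y. \<bar>g x - g y\<bar> \<le> L * norm1v (x - y)" "L \<ge> 0"
    and m: "g \<in> borel_measurable borel"
  shows "integrable M (\<lambda>x. \<bar>g (b + lin a t x) - g (b' + lin a' t x)\<bar>)"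
    "(\<integral>x. \<bar>g (b + lin a t x) - g (b' + lin a' t x)\<bar> \<partial>M) \<le> L * (norm1v (b - b') + D * (2 / (1 - q) * eps_mean))"
proof -
  note lin = lin_diff_L1[OF q a D, of t]
  note [measurable] = m
  have le: "\<bar>g (b + lin a t x) - g (b' + lin a' t x)\<bar> \<le> L * (norm1v (b - b') + norm1v (lin a t x - lin a' t x))" for x
  proof -
    have "b + lin a t x - (b' + lin a' t x) = (b - b') + (lin a t x - lin a' t x)" by simp
    then show ?thesis
      using order_trans[OF g(1)[of "b + lin a t x" "b' + lin a' t x"]] mult_left_mono[OF norm1v_triangle[of "b - b'" "lin a t x - lin a' t x"] g(2)]
      by (simp only:)
  qed
  have i: "integrable M (\<lambda>x. L * (norm1v (b - b') + norm1v (lin a t x - lin a' t x)))" using lin by simp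
  show i': "integrable M (\<lambda>x. \<bar>g (b + lin a t x) - g (b' + lin a' t x)\<bar>)"
    by (rule Bochner_Integration.integrable_bound[OF i]) (auto intro!: order_trans[OF le])
  have "(\<integral>x. \<bar>g (b + lin a t x) - g (b' + lin a' t x)\<bar> \<partial>M) \<le> (\<integral>x. L * (norm1v (b - b') + norm1v (lin a t x - lin a' t x)) \<partial>M)"
    by (intro integral_mono i i' le)
  also have "\<dots> = L * (norm1v (b - b') + (\<integral>x. norm1v (lin a t x - lin a' t x) \<partial>M))" using lin by (simp add: prob_space)
  also have "\<dots> \<le> L * (norm1v (b - b') + D * (2 / (1 - q) * eps_mean))" using lin g(2) by (intro mult_left_mono add_left_mono)
  finally show "(\<integral>x. \<bar>g (b + lin a t x) - g (b' + lin a' t x)\<bar> \<partial>M) \<le> L * (norm1v (b - b') + D * (2 / (1 - q) * eps_mean))" .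
qed

end

text \<open>The rate \<open>\<theta>\<close> of the paper is written \<open>q\<^sup>2\<close>: of the bound \<open>q ^ (2 * \<bar>j\<bar>)\<close>, one factor \<open>q ^ \<bar>j\<bar>\<close> pays for
  cutting the coefficients off and the other keeps the series summable.\<close>
locale lsp = linear_noise M eps for M :: "'w measure" and eps :: "int \<Rightarrow> 'w \<Rightarrow> real^'d" +
  fixes mu :: "real \<Rightarrow> real^'d" and A :: "nat \<Rightarrow> int \<Rightarrow> int \<Rightarrow> real^'d^'d" and Au :: "real \<Rightarrow> int \<Rightarrow> real^'d^'d"
    and B q Cmu :: real and w :: "nat \<Rightarrow> int \<Rightarrow> real" and Cw :: real
    and g :: "'j::finite \<Rightarrow> real^'d \<Rightarrow> real" and L \<delta> K :: real
  assumes q: "0 < q" "q < 1"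
    and A_bound: "\<And>T t j. 1 \<le> t \<Longrightarrow> t \<le> int T \<Longrightarrow> mnorm1 (A T t j) \<le> B * (q\<^sup>2) ^ nat \<bar>j\<bar>"
    and Au_bound: "\<And>u j. u \<in> {0..1} \<Longrightarrow> mnorm1 (Au u j) \<le> B * (q\<^sup>2) ^ nat \<bar>j\<bar>"
    and Au_lip: "\<And>u v j. u \<in> {0..1} \<Longrightarrow> v \<in> {0..1} \<Longrightarrow> mnorm1 (Au u j - Au v j) \<le> B * (q\<^sup>2) ^ nat \<bar>j\<bar> * \<bar>u - v\<bar>"
    and A_approx: "\<And>T t j. 1 \<le> t \<Longrightarrow> t \<le> int T \<Longrightarrow> real T * mnorm1 (A T t j - Au (real_of_int t / real T) j) \<le> B * (q\<^sup>2) ^ nat \<bar>j\<bar>"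
    and mu_lip: "\<And>u v. u \<in> {0..1} \<Longrightarrow> v \<in> {0..1} \<Longrightarrow> norm1v (mu u - mu v) \<le> Cmu * \<bar>u - v\<bar>"
    and w_nonneg: "\<And>T t. 0 \<le> w T t"
    and w_outside: "\<And>T t. t \<notin> {1..int T} \<Longrightarrow> w T t = 0"
    and w_sup: "\<And>T t. w T t \<le> Cw / sqrt (real (card {t\<in>{1..int T}. w T t \<noteq> 0}))"
    and dT_inf: "filterlim (\<lambda>T. card {t\<in>{1..int T}. w T t \<noteq> 0}) at_top sequentially"
    and g_lip: "\<And>j x y. \<bar>g j x - g j y\<bar> \<le> L * norm1v (x - y)" and L: "L \<ge> 0"
    and \<delta>: "0 < \<delta>" "\<delta> \<le> 1"
    and mom_X: "\<And>j T t. 1 \<le> t \<Longrightarrow> t \<le> int T \<Longrightarrow> Lp_le (2 + \<delta>) K (\<lambda>x. g j (lsp_X mu A eps T t x))"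
    and mom_XM: "\<And>j T t m. 1 \<le> t \<Longrightarrow> t \<le> int T \<Longrightarrow> Lp_le (2 + \<delta>) K (\<lambda>x. g j (lsp_XM mu A eps m T t x))"
    and mom_comp: "\<And>j u. u \<in> {0..1} \<Longrightarrow> Lp_le (2 + \<delta>) K (\<lambda>x. g j (comp_X mu Au eps u 0 x))"
    and lim_ex: "\<And>h j1 j2. convergent (\<lambda>T. \<Sum>t=1..int T. w T t * w T (t + h) *
         cov M (\<lambda>x. g j1 (comp_X mu Au eps (real_of_int t / real T) 0 x))
               (\<lambda>x. g j2 (comp_X mu Au eps (real_of_int t / real T) h x)))"
begin

abbreviation X where "X \<equiv> lsp_X mu A eps"
abbreviation XM where "XM \<equiv> lsp_XM mu A eps"
abbreviation Xc where "Xc \<equiv> comp_X mu Au eps"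

abbreviation covc :: "real \<Rightarrow> 'j \<Rightarrow> 'j \<Rightarrow> int \<Rightarrow> real" where
  "covc u i j h \<equiv> cov M (\<lambda>x. g i (Xc u 0 x)) (\<lambda>x. g j (Xc u h x))"

text \<open>The clipping level \<open>c\<close> needs an exponent strictly between \<open>1 / (2 * (1 + \<delta>))\<close>, so that clipping is
  negligible, and \<open>1 / 2\<close>, so that the weighted summands are small; the midpoint is taken.\<close>
definition d :: "nat \<Rightarrow> nat" where "d T = card {t\<in>{1..int T}. w T t \<noteq> 0}"
definition c :: "nat \<Rightarrow> real" where "c T = real (d T) powr ((2 + \<delta>) / (4 * (1 + \<delta>)))"
text \<open>The \<open>+ 1\<close> keeps the radius positive, as the bound for
  \<open>m\<close>-dependent sums requires, even where the logarithm vanishes.\<close>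

definition m :: "nat \<Rightarrow> nat" where "m T = nat \<lceil>(ln (real (d T)))\<^sup>2\<rceil> + 1"

lemma d_at_top: "filterlim d at_top sequentially"
  using dT_inf by (simp add: d_def[abs_def])

lemmas rates = truncation_rates[OF \<delta>(1) q d_at_top, folded c_def m_def]

definition G :: "nat \<Rightarrow> nat \<Rightarrow> 'j \<Rightarrow> int \<Rightarrow> 'w \<Rightarrow> real" where
  "G T k j t x = clip (c T) (g j (XM k T t x))"

text \<open>Bounds the expectation of the series of \<open>norm1v (eps (t - j))\<close> weighted by
  \<open>q ^ nat \<bar>j\<bar>\<close>; every L1 comparison of linear processes carries this
  factor.\<close>

definition H :: real where "H = 2 / (1 - q) * eps_mean"

lemma H_nonneg: "H \<ge> 0"
  using q eps_mean_nonneg by (simp add: H_def)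

lemma B_nonneg: "B \<ge> 0"
  using order_trans[OF mnorm1_nonneg Au_bound[of 0 0]] by simp

lemma c_nonneg: "c T \<ge> 0"
  by (simp add: c_def)

lemma g_measurable [measurable]: "g j \<in> borel_measurable borel"
  by (rule borel_measurable_lipschitz1[OF g_lip])

lemma lsp_X_lin: "X T t x = mu (real_of_int t / real T) + lin (A T t) t x"
  by (simp add: lsp_X_def lin_def)

lemma lsp_XM_lin: "XM k T t x = mu (real_of_int t / real T) + lin (trunc k (A T t)) t x"
  by (simp add: lsp_XM_def lin_trunc)

lemma comp_X_lin: "Xc u t x = mu u + lin (Au u) t x"
  by (simp add: comp_X_def lin_def)

lemma process_measurable [measurable]:
  "X T t \<in> borel_measurable M" "XM k T t \<in> borel_measurable M" "Xc u t \<in> borel_measurable M"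
  unfolding lsp_X_lin[abs_def] lsp_XM_lin[abs_def] comp_X_lin[abs_def] by measurable

lemma q2_le: "(q\<^sup>2) ^ k \<le> q ^ k"
proof -
  have "q ^ 2 \<le> q" using q by (simp add: power2_eq_square)
  then show ?thesis using q by (intro power_mono) auto
qed

lemma q2_tail: "k \<le> n \<Longrightarrow> (q\<^sup>2) ^ n \<le> q ^ k * q ^ n"
  using q by (simp add: power_mult_distrib power2_eq_square power_decreasing)

lemma trunc_bound: "1 \<le> t \<Longrightarrow> t \<le> int T \<Longrightarrow> mnorm1 (trunc k (A T t) j) \<le> B * q ^ nat \<bar>j\<bar>"
  using order_trans[OF A_bound mult_left_mono[OF q2_le B_nonneg], of t T j] q B_nonneg by (auto simp: trunc_def)

lemma A_geo: "1 \<le> t \<Longrightarrow> t \<le> int T \<Longrightarrow> mnorm1 (A T t j) \<le> B * q ^ nat \<bar>j\<bar>"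
  using order_trans[OF A_bound mult_left_mono[OF q2_le B_nonneg]] .

lemma Au_geo: "u \<in> {0..1} \<Longrightarrow> mnorm1 (Au u j) \<le> B * q ^ nat \<bar>j\<bar>"
  using order_trans[OF Au_bound mult_left_mono[OF q2_le B_nonneg]] .

lemma trunc_diff:
  assumes "1 \<le> t" "t \<le> int T"
  shows "mnorm1 (A T t j - trunc k (A T t) j) \<le> (B * q ^ k) * q ^ nat \<bar>j\<bar>"
proof (cases "\<bar>j\<bar> < int k")
  case True
  then show ?thesis using B_nonneg q by (simp add: trunc_def)
next
  case False
  then have "k \<le> nat \<bar>j\<bar>" by simp
  from mult_left_mono[OF q2_tail[OF this] B_nonneg] show ?thesis
    using A_bound[OF assms, of j] False by (simp add: trunc_def mult.assoc)
qed

lemma trunc_diff2: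
  assumes "1 \<le> t" "t \<le> int T" "k \<le> l"
  shows "mnorm1 (trunc l (A T t) j - trunc k (A T t) j) \<le> (B * q ^ k) * q ^ nat \<bar>j\<bar>"
proof (cases "\<bar>j\<bar> < int l")
  case True
  then show ?thesis using trunc_diff[OF assms(1,2), of j k] by (simp add: trunc_def)
next
  case False
  then show ?thesis using assms(3) B_nonneg q by (simp add: trunc_def)
qed

lemma trunc_X_L1:
  assumes t: "1 \<le> t" "t \<le> int T"
  shows "(\<integral>x. \<bar>g j (X T t x) - g j (XM k T t x)\<bar> \<partial>M) \<le> L * (B * q ^ k * H)"
  using lipschitz_lin_L1(2)[OF q A_geo[OF t] trunc_bound[OF t] trunc_diff[OF t, of _ k] g_lip L g_measurable,
      of j "mu (t / T)" t "mu (t / T)"]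
  unfolding lsp_X_lin lsp_XM_lin H_def by (simp only: diff_self norm1v_0 add_0)

lemma trunc_G_L1:
  assumes t: "1 \<le> t" "t \<le> int T" and k: "k \<le> l"
  shows "(\<integral>x. \<bar>G T l j t x - G T k j t x\<bar> \<partial>M) \<le> L * (B * q ^ k * H)"
proof -
  note * = lipschitz_lin_L1[OF q trunc_bound[OF t] trunc_bound[OF t] trunc_diff2[OF t k] g_lip L g_measurable,
      of j "mu (t / T)" t "mu (t / T)"]
  have "(\<integral>x. \<bar>G T l j t x - G T k j t x\<bar> \<partial>M) \<le> (\<integral>x. \<bar>g j (XM l T t x) - g j (XM k T t x)\<bar> \<partial>M)"
  proof (rule integral_mono)
    show i: "integrable M (\<lambda>x. \<bar>g j (XM l T t x) - g j (XM k T t x)\<bar>)"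
      using *(1) unfolding lsp_XM_lin by simp
    show "integrable M (\<lambda>x. \<bar>G T l j t x - G T k j t x\<bar>)"
      by (rule Bochner_Integration.integrable_bound[OF i]) (auto simp: G_def clip_lipschitz)
  qed (simp add: G_def clip_lipschitz)
  also have "\<dots> \<le> L * (B * q ^ k * H)" using *(2) unfolding lsp_XM_lin H_def by (simp only: diff_self norm1v_0 add_0)
  finally show ?thesis .
qed

lemma G_Lp: "1 \<le> t \<Longrightarrow> t \<le> int T \<Longrightarrow> Lp_le (2 + \<delta>) K (G T k j t)"
  unfolding G_def[abs_def] using \<delta> by (intro Lp_le_mono[OF mom_XM[of t T j k]]) (auto simp: clip_le_abs c_nonneg)

lemma G_measurable [measurable]: "G T k j t \<in> borel_measurable M"
  unfolding G_def[abs_def] by measurable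

lemma G_bound: "\<bar>G T k j t x\<bar> \<le> c T"
  unfolding G_def by (rule clip_bound[OF c_nonneg])

lemma G_block: "G T k j t \<in> borel_measurable (block {t - int k<..<t + int k})"
  unfolding G_def[abs_def] lsp_XM_lin
  by (intro clip_measurable measurable_compose[OF _ g_measurable] borel_measurable_add lin_trunc_block borel_measurable_const)

lemma comp_X_distr:
  "distr M (borel \<Otimes>\<^sub>M borel) (\<lambda>x. (Xc u t x, Xc u (t + h) x)) =
   distr M (borel \<Otimes>\<^sub>M borel) (\<lambda>x. (Xc u 0 x, Xc u h x))"
proof -
  let ?B = "borel \<Otimes>\<^sub>M borel :: ((real^'d) \<times> (real^'d)) measure"
  let ?S = "\<lambda>p :: (real^'d) \<times> (real^'d). (mu u + fst p, mu u + snd p)"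
  have S: "?S \<in> measurable ?B ?B" by measurable
  have p: "(\<lambda>x. (lin (Au u) t x, lin (Au u) s x)) \<in> measurable M ?B" for t s by measurable
  have "distr M ?B (\<lambda>x. (Xc u t x, Xc u s x)) = distr (distr M ?B (\<lambda>x. (lin (Au u) t x, lin (Au u) s x))) ?B ?S" for t s
    by (subst distr_distr[OF S p]) (simp add: comp_def comp_X_lin)
  then show ?thesis by (simp add: lin_stationary)
qed

lemma comp_X_stationary:
  fixes F :: "(real^'d) \<times> (real^'d) \<Rightarrow> real"
  assumes F: "F \<in> borel_measurable (borel \<Otimes>\<^sub>M borel)"
  shows "(\<integral>x. F (Xc u t x, Xc u (t + h) x) \<partial>M) = (\<integral>x. F (Xc u 0 x, Xc u h x) \<partial>M)"
    "integrable M (\<lambda>x. F (Xc u t x, Xc u (t + h) x)) \<longleftrightarrow> integrable M (\<lambda>x. F (Xc u 0 x, Xc u h x))"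
proof -
  have p: "(\<lambda>x. (Xc u t x, Xc u s x)) \<in> measurable M (borel \<Otimes>\<^sub>M borel)" for t s by measurable
  show "(\<integral>x. F (Xc u t x, Xc u (t + h) x) \<partial>M) = (\<integral>x. F (Xc u 0 x, Xc u h x) \<partial>M)"
    using integral_distr[OF p[of t "t + h"] F] integral_distr[OF p[of 0 h] F] by (simp add: comp_X_distr)
  show "integrable M (\<lambda>x. F (Xc u t x, Xc u (t + h) x)) \<longleftrightarrow> integrable M (\<lambda>x. F (Xc u 0 x, Xc u h x))"
    using integrable_distr_eq[OF p[of t "t + h"] F] integrable_distr_eq[OF p[of 0 h] F] by (simp add: comp_X_distr)
qed

lemma comp_Lp: "u \<in> {0..1} \<Longrightarrow> Lp_le (2 + \<delta>) K (\<lambda>x. g j (Xc u t x))"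
  using mom_comp[of u j] comp_X_stationary[of "\<lambda>p. \<bar>g j (fst p)\<bar> powr (2 + \<delta>)" u t 0]
  by (simp add: Lp_le_def)

lemma comp_cov_stationary:
  "cov M (\<lambda>x. g i (Xc u t x)) (\<lambda>x. g j (Xc u (t + h) x)) =
   cov M (\<lambda>x. g i (Xc u 0 x)) (\<lambda>x. g j (Xc u h x))"
proof -
  have 1: "(\<integral>x. g i (Xc u t x) \<partial>M) = (\<integral>x. g i (Xc u 0 x) \<partial>M)"
    using comp_X_stationary(1)[of "\<lambda>p. g i (fst p)" u t h] by simp
  have 2: "(\<integral>x. g j (Xc u (t + h) x) \<partial>M) = (\<integral>x. g j (Xc u h x) \<partial>M)"
    using comp_X_stationary(1)[of "\<lambda>p. g j (snd p)" u t h] by simp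
  show ?thesis
    unfolding cov_def 1 2
    using comp_X_stationary(1)[of "\<lambda>p. (g i (fst p) - (\<integral>x. g i (Xc u 0 x) \<partial>M)) * (g j (snd p) - (\<integral>x. g j (Xc u h x) \<partial>M))" u t h]
    by simp
qed

text \<open>The companion is frozen at \<open>t / T\<close> although the time is \<open>s\<close>,
  because the covariances in \<open>V\<close> use a single argument \<open>u\<close> for both
  factors. The cost is the approximation at \<open>s / T\<close> plus a Lipschitz step from
  \<open>s / T\<close> to \<open>t / T\<close>, together of order \<open>1 / T\<close> for a fixed
  lag \<open>s - t\<close>.\<close>

lemma X_comp_L1:
  assumes t: "1 \<le> t" "t \<le> int T" and s: "1 \<le> s" "s \<le> int T"
  shows "(\<integral>x. \<bar>g j (X T s x) - g j (Xc (real_of_int t / real T) s x)\<bar> \<partial>M)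
    \<le> L * (Cmu * \<bar>s - t\<bar> + B * (1 + \<bar>s - t\<bar>) * H) / real T"
proof -
  have T: "real T > 0" using t by simp
  let ?u = "real_of_int t / real T" and ?v = "real_of_int s / real T"
  have u: "?u \<in> {0..1}" "?v \<in> {0..1}" using t s T by (auto simp: field_simps)
  have uv: "\<bar>?v - ?u\<bar> = \<bar>s - t\<bar> / T" using T by (simp flip: diff_divide_distrib)
  have "mnorm1 (A T s j - Au ?u j) \<le> (B * (1 + \<bar>s - t\<bar>) / real T) * q ^ nat \<bar>j\<bar>" for j
  proof -
    have "mnorm1 (A T s j - Au ?u j) \<le> mnorm1 (A T s j - Au ?v j) + mnorm1 (Au ?v j - Au ?u j)"
      using mnorm1_triangle[of "A T s j - Au ?v j" "Au ?v j - Au ?u j"] by simp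
    also have "\<dots> \<le> B * (q\<^sup>2) ^ nat \<bar>j\<bar> / real T + B * (q\<^sup>2) ^ nat \<bar>j\<bar> * (\<bar>s - t\<bar> / real T)"
      using A_approx[OF s, of j] Au_lip[OF u(2,1), of j] T unfolding uv by (intro add_mono) (auto simp: field_simps)
    also have "\<dots> = (B * (1 + \<bar>s - t\<bar>) / real T) * (q\<^sup>2) ^ nat \<bar>j\<bar>" using T by (simp add: field_simps)
    also have "\<dots> \<le> (B * (1 + \<bar>s - t\<bar>) / real T) * q ^ nat \<bar>j\<bar>"
      using B_nonneg T by (intro mult_left_mono q2_le) auto
    finally show ?thesis .
  qed
  from lipschitz_lin_L1(2)[OF q A_geo[OF s] Au_geo[OF u(1)] this g_lip L g_measurable]
  have "(\<integral>x. \<bar>g j (X T s x) - g j (Xc ?u s x)\<bar> \<partial>M)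
    \<le> L * (norm1v (mu ?v - mu ?u) + B * (1 + \<bar>s - t\<bar>) / real T * H)"
    unfolding lsp_X_lin comp_X_lin H_def .
  also have "\<dots> \<le> L * (Cmu * (\<bar>s - t\<bar> / T) + B * (1 + \<bar>s - t\<bar>) / real T * H)"
    using mu_lip[OF u(2,1)] L unfolding uv by (intro mult_left_mono add_right_mono) auto
  also have "\<dots> = L * (Cmu * \<bar>s - t\<bar> + B * (1 + \<bar>s - t\<bar>) * H) / real T"
    using T by (simp add: field_simps)
  finally show ?thesis .
qed

definition rate :: "nat \<Rightarrow> real" where
  "rate T = L * (B * q ^ m T * H) + K * c T powr (- (1 + \<delta>))"

lemma X_G_L1:
  assumes t: "1 \<le> t" "t \<le> int T" and "d T > 0"
  shows "(\<integral>x. \<bar>g j (X T t x) - G T (m T) j t x\<bar> \<partial>M) \<le> rate T"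
proof -
  have cpos: "c T > 0" using assms(3) by (simp add: c_def)
  have p: "1 \<le> 2 + \<delta>" using \<delta> by simp
  have i: "integrable M (\<lambda>x. g j (X T t x))" "integrable M (\<lambda>x. g j (XM (m T) T t x))"
    "integrable M (G T (m T) j t)"
    using Lp_le_L1(1)[OF mom_X[OF t] p] Lp_le_L1(1)[OF mom_XM[OF t] p] Lp_le_L1(1)[OF G_Lp[OF t] p] by auto
  have "(\<integral>x. \<bar>g j (X T t x) - G T (m T) j t x\<bar> \<partial>M) \<le>
    (\<integral>x. \<bar>g j (X T t x) - g j (XM (m T) T t x)\<bar> + \<bar>g j (XM (m T) T t x) - G T (m T) j t x\<bar> \<partial>M)"
    using i by (intro integral_mono) auto
  also have "\<dots> = (\<integral>x. \<bar>g j (X T t x) - g j (XM (m T) T t x)\<bar> \<partial>M) + (\<integral>x. \<bar>g j (XM (m T) T t x) - G T (m T) j t x\<bar> \<partial>M)"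
    using i by simp
  also have "\<dots> \<le> L * (B * q ^ m T * H) + K * c T powr (1 - (2 + \<delta>))"
    unfolding G_def by (intro add_mono trunc_X_L1[OF t] clip_L1_error[OF mom_XM[OF t] cpos p])
  also have "\<dots> = rate T" by (simp add: rate_def)
  finally show ?thesis .
qed

section \<open>Covariances of the truncated array\<close>

text \<open>The constant of \<open>cov_close\<close> for \<open>C = L * (B * H)\<close>. The rate
  \<open>q_dec\<close> below is \<open>q\<close> raised to the Hoelder exponent
  \<open>\<delta> / 2\<close> of the covariance.\<close>

definition C_dec :: real where
  "C_dec = 2 * (L * (B * H) + (2 powr (2 + \<delta>) * (2 * K) + K)) + 2 * (L * (B * H)) * (1 + K)"

definition q_dec :: real where
  "q_dec = q powr (\<delta> / 2)"

lemma q_dec: "0 < q_dec" "q_dec < 1"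
  using q \<delta> powr_less_mono2[of "\<delta> / 2" q 1] by (auto simp: q_dec_def)

definition acov :: "nat \<Rightarrow> 'j \<Rightarrow> 'j \<Rightarrow> int \<Rightarrow> int \<Rightarrow> real" where
  "acov T i j t s = cov M (G T (m T) i t) (G T (m T) j s)"

lemma G_integrable: "integrable M (G T k j t)"
  by (rule integrable_bdd[OF G_measurable, of _ _ _ _ "c T"]) (simp add: G_bound)

text \<open>The bound is uniform in \<open>T\<close> although the clipping level grows: clipping
  increases neither the moments nor L1 distances, so the level enters no constant.\<close>

lemma acov_decay:
  assumes t: "1 \<le> t" "t \<le> int T" and s: "1 \<le> s" "s \<le> int T"
  shows "\<bar>acov T i j t s\<bar> \<le> C_dec * q_dec ^ (nat \<bar>s - t\<bar> div 2)"
proof -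
  define n where "n = nat \<bar>s - t\<bar> div 2"
  \<comment> \<open>Windows of radius \<open>n\<close>, half the lag, are disjoint. The minimum
    covers lags beyond the truncation: if \<open>n > m T\<close>, the windows of radius
    \<open>m T\<close> are already disjoint and nothing has to be shortened.\<close>
  define k where "k = min n (m T)"
  have p: "1 \<le> 2 + \<delta>" "2 \<le> 2 + \<delta>" using \<delta> by auto
  have LBH: "0 \<le> L * (B * H)" using L B_nonneg H_nonneg by simp
  have "cov M (G T k i t) (G T k j s) = 0"
  proof -
    have "(\<integral>x. G T k i t x * G T k j s x \<partial>M) = (\<integral>x. G T k i t x \<partial>M) * (\<integral>x. G T k j s x \<partial>M)"
    proof (rule expectation_block_mult[OF G_block G_block _ G_integrable G_integrable])
      have "2 * int k \<le> \<bar>s - t\<bar>" unfolding k_def n_def by linarith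
      then show "{t - int k<..<t + int k} \<inter> {s - int k<..<s + int k} = {}" by auto
    qed
    moreover have "integrable M (\<lambda>x. G T k i t x * G T k j s x)"
      by (intro integrable_mult_L2 G_measurable Lp_le_L2(1)[OF G_Lp p(2)] t s)
    ultimately show ?thesis using cov_eq[OF G_integrable[of T k i t] G_integrable[of T k j s]] by simp
  qed
  moreover have "\<bar>cov M (G T (m T) i t) (G T (m T) j s) - cov M (G T k i t) (G T k j s)\<bar> \<le> C_dec * (q ^ n) powr (\<delta> / 2)"
    unfolding C_dec_def
  proof (rule cov_close[OF G_Lp G_Lp G_Lp G_Lp \<delta> _ _ LBH])
    show "0 < q ^ n" "q ^ n \<le> 1" using q by (auto simp: power_le_one)
    have "(\<integral>x. \<bar>G T (m T) j t x - G T k j t x\<bar> \<partial>M) \<le> L * (B * H) * q ^ n" if "1 \<le> t" "t \<le> int T" for j t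
    proof (cases "n \<le> m T")
      case True
      then show ?thesis using trunc_G_L1[OF that True, of j] by (simp add: k_def mult_ac)
    next
      case False
      then have "k = m T" by (simp add: k_def)
      then show ?thesis using LBH q by simp
    qed
    from this[OF t] this[OF s]
    show "(\<integral>x. \<bar>G T (m T) i t x - G T k i t x\<bar> \<partial>M) \<le> L * (B * H) * q ^ n"
      "(\<integral>x. \<bar>G T (m T) j s x - G T k j s x\<bar> \<partial>M) \<le> L * (B * H) * q ^ n" by auto
  qed (use t s in auto)
  moreover have "(q ^ n) powr (\<delta> / 2) = q_dec ^ n"
    using q by (simp add: q_dec_def powr_powr mult.commute flip: powr_realpow)
  ultimately show ?thesis by (simp add: acov_def n_def)
qed

lemma K_nonneg: "K \<ge> 0"
  by (rule Lp_le_nonneg[OF mom_comp[of 0]]) simp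

lemma C_dec_nonneg: "C_dec \<ge> 0"
  using L B_nonneg H_nonneg K_nonneg by (simp add: C_dec_def)

section \<open>Weights and sums over a fixed lag\<close>

lemma Cw_d: "0 \<le> Cw / sqrt (real (d T))" "w T t \<le> Cw / sqrt (real (d T))"
  using w_nonneg[of T 0] w_sup[of T] order_trans[OF w_nonneg w_sup] by (auto simp: d_def)

text \<open>At most \<open>d T\<close> terms are non-zero, so the length \<open>T\<close> of the
  index range does not enter.\<close>

lemma sum_w_le: "(\<Sum>t=1..int T. F (w T t)) \<le> real (d T) * b"
  if "F 0 = (0::real)" "\<And>t. F (w T t) \<le> b" for F b
proof -
  have "(\<Sum>t=1..int T. F (w T t)) = (\<Sum>t\<in>{t\<in>{1..int T}. w T t \<noteq> 0}. F (w T t))"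
    by (rule sum.mono_neutral_right) (use that(1) in auto)
  also have "\<dots> \<le> real (d T) * b"
    unfolding d_def using that(2) by (intro sum_bounded_above)
  finally show ?thesis .
qed

lemma sum_weights: "(\<Sum>t=1..int T. w T t) \<le> Cw * sqrt (real (d T))"
proof -
  have "(\<Sum>t=1..int T. w T t) \<le> real (d T) * (Cw / sqrt (real (d T)))"
    by (rule sum_w_le[of "\<lambda>x. x"]) (rule refl Cw_d(2))+
  also have "\<dots> = Cw * sqrt (real (d T))"
    by (simp add: real_div_sqrt mult.commute[of Cw] flip: times_divide_eq_left)
  finally show ?thesis .
qed

lemma sum_weight_products: "(\<Sum>t=1..int T. w T t * w T (t + h)) \<le> Cw\<^sup>2"
proof -
  have "(\<Sum>t=1..int T. w T t * w T (t + h)) \<le> (\<Sum>t=1..int T. w T t * (Cw / sqrt (real (d T))))"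
    by (intro sum_mono mult_left_mono Cw_d w_nonneg)
  also have "\<dots> \<le> real (d T) * (Cw / sqrt (real (d T)) * (Cw / sqrt (real (d T))))"
    by (rule sum_w_le[of "\<lambda>x. x * (Cw / sqrt (real (d T)))"], simp)
      (intro mult_right_mono Cw_d)
  also have "\<dots> \<le> Cw\<^sup>2"
    by (cases "d T = 0") (auto simp: power2_eq_square)
  finally show ?thesis .
qed

definition lagsum :: "nat \<Rightarrow> 'j \<Rightarrow> 'j \<Rightarrow> int \<Rightarrow> real" where
  "lagsum T i j h = (\<Sum>t=1..int T. w T t * w T (t + h) * acov T i j t (t + h))"

lemma lagsum_bound: "\<bar>lagsum T i j h\<bar> \<le> Cw\<^sup>2 * (C_dec * q_dec ^ (nat \<bar>h\<bar> div 2))"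
proof -
  have "\<bar>lagsum T i j h\<bar> \<le> (\<Sum>t=1..int T. w T t * w T (t + h) * (C_dec * q_dec ^ (nat \<bar>h\<bar> div 2)))"
    unfolding lagsum_def
  proof (rule order_trans[OF sum_abs sum_mono])
    fix t assume t: "t \<in> {1..int T}"
    show "\<bar>w T t * w T (t + h) * acov T i j t (t + h)\<bar> \<le> w T t * w T (t + h) * (C_dec * q_dec ^ (nat \<bar>h\<bar> div 2))"
    \<comment> \<open>Decay of \<open>acov\<close> is available only for times in
      \<open>{1..int T}\<close>; outside, the second weight vanishes.\<close>
    proof (cases "t + h \<in> {1..int T}")
      case True
      then show ?thesis
        using acov_decay[of t T "t + h" i j] t w_nonneg by (auto simp: abs_mult intro!: mult_left_mono)
    qed (simp add: w_outside)
  qed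
  also have "\<dots> \<le> Cw\<^sup>2 * (C_dec * q_dec ^ (nat \<bar>h\<bar> div 2))"
    unfolding sum_distrib_right[symmetric]
    using C_dec_nonneg q_dec(1) by (intro mult_right_mono sum_weight_products) auto
  finally show ?thesis .
qed

definition limcov :: "'j \<Rightarrow> 'j \<Rightarrow> int \<Rightarrow> real" where
  "limcov i j h = lim (\<lambda>T. \<Sum>t=1..int T. w T t * w T (t + h) *
     covc (real_of_int t / real T) i j h)"

lemma Cmu_nonneg: "Cmu \<ge> 0"
  using order_trans[OF norm1v_nonneg mu_lip[of 0 1]] by simp

lemma rate_nonneg: "rate T \<ge> 0"
  using L B_nonneg H_nonneg K_nonneg q by (simp add: rate_def)

text \<open>Covariances at a fixed lag need only the first limit. The second, stronger one serves
  the replacement of the whole sum, where the errors are multiplied by a total weight of order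
  \<open>sqrt d\<close>.\<close>

lemma rate_lim: "rate \<longlonglongrightarrow> 0" "(\<lambda>T. sqrt (real (d T)) * rate T) \<longlonglongrightarrow> 0"
proof -
  have "(\<lambda>T. L * (B * q ^ m T * H) + K * c T powr (- (1 + \<delta>))) \<longlonglongrightarrow> L * (B * 0 * H) + K * 0"
    by (intro tendsto_intros rates)
  then show "rate \<longlonglongrightarrow> 0" by (simp add: rate_def[abs_def])
  have "(\<lambda>T. L * (B * (sqrt (real (d T)) * q ^ m T) * H) + K * (sqrt (real (d T)) * c T powr (- (1 + \<delta>)))) \<longlonglongrightarrow> L * (B * 0 * H) + K * 0"
    by (intro tendsto_intros rates)
  then show "(\<lambda>T. sqrt (real (d T)) * rate T) \<longlonglongrightarrow> 0"
    by (simp add: rate_def[abs_def] algebra_simps)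
qed

lemma lagsum_lim: "(\<lambda>T. lagsum T i j h) \<longlonglongrightarrow> limcov i j h"
proof -
  define b where "b T = (\<Sum>t=1..int T. w T t * w T (t + h) *
     covc (real_of_int t / real T) i j h)" for T
  have b: "b \<longlonglongrightarrow> limcov i j h"
    using lim_ex[of h i j] unfolding b_def[abs_def] limcov_def by (simp add: convergent_LIMSEQ_iff)
  \<comment> \<open>The L1 distance from the clipped truncation to the companion, within lag
    \<open>h\<close>; the extra \<open>1 / real T\<close> makes it strictly positive, as
    \<open>cov_close\<close> demands. \<open>C\<close> is the constant of that lemma with its
    parameter \<open>C\<close> equal to \<open>1\<close>.\<close>
  define r where "r T = rate T + L * (Cmu * \<bar>h\<bar> + B * (1 + \<bar>h\<bar>) * H) / real T + 1 / real T" for T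
  define C where "C = 2 * (1 + (2 powr (2 + \<delta>) * (2 * K) + K)) + 2 * 1 * (1 + K)"
  have r_lim: "r \<longlonglongrightarrow> 0"
  proof -
    have "(\<lambda>T. rate T + L * (Cmu * \<bar>h\<bar> + B * (1 + \<bar>h\<bar>) * H) / real T + 1 / real T) \<longlonglongrightarrow> 0 + 0 + 0"
      by (intro tendsto_add rate_lim lim_const_over_n)
    then show ?thesis by (simp add: r_def[abs_def])
  qed
  have C: "C \<ge> 0" using K_nonneg by (simp add: C_def)
  have rpos: "r T > 0" if "T > 0" for T
  proof -
    have "0 \<le> L * (Cmu * \<bar>h\<bar> + B * (1 + \<bar>h\<bar>) * H) / real T" using L Cmu_nonneg B_nonneg H_nonneg by simp
    moreover have "1 / real T > 0" using that by simp
    ultimately show ?thesis using rate_nonneg[of T] unfolding r_def by linarith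
  qed
  have close: "\<bar>lagsum T i j h - b T\<bar> \<le> Cw\<^sup>2 * (C * r T powr (\<delta> / 2))" if "d T > 0" "r T \<le> 1" "T > 0" for T
  proof -
    have cov_le: "\<bar>acov T i j t (t + h) - covc (real_of_int t / real T) i j h\<bar> \<le> C * r T powr (\<delta> / 2)"
      if t: "1 \<le> t" "t \<le> int T" and s: "1 \<le> t + h" "t + h \<le> int T" for t
    proof -
      let ?u = "real_of_int t / real T"
      have u: "?u \<in> {0..1}" using t by (auto simp: field_simps)
      have dist: "(\<integral>x. \<bar>G T (m T) j s x - g j (Xc ?u s x)\<bar> \<partial>M) \<le> 1 * r T"
        if s: "1 \<le> s" "s \<le> int T" "\<bar>s - t\<bar> \<le> \<bar>h\<bar>" for j s
      proof -
        have p: "1 \<le> 2 + \<delta>" using \<delta> by simp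
        note int = Lp_le_L1(1)[OF mom_X[OF s(1,2)] p, of j] G_integrable[of T "m T" j s] Lp_le_L1(1)[OF comp_Lp[OF u, of j s] p]
        have "(\<integral>x. \<bar>G T (m T) j s x - g j (Xc ?u s x)\<bar> \<partial>M)
          \<le> (\<integral>x. \<bar>g j (X T s x) - G T (m T) j s x\<bar> + \<bar>g j (X T s x) - g j (Xc ?u s x)\<bar> \<partial>M)"
          using int by (intro integral_mono) auto
        also have "\<dots> = (\<integral>x. \<bar>g j (X T s x) - G T (m T) j s x\<bar> \<partial>M) + (\<integral>x. \<bar>g j (X T s x) - g j (Xc ?u s x)\<bar> \<partial>M)"
          using int by simp
        also have "\<dots> \<le> rate T + L * (Cmu * \<bar>s - t\<bar> + B * (1 + \<bar>s - t\<bar>) * H) / real T"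
          by (intro add_mono X_G_L1 X_comp_L1 s t \<open>d T > 0\<close>)
        also have "\<dots> \<le> rate T + L * (Cmu * \<bar>h\<bar> + B * (1 + \<bar>h\<bar>) * H) / real T"
          using L Cmu_nonneg B_nonneg H_nonneg s(3)
          by (intro add_left_mono divide_right_mono mult_left_mono add_mono mult_right_mono of_int_le_iff[THEN iffD2]) auto
        also have "\<dots> \<le> 1 * r T" using \<open>T > 0\<close> by (simp add: r_def)
        finally show ?thesis .
      qed
      \<comment> \<open>The companion is first taken at the times \<open>t\<close> and
        \<open>t + h\<close>, where it is driven by the same innovations as the array. Stationarity
        then moves the pair to \<open>0\<close> and \<open>h\<close>, as in
        \<open>V\<close>.\<close>
      have "\<bar>cov M (G T (m T) i t) (G T (m T) j (t + h)) - cov M (\<lambda>x. g i (Xc ?u t x)) (\<lambda>x. g j (Xc ?u (t + h) x))\<bar> \<le> C * r T powr (\<delta> / 2)"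
        unfolding C_def
        by (rule cov_close[OF G_Lp[OF t] comp_Lp[OF u] G_Lp[OF s] comp_Lp[OF u] \<delta> rpos[OF \<open>T > 0\<close>] \<open>r T \<le> 1\<close> zero_le_one])
          (use dist t s in auto)
      then show ?thesis by (simp add: acov_def comp_cov_stationary)
    qed
    have "\<bar>lagsum T i j h - b T\<bar> \<le> (\<Sum>t=1..int T. w T t * w T (t + h) * (C * r T powr (\<delta> / 2)))"
      unfolding lagsum_def b_def sum_subtractf[symmetric] right_diff_distrib[symmetric]
    proof (rule order_trans[OF sum_abs sum_mono])
      fix t assume t: "t \<in> {1..int T}"
      show "\<bar>w T t * w T (t + h) * (acov T i j t (t + h) - covc (real_of_int t / real T) i j h)\<bar> \<le> w T t * w T (t + h) * (C * r T powr (\<delta> / 2))"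
      proof (cases "t + h \<in> {1..int T}")
        case True
        then show ?thesis using cov_le[of t] t w_nonneg by (auto simp: abs_mult intro!: mult_left_mono)
      qed (simp add: w_outside)
    qed
    also have "\<dots> \<le> Cw\<^sup>2 * (C * r T powr (\<delta> / 2))"
      unfolding sum_distrib_right[symmetric] using C by (intro mult_right_mono sum_weight_products) auto
    finally show ?thesis .
  qed
  have "(\<lambda>T. lagsum T i j h - b T) \<longlonglongrightarrow> 0"
  proof (rule Lim_null_comparison)
    have "\<forall>\<^sub>F T in sequentially. d T > 0"
      using d_at_top unfolding filterlim_at_top eventually_sequentially by (meson Suc_le_eq)
    moreover have "\<forall>\<^sub>F T in sequentially. r T < 1" using order_tendstoD(2)[OF r_lim] by simp
    moreover have "\<forall>\<^sub>F T in sequentially. T > (0::nat)" by (rule eventually_gt_at_top)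
    ultimately show "\<forall>\<^sub>F T in sequentially. norm (lagsum T i j h - b T) \<le> Cw\<^sup>2 * (C * \<bar>r T\<bar> powr (\<delta> / 2))"
    proof eventually_elim
      case (elim T)
      then show ?case using close[of T] rpos[of T] by simp
    qed
    have "(\<lambda>T. Cw\<^sup>2 * (C * \<bar>r T\<bar> powr (\<delta> / 2))) \<longlonglongrightarrow> Cw\<^sup>2 * (C * 0)"
      using \<delta> by (intro tendsto_mult_left tendsto_zero_powrI[where b="\<delta> / 2"] tendsto_rabs_zero r_lim tendsto_const) auto
    then show "(\<lambda>T. Cw\<^sup>2 * (C * \<bar>r T\<bar> powr (\<delta> / 2))) \<longlonglongrightarrow> 0" by simp
  qed
  from tendsto_add[OF this b] show ?thesis by simp
qed

lemma limcov_summable: "(\<lambda>h. limcov i j h) summable_on UNIV"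
  and lagsum_infsum_lim: "(\<lambda>T. \<Sum>\<^sub>\<infinity>h\<in>UNIV. lagsum T i j h) \<longlonglongrightarrow> (\<Sum>\<^sub>\<infinity>h\<in>UNIV. limcov i j h)"
proof -
  have "(\<lambda>h :: int. Cw\<^sup>2 * (C_dec * q_dec ^ (nat \<bar>h\<bar> div 2))) summable_on UNIV"
    by (intro summable_on_cmult_right summable_half_geometric_int q_dec)
  from tannery_int[of "\<lambda>T. lagsum T i j", OF lagsum_bound this lagsum_lim]
  show "(\<lambda>h. limcov i j h) summable_on UNIV"
    "(\<lambda>T. \<Sum>\<^sub>\<infinity>h\<in>UNIV. lagsum T i j h) \<longlonglongrightarrow> (\<Sum>\<^sub>\<infinity>h\<in>UNIV. limcov i j h)" by auto
qed

text \<open>Identifies the sum over all lags with the double sum of a variance, by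
  \<open>s = t + h\<close>. Pairs with a time outside the range have a zero weight, so lags with
  \<open>\<bar>h\<bar> \<ge> int T\<close> contribute nothing.\<close>

lemma infsum_lagsum:
  "(\<Sum>\<^sub>\<infinity>h\<in>UNIV. lagsum T i j h) = (\<Sum>t=1..int T. \<Sum>s=1..int T. w T t * w T s * acov T i j t s)"
proof -
  have "lagsum T i j h = (if \<bar>h\<bar> < int T then lagsum T i j h else 0)" for h
  proof (cases "\<bar>h\<bar> < int T")
    case False
    have "w T t * w T (t + h) * acov T i j t (t + h) = 0" if "t \<in> {1..int T}" for t
      using False that by (subst w_outside[of "t + h"]) auto
    then have "lagsum T i j h = 0" unfolding lagsum_def by (intro sum.neutral) blast
    then show ?thesis by simp
  qed simp
  then have "(\<Sum>\<^sub>\<infinity>h\<in>UNIV. lagsum T i j h) = (\<Sum>h | \<bar>h\<bar> < int T. lagsum T i j h)"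
    by (subst infsum_finite_support[symmetric]) simp
  also have "\<dots> = (\<Sum>t=1..int T. \<Sum>h | \<bar>h\<bar> < int T. w T t * w T (t + h) * acov T i j t (t + h))"
    unfolding lagsum_def by (rule sum.swap)
  also have "\<dots> = (\<Sum>t=1..int T. \<Sum>s=1..int T. w T t * w T s * acov T i j t s)"
  proof (rule sum.cong[OF refl])
    fix t assume t: "t \<in> {1..int T}"
    have "(\<Sum>h | \<bar>h\<bar> < int T. w T t * w T (t + h) * acov T i j t (t + h)) = (\<Sum>s\<in>{t - int T<..<t + int T}. w T t * w T s * acov T i j t s)"
      by (rule sum.reindex_bij_witness[of _ "\<lambda>s. s - t" "\<lambda>h. t + h"]) auto
    also have "\<dots> = (\<Sum>s=1..int T. w T t * w T s * acov T i j t s)"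
      using t by (intro sum.mono_neutral_right) (auto simp: w_outside)
    finally show "(\<Sum>h | \<bar>h\<bar> < int T. w T t * w T (t + h) * acov T i j t (t + h)) = \<dots>" .
  qed
  finally show ?thesis .
qed

section \<open>The central limit theorem\<close>

text \<open>Centring comes after clipping because clipping changes the mean; the price is the bound
  \<open>2 * c T\<close> in place of \<open>c T\<close>.\<close>

definition Gc :: "nat \<Rightarrow> 'j \<Rightarrow> int \<Rightarrow> 'w \<Rightarrow> real" where
  "Gc T j t x = G T (m T) j t x - (\<integral>x. G T (m T) j t x \<partial>M)"

text \<open>The projection onto \<open>u\<close> reduces the vector statement to scalar sums, as in
  the device of Cramer and Wold.\<close>

definition xi :: "nat \<Rightarrow> real^'j \<Rightarrow> int \<Rightarrow> 'w \<Rightarrow> real" where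
  "xi T u t x = w T t * (\<Sum>j\<in>UNIV. u $ j * Gc T j t x)"

definition psum :: "nat \<Rightarrow> real^'j \<Rightarrow> 'w \<Rightarrow> real" where
  "psum T u x = (\<Sum>t=1..int T. xi T u t x)"

definition V :: "real^'j^'j" where
  "V = (\<chi> i j. \<Sum>\<^sub>\<infinity>h\<in>UNIV. limcov i j h)"

definition Y :: "nat \<Rightarrow> 'w \<Rightarrow> real^'j" where
  "Y T x = (\<chi> j. \<Sum>t=1..int T. w T t *
     (g j (X T t x) - (\<integral>x'. g j (X T t x') \<partial>M)))"

lemma Gc_bound: "\<bar>Gc T j t x\<bar> \<le> 2 * c T"
proof -
  have "\<bar>\<integral>x. G T (m T) j t x \<partial>M\<bar> \<le> (\<integral>x. c T \<partial>M)"
    using norm_expectation_le[of "\<lambda>_. c T" "G T (m T) j t"] G_bound by simp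
  then show ?thesis using G_bound[of T "m T" j t x] by (simp add: Gc_def prob_space)
qed

lemma Gc_measurable [measurable]: "Gc T j t \<in> borel_measurable M"
  unfolding Gc_def[abs_def] by measurable

lemma Gc_mult_integrable: "integrable M (\<lambda>x. Gc T i t x * Gc T j s x)"
proof (rule integrable_bdd[where c="2 * c T * (2 * c T)"])
  show "norm (Gc T i t x * Gc T j s x) \<le> 2 * c T * (2 * c T)" for x
    unfolding real_norm_def abs_mult by (intro mult_mono Gc_bound) (simp_all add: c_nonneg)
qed measurable

lemma acov_Gc: "acov T i j t s = (\<integral>x. Gc T i t x * Gc T j s x \<partial>M)"
  by (simp add: acov_def cov_def Gc_def)

lemma xi_mult:
  "integrable M (\<lambda>x. xi T u t x * xi T u s x)"
  "(\<integral>x. xi T u t x * xi T u s x \<partial>M) = (\<Sum>i\<in>UNIV. \<Sum>j\<in>UNIV. u $ i * u $ j * (w T t * w T s * acov T i j t s))"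
proof -
  have eq: "xi T u t x * xi T u s x = (\<Sum>i\<in>UNIV. \<Sum>j\<in>UNIV. (u $ i * u $ j * (w T t * w T s)) * (Gc T i t x * Gc T j s x))" for x
    by (simp add: xi_def sum_product sum_distrib_left mult_ac)
  show "integrable M (\<lambda>x. xi T u t x * xi T u s x)"
    unfolding eq using Gc_mult_integrable by (intro Bochner_Integration.integrable_sum integrable_mult_right)
  show "(\<integral>x. xi T u t x * xi T u s x \<partial>M) = (\<Sum>i\<in>UNIV. \<Sum>j\<in>UNIV. u $ i * u $ j * (w T t * w T s * acov T i j t s))"
    unfolding eq using Gc_mult_integrable
    by (simp add: Bochner_Integration.integral_sum Bochner_Integration.integrable_sum acov_Gc mult.assoc)
qed

lemma psum_square:
  "integrable M (\<lambda>x. (psum T u x)\<^sup>2)"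
  "(\<integral>x. (psum T u x)\<^sup>2 \<partial>M) = (\<Sum>i\<in>UNIV. \<Sum>j\<in>UNIV. u $ i * u $ j * (\<Sum>\<^sub>\<infinity>h\<in>UNIV. lagsum T i j h))"
proof -
  have eq: "(psum T u x)\<^sup>2 = (\<Sum>t=1..int T. \<Sum>s=1..int T. xi T u t x * xi T u s x)" for x
    by (simp add: psum_def power2_eq_square sum_product)
  show "integrable M (\<lambda>x. (psum T u x)\<^sup>2)"
    unfolding eq by (intro Bochner_Integration.integrable_sum xi_mult)
  have "(\<integral>x. (psum T u x)\<^sup>2 \<partial>M) = (\<Sum>t=1..int T. \<Sum>s=1..int T. \<Sum>i\<in>UNIV. \<Sum>j\<in>UNIV. u $ i * u $ j * (w T t * w T s * acov T i j t s))"
    unfolding eq by (simp add: Bochner_Integration.integral_sum Bochner_Integration.integrable_sum xi_mult)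
  also have "\<dots> = (\<Sum>t=1..int T. \<Sum>i\<in>UNIV. \<Sum>s=1..int T. \<Sum>j\<in>UNIV. u $ i * u $ j * (w T t * w T s * acov T i j t s))"
    by (intro sum.cong refl sum.swap)
  also have "\<dots> = (\<Sum>t=1..int T. \<Sum>i\<in>UNIV. \<Sum>j\<in>UNIV. \<Sum>s=1..int T. u $ i * u $ j * (w T t * w T s * acov T i j t s))"
    by (intro sum.cong refl sum.swap)
  also have "\<dots> = (\<Sum>i\<in>UNIV. \<Sum>t=1..int T. \<Sum>j\<in>UNIV. \<Sum>s=1..int T. u $ i * u $ j * (w T t * w T s * acov T i j t s))"
    by (rule sum.swap)
  also have "\<dots> = (\<Sum>i\<in>UNIV. \<Sum>j\<in>UNIV. \<Sum>t=1..int T. \<Sum>s=1..int T. u $ i * u $ j * (w T t * w T s * acov T i j t s))"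
    by (intro sum.cong refl sum.swap)
  finally show "(\<integral>x. (psum T u x)\<^sup>2 \<partial>M) = (\<Sum>i\<in>UNIV. \<Sum>j\<in>UNIV. u $ i * u $ j * (\<Sum>\<^sub>\<infinity>h\<in>UNIV. lagsum T i j h))"
    by (simp add: infsum_lagsum sum_distrib_left)
qed

lemma quadratic_V: "u \<bullet> (V *v u) = (\<Sum>i\<in>UNIV. \<Sum>j\<in>UNIV. u $ i * u $ j * (\<Sum>\<^sub>\<infinity>h\<in>UNIV. limcov i j h))"
  by (simp add: V_def inner_vec_def matrix_vector_mult_def sum_distrib_left mult_ac)

lemma psum_square_lim: "(\<lambda>T. \<integral>x. (psum T u x)\<^sup>2 \<partial>M) \<longlonglongrightarrow> u \<bullet> (V *v u)"
  unfolding psum_square quadratic_V by (intro tendsto_intros lagsum_infsum_lim)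

lemma V_psd: "u \<bullet> (V *v u) \<ge> 0"
  by (rule LIMSEQ_le_const[OF psum_square_lim]) auto

definition usum :: "real^'j \<Rightarrow> real" where "usum u = (\<Sum>j\<in>UNIV. \<bar>u $ j\<bar>)"

lemma usum_nonneg: "usum u \<ge> 0"
  by (simp add: usum_def sum_nonneg)

lemma xi_bound: "\<bar>xi T u t x\<bar> \<le> Cw / sqrt (real (d T)) * (usum u * (2 * c T))"
proof -
  have "\<bar>\<Sum>j\<in>UNIV. u $ j * Gc T j t x\<bar> \<le> (\<Sum>j\<in>UNIV. \<bar>u $ j\<bar> * (2 * c T))"
    by (rule order_trans[OF sum_abs sum_mono]) (auto simp: abs_mult intro: mult_left_mono Gc_bound)
  then have "\<bar>\<Sum>j\<in>UNIV. u $ j * Gc T j t x\<bar> \<le> usum u * (2 * c T)" by (simp add: usum_def sum_distrib_right)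
  moreover have "\<bar>w T t\<bar> \<le> Cw / sqrt (real (d T))" by (simp only: abs_of_nonneg[OF w_nonneg] Cw_d(2))
  ultimately show ?thesis
    unfolding xi_def abs_mult[of "w T t"] by (intro mult_mono Cw_d(1) abs_ge_zero)
qed

lemma xi_square_sum: "(\<Sum>t=1..int T. \<integral>x. (xi T u t x)\<^sup>2 \<partial>M) \<le> (usum u)\<^sup>2 * (Cw\<^sup>2 * C_dec)"
proof -
  \<comment> \<open>At lag \<open>0\<close> the geometric factor of \<open>acov_decay\<close> is
    \<open>1\<close>, so \<open>C_dec\<close> bounds the variances too. The form
    \<open>t + 0\<close> prepares for \<open>sum_weight_products\<close>.\<close>
  have "(\<integral>x. (xi T u t x)\<^sup>2 \<partial>M) \<le> (usum u)\<^sup>2 * (w T t * w T (t + 0) * C_dec)" if t: "t \<in> {1..int T}" for t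
  proof -
    have "(\<integral>x. (xi T u t x)\<^sup>2 \<partial>M) \<le> (\<Sum>i\<in>UNIV. \<Sum>j\<in>UNIV. \<bar>u $ i\<bar> * \<bar>u $ j\<bar> * (w T t * w T t * C_dec))"
      unfolding power2_eq_square xi_mult(2)
    proof (rule sum_mono, rule sum_mono, rule order_trans[OF abs_ge_self])
      fix i j
      have "\<bar>acov T i j t t\<bar> \<le> C_dec" using acov_decay[of t T t i j] t by simp
      then show "\<bar>u $ i * u $ j * (w T t * w T t * acov T i j t t)\<bar> \<le> \<bar>u $ i\<bar> * \<bar>u $ j\<bar> * (w T t * w T t * C_dec)"
        using w_nonneg by (auto simp: abs_mult intro!: mult_left_mono)
    qed
    also have "\<dots> = (usum u)\<^sup>2 * (w T t * w T (t + 0) * C_dec)"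
      unfolding usum_def power2_eq_square sum_product by (simp only: sum_distrib_right add_0_right)
    finally show ?thesis .
  qed
  then have "(\<Sum>t=1..int T. \<integral>x. (xi T u t x)\<^sup>2 \<partial>M) \<le> (\<Sum>t=1..int T. (usum u)\<^sup>2 * (w T t * w T (t + 0) * C_dec))"
    by (rule sum_mono)
  also have "\<dots> = (usum u)\<^sup>2 * ((\<Sum>t=1..int T. w T t * w T (t + 0)) * C_dec)"
    by (simp add: sum_distrib_left sum_distrib_right)
  also have "\<dots> \<le> (usum u)\<^sup>2 * (Cw\<^sup>2 * C_dec)"
    by (intro mult_left_mono mult_right_mono sum_weight_products C_dec_nonneg) simp
  finally show ?thesis .
qed

lemma psum_measurable [measurable]: "psum T u \<in> borel_measurable M"
  unfolding psum_def[abs_def] xi_def[abs_def] by measurable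

lemma psum_cf_bound:
  "cmod ((\<integral>x. cis (psum T u x) \<partial>M) - complex_of_real (exp (- (\<integral>x. (psum T u x)\<^sup>2 \<partial>M) / 2)))
   \<le> 72 * (real (m T))\<^sup>2 * (Cw / sqrt (real (d T)) * (usum u * (2 * c T))) * ((usum u)\<^sup>2 * (Cw\<^sup>2 * C_dec))"
proof -
  have "cmod ((\<integral>x. cis (psum T u x) \<partial>M) - complex_of_real (exp (- (\<integral>x. (psum T u x)\<^sup>2 \<partial>M) / 2)))
   \<le> 72 * (real (m T))\<^sup>2 * (Cw / sqrt (real (d T)) * (usum u * (2 * c T))) * (\<Sum>t=1..int T. \<integral>x. (xi T u t x)\<^sup>2 \<partial>M)"
    unfolding psum_def
  proof (rule m_dependent_cf_bound)
    show "1 \<le> m T" by (simp add: m_def)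
    show "xi T u t \<in> borel_measurable (block {t - int (m T)<..<t + int (m T)})" for t
      unfolding xi_def[abs_def] Gc_def
      by (intro borel_measurable_times borel_measurable_sum borel_measurable_diff borel_measurable_const G_block)
    show "(\<integral>x. xi T u t x \<partial>M) = 0" for t
      using G_integrable by (simp add: xi_def Gc_def Bochner_Integration.integral_sum prob_space)
    show "0 \<le> Cw / sqrt (real (d T)) * (usum u * (2 * c T))"
      by (intro mult_nonneg_nonneg Cw_d usum_nonneg) (simp_all add: c_nonneg)
  qed (use xi_bound in auto)
  also have "\<dots> \<le> 72 * (real (m T))\<^sup>2 * (Cw / sqrt (real (d T)) * (usum u * (2 * c T))) * ((usum u)\<^sup>2 * (Cw\<^sup>2 * C_dec))"
    by (intro mult_left_mono xi_square_sum mult_nonneg_nonneg Cw_d usum_nonneg) (simp_all add: c_nonneg)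
  finally show ?thesis .
qed

lemma psum_cf_lim: "(\<lambda>T. \<integral>x. cis (psum T u x) \<partial>M) \<longlonglongrightarrow> complex_of_real (exp (- (u \<bullet> (V *v u)) / 2))"
proof -
  have "(\<lambda>T. (\<integral>x. cis (psum T u x) \<partial>M) - complex_of_real (exp (- (\<integral>x. (psum T u x)\<^sup>2 \<partial>M) / 2))) \<longlonglongrightarrow> 0"
  proof (rule Lim_null_comparison[OF always_eventually[OF allI[OF psum_cf_bound]]])
    have "(\<lambda>T. ((real (m T))\<^sup>2 * (c T / sqrt (real (d T)))) * (72 * Cw * usum u * 2 * ((usum u)\<^sup>2 * (Cw\<^sup>2 * C_dec)))) \<longlonglongrightarrow>
      0 * (72 * Cw * usum u * 2 * ((usum u)\<^sup>2 * (Cw\<^sup>2 * C_dec)))"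
      by (intro tendsto_intros rates)
    then show "(\<lambda>T. 72 * (real (m T))\<^sup>2 * (Cw / sqrt (real (d T)) * (usum u * (2 * c T))) * ((usum u)\<^sup>2 * (Cw\<^sup>2 * C_dec))) \<longlonglongrightarrow> 0"
      by (simp add: mult_ac)
  qed
  moreover have "(\<lambda>T. complex_of_real (exp (- (\<integral>x. (psum T u x)\<^sup>2 \<partial>M) / 2))) \<longlonglongrightarrow> complex_of_real (exp (- (u \<bullet> (V *v u)) / 2))"
    by (intro tendsto_intros psum_square_lim) simp
  ultimately show ?thesis using tendsto_add by fastforce
qed

lemma gX_integrable: "t \<in> {1..int T} \<Longrightarrow> integrable M (\<lambda>x. g j (X T t x))"
  using Lp_le_L1(1)[OF mom_X] \<delta> by simp

lemma Y_measurable [measurable]: "Y T \<in> borel_measurable M"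
proof -
  have "(\<lambda>x. \<Sum>j\<in>UNIV. (Y T x $ j) *\<^sub>R (axis j 1 :: real^'j)) \<in> borel_measurable M"
    unfolding Y_def by simp
  moreover have "(\<Sum>j\<in>UNIV. (Y T x $ j) *\<^sub>R (axis j 1 :: real^'j)) = Y T x" for x
    by (simp add: vec_eq_iff axis_def if_distrib cong: if_cong)
  ultimately show ?thesis by simp
qed

lemma Y_integrable: "integrable M (\<lambda>x. Y T x $ j)"
  unfolding Y_def using gX_integrable by (auto intro!: Bochner_Integration.integrable_sum Bochner_Integration.integrable_diff)

text \<open>Each summand is replaced together with its mean, hence the factor \<open>2\<close>; the
  sum of the weights contributes \<open>Cw * sqrt (real (d T))\<close>.\<close>

lemma Y_psum_L1:
  "integrable M (\<lambda>x. u \<bullet> Y T x - psum T u x)"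
  "(\<integral>x. \<bar>u \<bullet> Y T x - psum T u x\<bar> \<partial>M) \<le> 2 * usum u * Cw * (sqrt (real (d T)) * rate T)"
proof -
  define D where "D j t x = g j (X T t x) - G T (m T) j t x" for j t x
  define e where "e j t = (\<integral>x. D j t x \<partial>M)" for j t
  have D_int: "integrable M (D j t)" if "t \<in> {1..int T}" for j t
    unfolding D_def using gX_integrable[OF that] G_integrable by (rule Bochner_Integration.integrable_diff)
  have eq: "u \<bullet> Y T x - psum T u x = (\<Sum>t=1..int T. w T t * (\<Sum>j\<in>UNIV. u $ j * (D j t x - e j t)))" for x
  proof -
    have "u \<bullet> Y T x = (\<Sum>t=1..int T. w T t * (\<Sum>j\<in>UNIV. u $ j * (g j (X T t x) - (\<integral>x'. g j (X T t x') \<partial>M))))"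
      unfolding inner_vec_def Y_def inner_real_def vec_lambda_beta sum_distrib_left
      by (subst sum.swap) (simp add: mult_ac)
    then have "u \<bullet> Y T x - psum T u x = (\<Sum>t=1..int T. w T t * (\<Sum>j\<in>UNIV. u $ j *
        ((g j (X T t x) - (\<integral>x'. g j (X T t x') \<partial>M)) - Gc T j t x)))"
      unfolding psum_def xi_def by (simp add: sum_subtractf right_diff_distrib)
    also have "\<dots> = (\<Sum>t=1..int T. w T t * (\<Sum>j\<in>UNIV. u $ j * (D j t x - e j t)))"
    proof (intro sum.cong refl arg_cong2[where f="(*)"])
      fix t j assume "t \<in> {1..int T}"
      then have "e j t = (\<integral>x'. g j (X T t x') \<partial>M) - (\<integral>x. G T (m T) j t x \<partial>M)"
        unfolding e_def D_def using gX_integrable G_integrable by simp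
      then show "(g j (X T t x) - (\<integral>x'. g j (X T t x') \<partial>M)) - Gc T j t x = D j t x - e j t"
        by (simp add: D_def Gc_def)
    qed
    finally show ?thesis .
  qed
  show int: "integrable M (\<lambda>x. u \<bullet> Y T x - psum T u x)"
    unfolding eq using D_int by (intro Bochner_Integration.integrable_sum integrable_mult_right Bochner_Integration.integrable_diff) auto
  show "(\<integral>x. \<bar>u \<bullet> Y T x - psum T u x\<bar> \<partial>M) \<le> 2 * usum u * Cw * (sqrt (real (d T)) * rate T)"
  proof (cases "d T = 0")
    case True
    \<comment> \<open>Division by zero yields \<open>Cw / sqrt 0 = 0\<close>, so the bound on the
      weights forces all of them to vanish.\<close>
    then have "w T t = 0" for t using Cw_d(2)[of T t] w_nonneg[of T t] by simp
    then show ?thesis unfolding eq using True by simp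
  next
    case False
    have D_le: "(\<integral>x. \<bar>D j t x - e j t\<bar> \<partial>M) \<le> 2 * rate T" if t: "t \<in> {1..int T}" for j t
    proof -
      have 1: "(\<integral>x. \<bar>D j t x\<bar> \<partial>M) \<le> rate T" unfolding D_def using X_G_L1[of t T j] t False by simp
      have "\<bar>e j t\<bar> \<le> (\<integral>x. \<bar>D j t x\<bar> \<partial>M)" unfolding e_def by (rule integral_abs_bound)
      moreover have "(\<integral>x. \<bar>D j t x - e j t\<bar> \<partial>M) \<le> (\<integral>x. \<bar>D j t x\<bar> + \<bar>e j t\<bar> \<partial>M)"
        using D_int[OF t] by (intro integral_mono) auto
      moreover have "(\<integral>x. \<bar>D j t x\<bar> + \<bar>e j t\<bar> \<partial>M) = (\<integral>x. \<bar>D j t x\<bar> \<partial>M) + \<bar>e j t\<bar>"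
        using D_int[OF t] by (simp add: prob_space)
      ultimately show ?thesis using 1 by linarith
    qed
    have "(\<integral>x. \<bar>u \<bullet> Y T x - psum T u x\<bar> \<partial>M) \<le> (\<integral>x. (\<Sum>t=1..int T. w T t * (\<Sum>j\<in>UNIV. \<bar>u $ j\<bar> * \<bar>D j t x - e j t\<bar>)) \<partial>M)"
    proof (rule integral_mono)
      show "integrable M (\<lambda>x. \<bar>u \<bullet> Y T x - psum T u x\<bar>)" using int by simp
      show "integrable M (\<lambda>x. \<Sum>t=1..int T. w T t * (\<Sum>j\<in>UNIV. \<bar>u $ j\<bar> * \<bar>D j t x - e j t\<bar>))"
        using D_int by (intro Bochner_Integration.integrable_sum integrable_mult_right integrable_abs Bochner_Integration.integrable_diff) auto
      show "\<bar>u \<bullet> Y T x - psum T u x\<bar> \<le> (\<Sum>t=1..int T. w T t * (\<Sum>j\<in>UNIV. \<bar>u $ j\<bar> * \<bar>D j t x - e j t\<bar>))" for x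
        unfolding eq
        by (intro order_trans[OF sum_abs sum_mono])
          (auto simp: abs_mult w_nonneg intro!: mult_left_mono order_trans[OF sum_abs sum_mono])
    qed
    also have "\<dots> = (\<Sum>t=1..int T. w T t * (\<Sum>j\<in>UNIV. \<bar>u $ j\<bar> * (\<integral>x. \<bar>D j t x - e j t\<bar> \<partial>M)))"
    proof (subst Bochner_Integration.integral_sum)
      show "integrable M (\<lambda>x. w T t * (\<Sum>j\<in>UNIV. \<bar>u $ j\<bar> * \<bar>D j t x - e j t\<bar>))" if "t \<in> {1..int T}" for t
        using D_int[OF that] by (intro Bochner_Integration.integrable_sum integrable_mult_right integrable_abs Bochner_Integration.integrable_diff) auto
      show "(\<Sum>t=1..int T. \<integral>x. w T t * (\<Sum>j\<in>UNIV. \<bar>u $ j\<bar> * \<bar>D j t x - e j t\<bar>) \<partial>M) =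
        (\<Sum>t=1..int T. w T t * (\<Sum>j\<in>UNIV. \<bar>u $ j\<bar> * (\<integral>x. \<bar>D j t x - e j t\<bar> \<partial>M)))"
      proof (rule sum.cong[OF refl])
        fix t assume t: "t \<in> {1..int T}"
        have "integrable M (\<lambda>x. \<bar>u $ j\<bar> * \<bar>D j t x - e j t\<bar>)" for j using D_int[OF t] by auto
        then show "(\<integral>x. w T t * (\<Sum>j\<in>UNIV. \<bar>u $ j\<bar> * \<bar>D j t x - e j t\<bar>) \<partial>M) =
          w T t * (\<Sum>j\<in>UNIV. \<bar>u $ j\<bar> * (\<integral>x. \<bar>D j t x - e j t\<bar> \<partial>M))"
          using D_int[OF t] by (simp add: Bochner_Integration.integral_sum)
      qed
    qed
    also have "\<dots> \<le> (\<Sum>t=1..int T. w T t * (\<Sum>j\<in>UNIV. \<bar>u $ j\<bar> * (2 * rate T)))"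
      using D_le by (intro sum_mono mult_left_mono w_nonneg) auto
    also have "\<dots> = (\<Sum>t=1..int T. w T t) * (usum u * (2 * rate T))"
      by (simp add: usum_def sum_distrib_right)
    also have "\<dots> \<le> Cw * sqrt (real (d T)) * (usum u * (2 * rate T))"
      by (intro mult_right_mono sum_weights mult_nonneg_nonneg usum_nonneg) (simp_all add: rate_nonneg)
    finally show ?thesis by (simp add: mult_ac)
  qed
qed

lemma Y_psum_lim: "(\<lambda>T. \<integral>x. \<bar>u \<bullet> Y T x - psum T u x\<bar> \<partial>M) \<longlonglongrightarrow> 0"
proof (rule tendsto_sandwich[OF always_eventually always_eventually tendsto_const])
  have "(\<lambda>T. 2 * usum u * Cw * (sqrt (real (d T)) * rate T)) \<longlonglongrightarrow> 2 * usum u * Cw * 0"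
    by (intro tendsto_intros rate_lim)
  then show "(\<lambda>T. 2 * usum u * Cw * (sqrt (real (d T)) * rate T)) \<longlonglongrightarrow> 0" by simp
qed (auto simp: Y_psum_L1)

lemma Y_cf_lim: "(\<lambda>T. \<integral>x. cis (u \<bullet> Y T x) \<partial>M) \<longlonglongrightarrow> complex_of_real (exp (- (u \<bullet> (V *v u)) / 2))"
proof -
  have cis_int: "integrable M (\<lambda>x. cis (Z x))" if "Z \<in> borel_measurable M" for Z
  proof (rule integrable_bdd[where c=1])
    show "(\<lambda>x. cis (Z x)) \<in> borel_measurable M"
      by (rule borel_measurable_continuous_on[OF _ that]) (intro continuous_intros)
  qed simp
  have "(\<lambda>T. (\<integral>x. cis (u \<bullet> Y T x) \<partial>M) - (\<integral>x. cis (psum T u x) \<partial>M)) \<longlonglongrightarrow> 0"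
  proof (rule Lim_null_comparison[OF always_eventually Y_psum_lim], intro allI)
    fix T
    have "(\<integral>x. cis (u \<bullet> Y T x) \<partial>M) - (\<integral>x. cis (psum T u x) \<partial>M) = (\<integral>x. cis (u \<bullet> Y T x) - cis (psum T u x) \<partial>M)"
      by (rule Bochner_Integration.integral_diff[symmetric]; rule cis_int; measurable)
    also have "cmod \<dots> \<le> (\<integral>x. \<bar>u \<bullet> Y T x - psum T u x\<bar> \<partial>M)"
      by (rule norm_expectation_le[OF integrable_abs[OF Y_psum_L1(1)] norm_cis_diff])
    finally show "cmod ((\<integral>x. cis (u \<bullet> Y T x) \<partial>M) - (\<integral>x. cis (psum T u x) \<partial>M)) \<le> (\<integral>x. \<bar>u \<bullet> Y T x - psum T u x\<bar> \<partial>M)" .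
  qed
  from tendsto_add[OF this psum_cf_lim[of u]] show ?thesis by simp
qed

text \<open>\<open>Y\<close> is close to \<open>psum\<close> in L1 only, so the bounded variances of
  \<open>psum\<close> pass to it as a first moment bound, through
  \<open>\<bar>y\<bar> \<le> \<bar>y - p\<bar> + 1 + p\<^sup>2\<close>.\<close>

lemma Y_tight: "\<exists>b. \<forall>T j. (\<integral>x. \<bar>Y T x $ j\<bar> \<partial>M) \<le> b"
proof -
  have "\<exists>b. \<forall>T. (\<integral>x. \<bar>Y T x $ j\<bar> \<partial>M) \<le> b" for j
  proof -
    define u where "u = (axis j 1 :: real^'j)"
    obtain b1 where b1: "\<And>T. \<bar>\<integral>x. \<bar>u \<bullet> Y T x - psum T u x\<bar> \<partial>M\<bar> \<le> b1"
      using convergent_imp_Bseq[OF convergentI[OF Y_psum_lim[of u]]] unfolding Bseq_def real_norm_def by auto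
    obtain b2 where b2: "\<And>T. \<bar>\<integral>x. (psum T u x)\<^sup>2 \<partial>M\<bar> \<le> b2"
      using convergent_imp_Bseq[OF convergentI[OF psum_square_lim[of u]]] unfolding Bseq_def real_norm_def by auto
    have "(\<integral>x. \<bar>Y T x $ j\<bar> \<partial>M) \<le> b1 + (1 + b2)" for T
    proof -
      note int = Y_psum_L1(1)[of u T] psum_square(1)[of T u]
      have "(\<integral>x. \<bar>Y T x $ j\<bar> \<partial>M) \<le> (\<integral>x. \<bar>u \<bullet> Y T x - psum T u x\<bar> + (1 + (psum T u x)\<^sup>2) \<partial>M)"
      proof (rule integral_mono)
        fix x
        have "\<bar>psum T u x\<bar> \<le> 1 + (psum T u x)\<^sup>2"
          using sum_squares_bound[of 1 "\<bar>psum T u x\<bar>"] zero_le_power2[of "psum T u x"] unfolding power2_abs by simp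
        moreover have "Y T x $ j = u \<bullet> Y T x" by (simp add: u_def inner_axis')
        ultimately show "\<bar>Y T x $ j\<bar> \<le> \<bar>u \<bullet> Y T x - psum T u x\<bar> + (1 + (psum T u x)\<^sup>2)" by linarith
      qed (use int Y_integrable in auto)
      also have "\<dots> = (\<integral>x. \<bar>u \<bullet> Y T x - psum T u x\<bar> \<partial>M) + (1 + (\<integral>x. (psum T u x)\<^sup>2 \<partial>M))"
        using int by (simp add: prob_space)
      also have "\<dots> \<le> b1 + (1 + b2)" using b1[of T] b2[of T] by linarith
      finally show ?thesis .
    qed
    then show ?thesis by blast
  qed
  then obtain b where b: "\<And>j T. (\<integral>x. \<bar>Y T x $ j\<bar> \<partial>M) \<le> b j" by metis
  then have "(\<integral>x. \<bar>Y T x $ j\<bar> \<partial>M) \<le> Max (range b)" for T j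
    by (rule order_trans) simp
  then show ?thesis by blast
qed

theorem clt: "\<exists>N. is_normal_0 N V \<and> conv_distr M Y N"
proof -
  obtain N where N: "is_normal_0 N V" using is_normal_0_exists[OF V_psd] by blast
  obtain b where b: "\<And>T j. (\<integral>x. \<bar>Y T x $ j\<bar> \<partial>M) \<le> b" using Y_tight by blast
  have "conv_distr M Y N"
  proof (rule levy_continuity_vec)
    show "(\<lambda>T. \<integral>x. cis (u \<bullet> Y T x) \<partial>M) \<longlonglongrightarrow> (\<integral>x. cis (u \<bullet> x) \<partial>N)" for u
      using Y_cf_lim[of u] N by (simp add: is_normal_0_def)
  qed (use N b Y_integrable prob_space_axioms in \<open>auto simp: is_normal_0_def\<close>)
  then show ?thesis using N by blast
qed

end

section \<open>From the stated assumptions to the locale\<close>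

lemma C1_01_lipschitz:
  assumes "C1_01 h"
  shows "\<exists>c\<ge>0. \<forall>u\<in>{0..1}. \<forall>v\<in>{0..1}. \<bar>h u - h v\<bar> \<le> c * \<bar>u - v\<bar>"
proof -
  obtain h' where h': "continuous_on {0..1} h'" "\<And>u. u \<in> {0..1} \<Longrightarrow> (h has_real_derivative h' u) (at u within {0..1})"
    using assms unfolding C1_01_def by blast
  have "bounded (h' ` {0..1})" using compact_continuous_image[OF h'(1)] compact_imp_bounded by blast
  then obtain c where c: "c > 0" "\<And>u. u \<in> {0..1} \<Longrightarrow> \<bar>h' u\<bar> \<le> c" unfolding bounded_pos by auto
  have "\<bar>h u - h v\<bar> \<le> c * \<bar>u - v\<bar>" if "u \<in> {0..1}" "v \<in> {0..1}" for u v
    using field_differentiable_bound[of "{0..1}" h h' c u v] h'(2) c(2) that by auto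
  then show ?thesis using c(1) by (intro exI[of _ c]) auto
qed

theorem theorem1:
  fixes M :: "'w measure"
    and eps :: "int \<Rightarrow> 'w \<Rightarrow> real^'d"
    and mu :: "real \<Rightarrow> real^'d"
    and A :: "nat \<Rightarrow> int \<Rightarrow> int \<Rightarrow> real^'d^'d"
    and Au :: "real \<Rightarrow> int \<Rightarrow> real^'d^'d"
    and B \<theta> :: real
    and w :: "nat \<Rightarrow> int \<Rightarrow> real"
    and Cw :: real
    and S :: "(ereal^'d) set"
    and \<rho> :: "ereal^'d \<Rightarrow> ereal^'d \<Rightarrow> real"
    and f :: "ereal^'d \<Rightarrow> real^'d \<Rightarrow> real"
    and CLip \<delta> :: real
    and s :: "'j::finite \<Rightarrow> ereal^'d"
  assumes M: "prob_space M"
    \<comment> \<open>(P)(i): i.i.d. centred innovations with finite first absolute moment\<close>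
    and eps_meas: "\<And>t. eps t \<in> borel_measurable M"
    and eps_indep: "prob_space.indep_vars M (\<lambda>_. borel) eps UNIV"
    and eps_ident: "\<And>t. distr M borel (eps t) = distr M borel (eps 0)"
    and eps_int: "integrable M (\<lambda>\<omega>. norm1v (eps 0 \<omega>))"
    and eps_centred: "\<And>t i. (\<integral>\<omega>. eps t \<omega> $ i \<partial>M) = 0"
    \<comment> \<open>(P)(ii) with k = 1\<close>
    and theta: "0 < \<theta>" "\<theta> < 1"
    and A_bound: "\<And>T t j. 1 \<le> t \<Longrightarrow> t \<le> int T \<Longrightarrow> mnorm1 (A T t j) \<le> B * \<theta> ^ nat \<bar>j\<bar>"
    and Au_smooth: "\<And>j p q. \<exists>a'. continuous_on {0..1} a' \<and>
         (\<forall>u\<in>{0..1}. ((\<lambda>v. Au v j $ p $ q) has_real_derivative a' u) (at u within {0..1}) \<and>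
                      \<bar>Au u j $ p $ q\<bar> \<le> B * \<theta> ^ nat \<bar>j\<bar> \<and> \<bar>a' u\<bar> \<le> B * \<theta> ^ nat \<bar>j\<bar>)"
    and A_approx: "\<And>T t j. 1 \<le> t \<Longrightarrow> t \<le> int T \<Longrightarrow>
         real T * mnorm1 (A T t j - Au (real_of_int t / real T) j) \<le> B * \<theta> ^ nat \<bar>j\<bar>"
    \<comment> \<open>(P)(iii)\<close>
    and mu_C1: "\<And>i. C1_01 (\<lambda>u. mu u $ i)"
    \<comment> \<open>(W)\<close>
    and w_nonneg: "\<And>T t. 0 \<le> w T t"
    and w_outside: "\<And>T t. t \<notin> {1..int T} \<Longrightarrow> w T t = 0"
    and w_sup: "\<And>T t. w T t \<le> Cw / sqrt (real (card {t\<in>{1..int T}. w T t \<noteq> 0}))"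
    and dT_inf: "filterlim (\<lambda>T. card {t\<in>{1..int T}. w T t \<noteq> 0}) at_top sequentially"
    \<comment> \<open>(F1)\<close>
    and S_compact: "compact_semimetric S \<rho>"
    and f_Lip: "\<And>x x'. \<forall>sv\<in>S. \<bar>f sv x - f sv x'\<bar> \<le> CLip * norm1v (x - x')"
    and delta: "0 < \<delta>" "\<delta> < 1/2"
    and f_mom_X: "\<exists>K. \<forall>T t sv m. 1 \<le> t \<and> t \<le> int T \<and> sv \<in> S \<longrightarrow>
         (\<integral>\<^sup>+\<omega>. ennreal (\<bar>f sv (lsp_X mu A eps T t \<omega>)\<bar> powr (2 + \<delta>))
                 + ennreal (\<bar>f sv (lsp_XM mu A eps m T t \<omega>)\<bar> powr (2 + \<delta>)) \<partial>M) \<le> ennreal K"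
    and f_mom_comp: "\<exists>K. \<forall>u sv m. u \<in> {0..1} \<and> sv \<in> S \<longrightarrow>
         (\<integral>\<^sup>+\<omega>. ennreal (\<bar>f sv (comp_X mu Au eps u 0 \<omega>)\<bar> powr (2 + \<delta>))
                 + ennreal (\<bar>f sv (comp_XM mu Au eps m u 0 \<omega>)\<bar> powr (2 + \<delta>)) \<partial>M) \<le> ennreal K"
    \<comment> \<open>the points s_1, ..., s_J\<close>
    and s_in: "\<And>j. s j \<in> S"
    \<comment> \<open>the limits over T appearing in the definition of V exist\<close>
    and lim_ex: "\<And>h j1 j2. convergent (\<lambda>T. \<Sum>t=1..int T. w T t * w T (t + h) *
         cov M (\<lambda>\<omega>. f (s j1) (comp_X mu Au eps (real_of_int t / real T) 0 \<omega>))
               (\<lambda>\<omega>. f (s j2) (comp_X mu Au eps (real_of_int t / real T) h \<omega>)))"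
  shows "let Vh = (\<lambda>h j1 j2. lim (\<lambda>T. \<Sum>t=1..int T. w T t * w T (t + h) *
                 cov M (\<lambda>\<omega>. f (s j1) (comp_X mu Au eps (real_of_int t / real T) 0 \<omega>))
                       (\<lambda>\<omega>. f (s j2) (comp_X mu Au eps (real_of_int t / real T) h \<omega>))));
             V = (\<chi> j1 j2. \<Sum>\<^sub>\<infinity>h\<in>UNIV. Vh h j1 j2);
             Y = (\<lambda>T \<omega>. \<chi> j. \<Sum>t=1..int T. w T t *
                   (f (s j) (lsp_X mu A eps T t \<omega>) - (\<integral>\<omega>'. f (s j) (lsp_X mu A eps T t \<omega>') \<partial>M)))
         in (\<forall>j1 j2. (\<lambda>h. Vh h j1 j2) summable_on UNIV) \<and>
            (\<exists>N. is_normal_0 N V \<and> conv_distr M Y N)"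
proof -
  interpret prob_space M by (rule M)
  interpret linear_noise M eps
    by unfold_locales (use eps_meas eps_indep eps_ident eps_int in auto)
  define q where "q = sqrt \<theta>"
  \<comment> \<open>Entrywise bounds become bounds for the column sum norm at the price of the
    dimension; the absolute value allows enlarging constants without knowing the sign of
    \<open>B\<close>.\<close>
  define B' where "B' = real CARD('d) * \<bar>B\<bar>"
  have q: "0 < q" "q < 1" "q\<^sup>2 = \<theta>" using theta by (auto simp: q_def)
  have BB: "B * \<theta> ^ k \<le> B' * \<theta> ^ k" for k
  proof -
    have "B \<le> 1 * \<bar>B\<bar>" by simp
    also have "\<dots> \<le> B'" unfolding B'_def by (intro mult_right_mono) (auto simp: Suc_le_eq)
    finally show ?thesis using theta by (intro mult_right_mono) auto
  qed
  have Au_entry: "\<bar>Au u j $ p $ r\<bar> \<le> \<bar>B\<bar> * \<theta> ^ nat \<bar>j\<bar>" if "u \<in> {0..1}" for u j p r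
  proof -
    have "\<bar>Au u j $ p $ r\<bar> \<le> B * \<theta> ^ nat \<bar>j\<bar>" using Au_smooth[of j p r] that by blast
    also have "\<dots> \<le> \<bar>B\<bar> * \<theta> ^ nat \<bar>j\<bar>" using theta by (intro mult_right_mono) auto
    finally show ?thesis .
  qed
  have Au_entry_lip: "\<bar>Au u j $ p $ r - Au v j $ p $ r\<bar> \<le> \<bar>B\<bar> * \<theta> ^ nat \<bar>j\<bar> * \<bar>u - v\<bar>"
    if uv: "u \<in> {0..1}" "v \<in> {0..1}" for u v j p r
  proof -
    obtain a' where a': "\<And>u. u \<in> {0..1} \<Longrightarrow> ((\<lambda>v. Au v j $ p $ r) has_real_derivative a' u) (at u within {0..1})"
      "\<And>u. u \<in> {0..1} \<Longrightarrow> \<bar>a' u\<bar> \<le> B * \<theta> ^ nat \<bar>j\<bar>"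
      using Au_smooth[of j p r] by blast
    have "norm (Au u j $ p $ r - Au v j $ p $ r) \<le> B * \<theta> ^ nat \<bar>j\<bar> * norm (u - v)"
      by (rule field_differentiable_bound[where f' = a', OF convex_real_interval(5)]) (use a' uv in auto)
    also have "\<dots> \<le> \<bar>B\<bar> * \<theta> ^ nat \<bar>j\<bar> * norm (u - v)" using theta by (intro mult_right_mono) auto
    finally show ?thesis by simp
  qed
  obtain cm where cm: "\<And>i. cm i \<ge> 0" "\<And>i u v. u \<in> {0..1} \<Longrightarrow> v \<in> {0..1} \<Longrightarrow> \<bar>mu u $ i - mu v $ i\<bar> \<le> cm i * \<bar>u - v\<bar>"
    using C1_01_lipschitz[OF mu_C1] by metis
  obtain K1 where K1: "\<And>T t sv m. 1 \<le> t \<Longrightarrow> t \<le> int T \<Longrightarrow> sv \<in> S \<Longrightarrow>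
         (\<integral>\<^sup>+\<omega>. ennreal (\<bar>f sv (lsp_X mu A eps T t \<omega>)\<bar> powr (2 + \<delta>))
                 + ennreal (\<bar>f sv (lsp_XM mu A eps m T t \<omega>)\<bar> powr (2 + \<delta>)) \<partial>M) \<le> ennreal K1"
    using f_mom_X by blast
  obtain K2 where K2: "\<And>u sv m. u \<in> {0..1} \<Longrightarrow> sv \<in> S \<Longrightarrow>
         (\<integral>\<^sup>+\<omega>. ennreal (\<bar>f sv (comp_X mu Au eps u 0 \<omega>)\<bar> powr (2 + \<delta>))
                 + ennreal (\<bar>f sv (comp_XM mu Au eps m u 0 \<omega>)\<bar> powr (2 + \<delta>)) \<partial>M) \<le> ennreal K2"
    using f_mom_comp by blast
  \<comment> \<open>One nonnegative constant for all moments. The maximum with \<open>0\<close>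
    matters because \<open>ennreal\<close> sends negative reals to \<open>0\<close>.\<close>
  define K where "K = max 0 (max K1 K2)"
  have K: "K \<ge> 0" "ennreal K1 \<le> ennreal K" "ennreal K2 \<le> ennreal K" by (auto simp: K_def intro: ennreal_leI)
  have f_lip: "\<bar>f (s j) x - f (s j) y\<bar> \<le> \<bar>CLip\<bar> * norm1v (x - y)" for j x y
  proof -
    have "\<bar>f (s j) x - f (s j) y\<bar> \<le> CLip * norm1v (x - y)" using f_Lip s_in by blast
    also have "\<dots> \<le> \<bar>CLip\<bar> * norm1v (x - y)" by (intro mult_right_mono) auto
    finally show ?thesis .
  qed
  note [measurable] = borel_measurable_lipschitz1[OF f_lip]
  have [measurable]: "lsp_X mu A eps T t \<in> borel_measurable M" for T t
    using lin_measurable[of "A T t" t] unfolding lin_def[abs_def] lsp_X_def[abs_def] by measurable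
  have [measurable]: "lsp_XM mu A eps m T t \<in> borel_measurable M" for T t m
    using lin_measurable[of "trunc m (A T t)" t] unfolding lin_trunc[abs_def] lsp_XM_def[abs_def] by measurable
  have [measurable]: "comp_X mu Au eps u t \<in> borel_measurable M" for u t
    using lin_measurable[of "Au u" t] unfolding lin_def[abs_def] comp_X_def[abs_def] by measurable
  interpret lsp M eps mu A Au B' q "\<Sum>i\<in>UNIV. cm i" w Cw "\<lambda>j. f (s j)" "\<bar>CLip\<bar>" \<delta> K
  proof unfold_locales
    show "mnorm1 (A T t j) \<le> B' * (q\<^sup>2) ^ nat \<bar>j\<bar>" if "1 \<le> t" "t \<le> int T" for T t j
      unfolding q(3) by (rule order_trans[OF A_bound[OF that] BB])
    show "real T * mnorm1 (A T t j - Au (real_of_int t / real T) j) \<le> B' * (q\<^sup>2) ^ nat \<bar>j\<bar>"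
      if "1 \<le> t" "t \<le> int T" for T t j
      unfolding q(3) by (rule order_trans[OF A_approx[OF that] BB])
    show "mnorm1 (Au u j) \<le> B' * (q\<^sup>2) ^ nat \<bar>j\<bar>" if "u \<in> {0..1}" for u j
      using mnorm1_le_entries[OF Au_entry[OF that, of j]] unfolding q(3) B'_def by (simp add: mult.assoc)
    show "mnorm1 (Au u j - Au v j) \<le> B' * (q\<^sup>2) ^ nat \<bar>j\<bar> * \<bar>u - v\<bar>" if "u \<in> {0..1}" "v \<in> {0..1}" for u v j
      using mnorm1_le_entries[of "Au u j - Au v j", simplified, OF Au_entry_lip[OF that]] unfolding q(3) B'_def by (simp add: mult.assoc)
    show "norm1v (mu u - mu v) \<le> (\<Sum>i\<in>UNIV. cm i) * \<bar>u - v\<bar>" if "u \<in> {0..1}" "v \<in> {0..1}" for u v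
      using cm(2)[OF that] by (simp add: norm1v_def sum_distrib_right sum_mono)
    show "Lp_le (2 + \<delta>) K (\<lambda>\<omega>. f (s j) (lsp_X mu A eps T t \<omega>))" if t: "1 \<le> t" "t \<le> int T" for j T t
    proof (rule Lp_leI_nn[OF _ order_trans[OF _ order_trans[OF K1[OF t s_in, of j] K(2)]] K(1)])
      \<comment> \<open>The assumption bounds two nonnegative terms jointly, so either may be
        dropped; the truncation index \<open>0\<close> is an arbitrary choice.\<close>
      show "(\<integral>\<^sup>+\<omega>. ennreal (\<bar>f (s j) (lsp_X mu A eps T t \<omega>)\<bar> powr (2 + \<delta>)) \<partial>M) \<le>
        (\<integral>\<^sup>+\<omega>. ennreal (\<bar>f (s j) (lsp_X mu A eps T t \<omega>)\<bar> powr (2 + \<delta>))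
                 + ennreal (\<bar>f (s j) (lsp_XM mu A eps 0 T t \<omega>)\<bar> powr (2 + \<delta>)) \<partial>M)"
        by (rule nn_integral_mono) simp
    qed measurable
    show "Lp_le (2 + \<delta>) K (\<lambda>\<omega>. f (s j) (lsp_XM mu A eps m T t \<omega>))" if t: "1 \<le> t" "t \<le> int T" for j T t m
    proof (rule Lp_leI_nn[OF _ order_trans[OF _ order_trans[OF K1[OF t s_in, of j] K(2)]] K(1)])
      show "(\<integral>\<^sup>+\<omega>. ennreal (\<bar>f (s j) (lsp_XM mu A eps m T t \<omega>)\<bar> powr (2 + \<delta>)) \<partial>M) \<le>
        (\<integral>\<^sup>+\<omega>. ennreal (\<bar>f (s j) (lsp_X mu A eps T t \<omega>)\<bar> powr (2 + \<delta>))
                 + ennreal (\<bar>f (s j) (lsp_XM mu A eps m T t \<omega>)\<bar> powr (2 + \<delta>)) \<partial>M)"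
        by (rule nn_integral_mono) simp
    qed measurable
    show "Lp_le (2 + \<delta>) K (\<lambda>\<omega>. f (s j) (comp_X mu Au eps u 0 \<omega>))" if u: "u \<in> {0..1}" for j u
    proof (rule Lp_leI_nn[OF _ order_trans[OF _ order_trans[OF K2[OF u s_in, of j] K(3)]] K(1)])
      show "(\<integral>\<^sup>+\<omega>. ennreal (\<bar>f (s j) (comp_X mu Au eps u 0 \<omega>)\<bar> powr (2 + \<delta>)) \<partial>M) \<le>
        (\<integral>\<^sup>+\<omega>. ennreal (\<bar>f (s j) (comp_X mu Au eps u 0 \<omega>)\<bar> powr (2 + \<delta>))
                 + ennreal (\<bar>f (s j) (comp_XM mu Au eps 0 u 0 \<omega>)\<bar> powr (2 + \<delta>)) \<partial>M)"
        by (rule nn_integral_mono) simp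
    qed measurable
  qed (use q delta w_nonneg w_outside w_sup dT_inf f_lip lim_ex in auto)
  show ?thesis
    unfolding Let_def limcov_def[symmetric] V_def[symmetric] Y_def[abs_def, symmetric]
    using limcov_summable clt by blast
qed

end
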